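(* Let $M$ be a pure abelian T-motive over $\mathbb F_q[T]$ of rank $r$ and dimension $n$, and let $m\ge1$ be an integer with $(T-\theta)^m(M/\tau M)=0$. If $rm-n>0$, then the $m$-dual $M'$ of $M$ exists (as an abelian T-motive), and $M'$ is pure.
   Context: $\mathbb C_\infty$ is the completion of an algebraic closure of $\mathbb F_q((1/\theta))$; $\mathbb C_\infty[T,\tau]$ has relations $Ta=aT$, $T\tau=\tau T$, $\tau a=a^q\tau$. An abelian T-motive is a left $\mathbb C_\infty[T,\tau]$-module free and finitely generated over $\mathbb C_\infty[T]$ (rank $r$) and over $\mathbb C_\infty[\tau]$ (dimension $n$) with $(T-\theta)^m(M/\tau M)=0$ for some $m$. For $\mu\ge1$, the $\mu$-dual of $M$: choosing a $\mathbb C_\infty[T]$-basis $f_*$ of $M$ with $\tau f_*=Qf_*$, an abelian T-motive $M'$ is the $\mu$-dual if it has a $\mathbb C_\infty[T]$-basis $f'_*$ with $\tau f'_*=(T-\theta)^\mu(Q^t)^{-1}f'_*$ (equivalently $M'\otimes\mathbb C_\infty(T)\cong\mathrm{Hom}_{\mathbb C_\infty(T)}(M\otimes\mathbb C_\infty(T),\mathfrak C^{\otimes\mu}\otimes\mathbb C_\infty(T))$ with $\tau\varphi=\tau\circ\varphi\circ\tau^{-1}$, $\mathfrak C$ the Carlitz motive $\tau\mathfrak f=(T-\theta)\mathfrak f$). $M$ is pure if there are a finitely generated $\mathbb C_\infty[[1/T]]$-submodule $W\subset M\otimes_{\mathbb C_\infty[T]}\mathbb C_\infty((1/T))$ spanning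 it and integers $u,v>0$ such that the $\mathbb C_\infty[[1/T]]$-span of $\tau^v(W)$ equals $T^uW$. *)

theory Defs
  imports
    "HOL-Analysis.Analysis"
    "HOL-Library.Poly_Mapping"
    "HOL-Computational_Algebra.Computational_Algebra"
    "HOL-Algebra.Algebraic_Closure_Type"
    "Jordan_Normal_Form.Ring_Hom_Matrix"
begin

section \<open>The field \<open>\<complex>\<^sub>\<infinity>\<close>\<close>

text \<open>
  The finite field is a type \<open>'f\<close> and \<open>q = CARD('f)\<close>. The field of Laurent series in \<open>1/\<theta>\<close> is
  \<open>'f fls\<close>, whose variable \<open>fls_X\<close> stands for \<open>1/\<theta>\<close>.
\<close>

definition laurent_abs :: "'f::{field,finite} fls \<Rightarrow> real" where
  "laurent_abs f = (if f = 0 then 0 else real CARD('f) powi (- fls_subdegree f))"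

text \<open>
  A field \<open>'c\<close> with absolute value \<open>av\<close> and embedding \<open>emb\<close> is a completion of the algebraic
  closure of \<open>'f fls\<close> with respect to the absolute value extending \<open>laurent_abs\<close>.
  The extension is unique because \<open>'f fls\<close> is complete, so these data are unique up to isomorphism.
\<close>

locale C_infinity =
  emb: field_hom emb
  for emb :: "'f::{field,finite} fls alg_closure \<Rightarrow> 'c::field" +
  fixes av :: "'c \<Rightarrow> real"
  assumes av_nonneg: "av x \<ge> 0"
    and av_eq_0_iff: "av x = 0 \<longleftrightarrow> x = 0"
    and av_mult: "av (x * y) = av x * av y"
    and av_ultrametric: "av (x + y) \<le> max (av x) (av y)"
    and av_extends: "av (emb (to_ac f)) = laurent_abs f"
    and complete: "Metric_space.mcomplete UNIV (\<lambda>x y. av (x - y))"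
    and dense: "Metric_space.mtopology UNIV (\<lambda>x y. av (x - y)) closure_of range emb = UNIV"

definition theta :: "('f::{field,finite} fls alg_closure \<Rightarrow> 'c::field) \<Rightarrow> 'c" where
  "theta emb = emb (to_ac fls_X_inv)"


section \<open>The ring \<open>\<complex>\<^sub>\<infinity>[T,\<tau>]\<close> and its left modules\<close>

text \<open>
  An element \<open>\<Sum>\<^sub>i a\<^sub>i \<tau>\<^sup>i\<close> with \<open>a\<^sub>i \<in> \<complex>\<^sub>\<infinity>[T]\<close> is represented by the element of \<open>'c poly poly\<close> with
  coefficients \<open>a\<^sub>i\<close>; the addition is that of \<open>'c poly poly\<close>, the multiplication is \<open>skew_mult\<close>.
\<close>

definition frob_poly :: "nat \<Rightarrow> 'c::field poly \<Rightarrow> 'c poly" where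
  "frob_poly q = map_poly (\<lambda>a. a ^ q)"

definition skew_mult :: "nat \<Rightarrow> 'c::field poly poly \<Rightarrow> 'c poly poly \<Rightarrow> 'c poly poly" where
  "skew_mult q x y =
     (\<Sum>i\<le>Polynomial.degree x. \<Sum>j\<le>Polynomial.degree y.
        Polynomial.monom
          (Polynomial.coeff x i * (frob_poly q ^^ i) (Polynomial.coeff y j)) (i + j))"

definition sk_const :: "'c::field \<Rightarrow> 'c poly poly" where "sk_const a = [:[:a:]:]"
definition sk_T :: "'c::field poly poly" where "sk_T = [:[:0, 1:]:]"
definition sk_tau :: "'c::field poly poly" where "sk_tau = [:0, 1:]"

definition sk_ring_T :: "'c::field poly poly set" where
  "sk_ring_T = range (\<lambda>p. [:p:])"

definition sk_ring_tau :: "'c::field poly poly set" where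
  "sk_ring_tau = range (map_poly (\<lambda>a. [:a:]))"

lemma skew_relations:
  assumes "q > 0"
  shows "skew_mult q sk_T (sk_const a) = skew_mult q (sk_const a) sk_T"
    and "skew_mult q sk_T sk_tau = skew_mult q sk_tau sk_T"
    and "skew_mult q sk_tau (sk_const a) = skew_mult q (sk_const (a ^ q)) sk_tau"
  using assms
  by (simp_all add: skew_mult_def sk_T_def sk_const_def sk_tau_def frob_poly_def map_poly_pCons)

text \<open>The module is the whole type \<open>'m\<close>; only the action of the ring is explicit.\<close>

definition skew_module :: "nat \<Rightarrow> ('c::field poly poly \<Rightarrow> 'm::ab_group_add \<Rightarrow> 'm) \<Rightarrow> bool" where
  "skew_module q act \<longleftrightarrow>
     (\<forall>a x y. act a (x + y) = act a x + act a y) \<and>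
     (\<forall>a b x. act (a + b) x = act a x + act b x) \<and>
     (\<forall>a b x. act (skew_mult q a b) x = act a (act b x)) \<and>
     (\<forall>x. act 1 x = x)"

text \<open>\<open>b 0, \<dots>, b (d - 1)\<close> is a basis of the module over the subring \<open>S\<close>.\<close>

definition is_basis ::
  "('s::zero \<Rightarrow> 'm::ab_group_add \<Rightarrow> 'm) \<Rightarrow> 's set \<Rightarrow> nat \<Rightarrow> (nat \<Rightarrow> 'm) \<Rightarrow> bool" where
  "is_basis act S d b \<longleftrightarrow>
     (\<forall>x. \<exists>c. (\<forall>i<d. c i \<in> S) \<and> x = (\<Sum>i<d. act (c i) (b i))) \<and>
     (\<forall>c. (\<forall>i<d. c i \<in> S) \<and> (\<Sum>i<d. act (c i) (b i)) = 0 \<longrightarrow> (\<forall>i<d. c i = 0))"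


section \<open>Abelian T-motives\<close>

text \<open>
  \<open>(T - \<theta>)\<^sup>m (M/\<tau>M) = 0\<close>, that is, \<open>(T - \<theta>)\<^sup>m M \<subseteq> \<tau>M\<close>.
\<close>

definition kills_coker ::
  "'c::field \<Rightarrow> nat \<Rightarrow> ('c poly poly \<Rightarrow> 'm::ab_group_add \<Rightarrow> 'm) \<Rightarrow> bool" where
  "kills_coker \<theta> m act \<longleftrightarrow> range (act [:[:- \<theta>, 1:] ^ m:]) \<subseteq> range (act sk_tau)"

definition abelian_T_motive ::
  "nat \<Rightarrow> 'c::field \<Rightarrow> nat \<Rightarrow> nat \<Rightarrow> ('c poly poly \<Rightarrow> 'm::ab_group_add \<Rightarrow> 'm) \<Rightarrow> bool" where
  "abelian_T_motive q \<theta> r n act \<longleftrightarrow>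
     skew_module q act \<and>
     (\<exists>f. is_basis act sk_ring_T r f) \<and>
     (\<exists>g. is_basis act sk_ring_tau n g) \<and>
     (\<exists>m. kills_coker \<theta> m act)"

text \<open>\<open>\<tau> f\<^sub>* = Q f\<^sub>*\<close>, where \<open>f\<^sub>*\<close> is a column of length \<open>r\<close>.\<close>

definition tau_matrix ::
  "('c::field poly poly \<Rightarrow> 'm::ab_group_add \<Rightarrow> 'm) \<Rightarrow> nat \<Rightarrow> (nat \<Rightarrow> 'm) \<Rightarrow> 'c poly mat \<Rightarrow> bool" where
  "tau_matrix act r f Q \<longleftrightarrow>
     Q \<in> carrier_mat r r \<and> (\<forall>i<r. act sk_tau (f i) = (\<Sum>j<r. act [:Q $$ (i, j):] (f j)))"

text \<open>
  The matrix of \<open>M'\<close> is \<open>Q' = (T - \<theta>)\<^sup>\<mu> (Q\<^sup>t)\<^sup>-\<^sup>1\<close>, where the inverse \<open>R\<close> is taken over \<open>\<complex>\<^sub>\<infinity>(T)\<close>.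
\<close>

definition is_mu_dual ::
  "nat \<Rightarrow> 'c::field \<Rightarrow> nat \<Rightarrow> ('c poly poly \<Rightarrow> 'm::ab_group_add \<Rightarrow> 'm) \<Rightarrow>
     ('c poly poly \<Rightarrow> 'n::ab_group_add \<Rightarrow> 'n) \<Rightarrow> bool" where
  "is_mu_dual q \<theta> \<mu> M M' \<longleftrightarrow>
     (\<exists>r' n'. abelian_T_motive q \<theta> r' n' M') \<and>
     (\<exists>r f Q f' Q' R.
        is_basis M sk_ring_T r f \<and> tau_matrix M r f Q \<and>
        is_basis M' sk_ring_T r f' \<and> tau_matrix M' r f' Q' \<and>
        R \<in> carrier_mat r r \<and>
        inverts_mat (transpose_mat (map_mat to_fract Q)) R \<and>
        inverts_mat R (transpose_mat (map_mat to_fract Q)) \<and>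
        map_mat to_fract Q' = to_fract ([:- \<theta>, 1:] ^ \<mu>) \<cdot>\<^sub>m R)"


section \<open>Purity\<close>

text \<open>
  The field \<open>\<complex>\<^sub>\<infinity>((1/T))\<close> is \<open>'c fls\<close>, whose variable \<open>fls_X\<close> stands for \<open>1/T\<close>. So
  \<open>\<complex>\<^sub>\<infinity>[[1/T]]\<close> is \<open>range fps_to_fls\<close>, and \<open>\<complex>\<^sub>\<infinity>[T]\<close> is embedded by \<open>T \<mapsto> fls_X_inv\<close>.
\<close>

definition poly_to_fls_inv :: "'c::field poly \<Rightarrow> 'c fls" where
  "poly_to_fls_inv p = poly (map_poly fls_const p) fls_X_inv"

definition frob_fls :: "nat \<Rightarrow> 'c::field fls \<Rightarrow> 'c fls" where
  "frob_fls q k = Abs_fls (\<lambda>i. fls_nth k i ^ q)"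

text \<open>
  \<open>M \<otimes>\<^bsub>\<complex>\<^sub>\<infinity>[T]\<^esub> \<complex>\<^sub>\<infinity>((1/T))\<close> is the free abelian group on \<open>M \<times> \<complex>\<^sub>\<infinity>((1/T))\<close> modulo the subgroup
  generated by the bilinearity relations; its elements are cosets of this subgroup.
\<close>

definition tensor_null ::
  "('c::field poly poly \<Rightarrow> 'm::ab_group_add \<Rightarrow> 'm) \<Rightarrow> ('m \<times> 'c fls \<Rightarrow>\<^sub>0 int) set" where
  "tensor_null act = group_closure
     ({frag_of (x + y, k) - frag_of (x, k) - frag_of (y, k) | x y k. True} \<union>
      {frag_of (x, k + l) - frag_of (x, k) - frag_of (x, l) | x k l. True} \<union>
      {frag_of (act [:p:] x, k) - frag_of (x, poly_to_fls_inv p * k) | p x k. True})"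

definition tensor_class ::
  "('c::field poly poly \<Rightarrow> 'm::ab_group_add \<Rightarrow> 'm) \<Rightarrow>
     ('m \<times> 'c fls \<Rightarrow>\<^sub>0 int) \<Rightarrow> ('m \<times> 'c fls \<Rightarrow>\<^sub>0 int) set" where
  "tensor_class act z = {w. w - z \<in> tensor_null act}"

definition tensor_space ::
  "('c::field poly poly \<Rightarrow> 'm::ab_group_add \<Rightarrow> 'm) \<Rightarrow> ('m \<times> 'c fls \<Rightarrow>\<^sub>0 int) set set" where
  "tensor_space act = range (tensor_class act)"

definition tensor_add ::
  "('m \<times> 'c::field fls \<Rightarrow>\<^sub>0 int) set \<Rightarrow> ('m \<times> 'c fls \<Rightarrow>\<^sub>0 int) set \<Rightarrow>
     ('m \<times> 'c fls \<Rightarrow>\<^sub>0 int) set" where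
  "tensor_add A B = {a + b | a b. a \<in> A \<and> b \<in> B}"

text \<open>
  The map on classes induced by a map \<open>h\<close> of the generators. For the maps \<open>h\<close> used below, which
  preserve the bilinearity relations, all classes in the union are equal.
\<close>

definition tensor_map ::
  "('c::field poly poly \<Rightarrow> 'm::ab_group_add \<Rightarrow> 'm) \<Rightarrow> ('m \<times> 'c fls \<Rightarrow> 'm \<times> 'c fls) \<Rightarrow>
     ('m \<times> 'c fls \<Rightarrow>\<^sub>0 int) set \<Rightarrow> ('m \<times> 'c fls \<Rightarrow>\<^sub>0 int) set" where
  "tensor_map act h A = (\<Union>z\<in>A. tensor_class act (frag_extend (\<lambda>e. frag_of (h e)) z))"

definition tensor_scale ::
  "('c::field poly poly \<Rightarrow> 'm::ab_group_add \<Rightarrow> 'm) \<Rightarrow> 'c fls \<Rightarrow>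
     ('m \<times> 'c fls \<Rightarrow>\<^sub>0 int) set \<Rightarrow> ('m \<times> 'c fls \<Rightarrow>\<^sub>0 int) set" where
  "tensor_scale act c = tensor_map act (\<lambda>(x, k). (x, c * k))"

definition tensor_tau ::
  "nat \<Rightarrow> ('c::field poly poly \<Rightarrow> 'm::ab_group_add \<Rightarrow> 'm) \<Rightarrow>
     ('m \<times> 'c fls \<Rightarrow>\<^sub>0 int) set \<Rightarrow> ('m \<times> 'c fls \<Rightarrow>\<^sub>0 int) set" where
  "tensor_tau q act = tensor_map act (\<lambda>(x, k). (act sk_tau x, frob_fls q k))"

inductive_set tensor_span ::
  "('c::field poly poly \<Rightarrow> 'm::ab_group_add \<Rightarrow> 'm) \<Rightarrow> 'c fls set \<Rightarrow>
     ('m \<times> 'c fls \<Rightarrow>\<^sub>0 int) set set \<Rightarrow> ('m \<times> 'c fls \<Rightarrow>\<^sub>0 int) set set"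
  for act S G where
  zero: "tensor_class act 0 \<in> tensor_span act S G"
| add: "c \<in> S \<Longrightarrow> A \<in> G \<Longrightarrow> B \<in> tensor_span act S G \<Longrightarrow>
         tensor_add (tensor_scale act c A) B \<in> tensor_span act S G"

definition pure_motive ::
  "nat \<Rightarrow> ('c::field poly poly \<Rightarrow> 'm::ab_group_add \<Rightarrow> 'm) \<Rightarrow> bool" where
  "pure_motive q act \<longleftrightarrow>
     (\<exists>W G u v.
        finite G \<and> G \<subseteq> tensor_space act \<and> W = tensor_span act (range fps_to_fls) G \<and>
        tensor_span act UNIV W = tensor_space act \<and>
        u > 0 \<and> v > 0 \<and>
        tensor_span act (range fps_to_fls) ((tensor_tau q act ^^ v) ` W) =
          tensor_scale act (fls_X_inv ^ u) ` W)"

end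

theory Submission
  imports Defs "Jordan_Normal_Form.Determinant"
begin

text \<open>
  Write \<open>L = \<complex>\<^sub>\<infinity>((1/T))\<close>, \<open>O = \<complex>\<^sub>\<infinity>[[1/T]]\<close> and \<open>\<sigma>\<close> for the coefficientwise \<open>q\<close>-th power. In terms of a
  \<open>\<complex>\<^sub>\<infinity>[T]\<close>-basis with \<open>\<tau> f = Q f\<close>, purity says that \<open>\<sigma>\<^sup>v(P) Q\<^sub>v = T\<^sup>u U P\<close> for some \<open>P \<in> GL\<^sub>r(L)\<close> and
  \<open>U \<in> GL\<^sub>r(O)\<close>, where \<open>Q\<^sub>v = \<sigma>\<^sup>v\<^sup>-\<^sup>1(Q) \<cdots> \<sigma>(Q) Q\<close> is the matrix of \<open>\<tau>\<^sup>v\<close>. Since \<open>(T - \<theta>)\<^sup>m M \<subseteq> \<tau>M\<close>,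
  the matrix \<open>Q' = (T - \<theta>)\<^sup>m (Q\<^sup>t)\<^sup>-\<^sup>1\<close> is polynomial, and passing to inverse transposes shows that
  \<open>Q'\<close> satisfies the purity equation with \<open>u' = mv - u\<close>.

  The lattice with basis \<open>P\<close> gives a filtration of \<open>M\<close> by finite-dimensional \<open>\<complex>\<^sub>\<infinity>\<close>-spaces for which
  \<open>T\<close> and \<open>\<tau>\<close> shift levels by \<open>v\<close> and \<open>u\<close>. Computing its growth from a basis over \<open>\<complex>\<^sub>\<infinity>[T]\<close> and from
  one over \<open>\<complex>\<^sub>\<infinity>[\<tau>]\<close> gives \<open>ru \<le> nv\<close>, hence \<open>u' > 0\<close>. For the dual, the same filtration with
  \<open>u' > 0\<close> yields a \<open>\<complex>\<^sub>\<infinity>[\<tau>]\<close>-basis by successive minima, because \<open>\<complex>\<^sub>\<infinity>\<close> is perfect.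
\<close>


section \<open>The Frobenius of \<open>\<complex>\<^sub>\<infinity>\<close>\<close>

text \<open>The matrix \<open>Q'\<close> by itself yields only a free
  \<open>\<complex>\<^sub>\<infinity>[T]\<close>-module with a semilinear map. The obstacle is a
  finite basis over \<open>\<complex>\<^sub>\<infinity>[\<tau>]\<close>, which a basis over
  \<open>\<complex>\<^sub>\<infinity>[T]\<close> does not show. Hence purity of the dual is
  established first and then used to build that basis. The sign of \<open>u'\<close> decides: when
  it is positive, \<tau> strictly raises levels, so below each level there are finitely many
  products \<open>\<tau>^j b_i\<close>, leading terms can be compared, and counting dimensions
  bounds the length of a reduced family by \<open>r * u'\<close>.

  The inequality for \<open>u\<close> compares slopes. The products \<open>T^j f_i\<close> make the
  dimension of level \<open>k\<close> grow at least like \<open>r k / v\<close>, while a basis over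
  \<open>\<complex>\<^sub>\<infinity>[\<tau>]\<close> allows at most \<open>n k / u\<close>. With
  \<open>n < r m\<close> this gives \<open>r u \<le> n v < r m v\<close>.

  Perfectness takes the place of division: a leading coefficient passes through
  \<open>\<tau>^d\<close> only as a \<open>q^d\<close>-th root. For the completion it is obtained by
  approximation from the dense algebraically closed subfield.\<close>

lemma finite_field_power_card:
  fixes x :: "'f::{field,finite}"
  shows "x ^ CARD('f) = x"
proof (cases "x = 0")
  case False
  let ?U = "UNIV - {0::'f}"
  have "bij_betw ((*) x) ?U ?U"
    using False by (intro bij_betwI[of _ _ _ "\<lambda>y. y / x"]) auto
  then have "(\<Prod>y\<in>?U. x * y) = \<Prod>?U"
    by (rule prod.reindex_bij_betw)
  then have "x ^ card ?U * \<Prod>?U = 1 * \<Prod>?U"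
    by (simp add: prod.distrib)
  moreover have "\<Prod>?U \<noteq> 0" by simp
  ultimately have "x ^ card ?U = 1"
    by (metis mult_right_cancel)
  moreover have "CARD('f) = Suc (card ?U)"
    by (simp add: card_Diff_singleton)
  ultimately show ?thesis by (simp only: power_Suc mult_1_right)
qed (simp add: zero_power)

text \<open>
  The polynomial \<open>(X + 1)\<^sup>q - X\<^sup>q - 1\<close> has degree less than \<open>q\<close> and vanishes on the field with
  \<open>q\<close> elements, so its coefficients are zero.
\<close>

lemma of_nat_card_choose_eq_0:
  assumes "0 < i" "i < CARD('f::{field,finite})"
  shows "of_nat (CARD('f) choose i) = (0::'f)"
proof -
  let ?q = "CARD('f)"
  define p :: "'f poly" where
    "p = (\<Sum>j\<in>{0<..<?q}. Polynomial.monom (of_nat (?q choose j)) j)"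
  have "poly p x = 0" for x
  proof -
    have "{..?q} = {0<..<?q} \<union> {0, ?q}" by auto
    then have "(x + 1) ^ ?q = (\<Sum>k\<in>{0<..<?q} \<union> {0, ?q}. of_nat (?q choose k) * x ^ k)"
      by (simp add: binomial_ring)
    also have "\<dots> = poly p x + (x ^ ?q + 1)"
      by (subst sum.union_disjoint) (auto simp: p_def poly_sum poly_monom)
    finally have "x + 1 = poly p x + (x + 1)"
      unfolding finite_field_power_card .
    then show ?thesis by simp
  qed
  moreover have "Polynomial.degree p < ?q" unfolding p_def
    by (rule degree_sum_less) (auto intro: le_less_trans[OF degree_monom_le])
  ultimately have "p = 0"
    using card_poly_roots_bound[of p] by (cases "p = 0") auto
  then have "Polynomial.coeff p i = 0" by simp
  then show ?thesis
    using assms by (simp add: p_def coeff_sum sum.delta')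
qed

text \<open>Besides the field axioms, these are the properties of
  \<open>\<complex>\<^sub>\<infinity>\<close> on which the later sections rest. The exponent is a
  parameter so that \<open>q ^ v\<close>, the twist belonging to \<open>\<tau>^v\<close>, gives
  another instance.\<close>

locale frobenius_field =
  fixes ty :: "'c::field itself" and q :: nat
  assumes q_pos: "q > 0"
    and frob_add: "(a + b :: 'c) ^ q = a ^ q + b ^ q"
    and frob_surj: "\<exists>b::'c. b ^ q = a"
begin

lemma frob_zero [simp]: "(0::'c) ^ q = 0"
  using q_pos by simp

lemma frob_sum: "(\<Sum>i\<in>I. f i :: 'c) ^ q = (\<Sum>i\<in>I. f i ^ q)"
  by (induction I rule: infinite_finite_induct) (simp_all add: frob_add)

lemma frobenius_field_power: "frobenius_field TYPE('c) (q ^ v)"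
proof (induction v)
  case 0
  show ?case by unfold_locales auto
next
  case (Suc v)
  then interpret v: frobenius_field "TYPE('c)" "q ^ v" .
  show ?case
  proof
    fix a b :: 'c
    show "(a + b) ^ (q ^ Suc v) = a ^ (q ^ Suc v) + b ^ (q ^ Suc v)"
      by (simp add: power_mult frob_add v.frob_add)
    show "\<exists>b. b ^ (q ^ Suc v) = a"
      by (metis frob_surj v.frob_surj power_mult power_Suc)
  qed (use q_pos in simp)
qed

end

context C_infinity
begin

lemma of_nat_eq_0_transfer:
  assumes "of_nat k = (0::'f)"
  shows "of_nat k = (0::'c)"
proof -
  have "(of_nat k :: 'f fls) = 0"
    using assms by (simp add: fls_of_nat)
  then have "(of_nat k :: 'f fls alg_closure) = 0"
    by (metis to_ac_0 to_ac_of_nat)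
  then show ?thesis
    by (metis emb.hom_of_nat emb.hom_zero)
qed

lemma Metric_space_av: "Metric_space UNIV (\<lambda>x y. av (x - y))"
proof
  have neg: "av (- x) = av x" for x
  proof -
    have "av (- 1) * av (- 1) = 1 * 1"
      using av_mult[of "-1" "-1"] av_mult[of 1 1] av_eq_0_iff[of 1] by simp
    then have "av (- 1) = 1"
      by (smt (verit, ccfv_SIG) av_nonneg mult_less_cancel_left mult_less_cancel_right1)
    then show ?thesis using av_mult[of "-1" x] by simp
  qed
  show "0 \<le> av (x - y)" for x y by (rule av_nonneg)
  show "av (x - y) = av (y - x)" for x y using neg[of "x - y"] by simp
  show "av (x - y) = 0 \<longleftrightarrow> x = y" for x y by (simp add: av_eq_0_iff)
  show "av (x - z) \<le> av (x - y) + av (y - z)" for x y z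
    using av_ultrametric[of "x - y" "y - z"] av_nonneg[of "x - y"] av_nonneg[of "y - z"] by simp
qed

lemma av_power: "av (x ^ n) = av x ^ n"
proof (induction n)
  case 0
  show ?case using av_mult[of 1 1] av_eq_0_iff[of 1] by simp
qed (simp add: av_mult)

text \<open>Additivity holds because the inner binomial coefficients vanish. For roots,
  \<open>a\<close> is approximated by \<open>y n\<close> from the algebraic closure and roots
  \<open>b n\<close> are taken there. Since \<open>x ^ q\<close> is additive and
  \<open>av (x ^ q) = av x ^ q\<close>, close elements have close roots; so the \<open>b n\<close>
  form a Cauchy sequence, and the \<open>q\<close>-th power of its limit is
  \<open>a\<close>.\<close>

lemma frobenius_field: "frobenius_field TYPE('c) CARD('f)"
proof
  let ?q = "CARD('f)"
  interpret Metric_space UNIV "\<lambda>x y. av (x - y)" by (rule Metric_space_av)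
  show q: "0 < ?q" by simp
  show add: "(a + b) ^ ?q = a ^ ?q + b ^ ?q" for a b :: 'c
  proof -
    have "of_nat (?q choose k) = (0::'c)" if "k \<in> {0<..<?q}" for k
      using that by (intro of_nat_eq_0_transfer of_nat_card_choose_eq_0) auto
    moreover have "{..?q} = {0<..<?q} \<union> {0, ?q}" by auto
    ultimately show ?thesis
      by (subst binomial_ring) (simp add: sum.union_disjoint)
  qed
  have diff: "(a - b) ^ ?q = a ^ ?q - b ^ ?q" for a b :: 'c
    using add[of "a - b" b] by (simp add: algebra_simps)
  fix a :: 'c
  have "\<exists>y. av (a - emb y) < inverse (Suc n)" for n
  proof -
    have "a \<in> mtopology closure_of range emb" using dense by simp
    then have "\<forall>r>0. \<exists>y\<in>range emb. y \<in> mball a r"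
      by (simp add: metric_closure_of)
    moreover have "inverse (real (Suc n)) > 0" by simp
    ultimately have "\<exists>y\<in>range emb. y \<in> mball a (inverse (Suc n))" by blast
    then show ?thesis by (simp add: mball_def)
  qed
  then have "\<forall>n. \<exists>y. av (a - emb y) < inverse (Suc n)" by blast
  from choice[OF this] obtain y where y: "\<And>n. av (a - emb (y n)) < inverse (Suc n)" by blast
  have "\<exists>b. b ^ ?q = y n" for n
    by (rule nth_root_exists) simp
  then have "\<forall>n. \<exists>b. b ^ ?q = y n" by blast
  from choice[OF this] obtain b where b: "\<And>n. b n ^ ?q = y n" by blast
  let ?b = "\<lambda>n. emb (b n)"
  have bq: "?b n ^ ?q = emb (y n)" for n
    by (simp only: b flip: emb.hom_power)
  have "MCauchy ?b"
    unfolding MCauchy_def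
  proof safe
    fix \<epsilon> :: real assume "\<epsilon> > 0"
    then obtain N where N: "inverse (Suc N) < \<epsilon> ^ ?q"
      using reals_Archimedean[of "\<epsilon> ^ ?q"] by auto
    have "av (?b n - ?b n') < \<epsilon>" if "N \<le> n" "N \<le> n'" for n n'
    proof -
      have le: "inverse (Suc k) \<le> inverse (real (Suc N))" if "N \<le> k" for k
        using that by (simp add: le_imp_inverse_le)
      have "av (?b n - ?b n') ^ ?q = av ((emb (y n) - a) + (a - emb (y n')))"
        by (simp flip: av_power add: diff bq)
      also have "\<dots> \<le> max (av (emb (y n) - a)) (av (a - emb (y n')))"
        by (rule av_ultrametric)
      also have "\<dots> < \<epsilon> ^ ?q"
        using y[of n] y[of n'] le[OF that(1)] le[OF that(2)] N commute[of a "emb (y n)"]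
        unfolding max_less_iff_conj by linarith
      finally show ?thesis
        using \<open>\<epsilon> > 0\<close> by (auto intro: power_less_imp_less_base)
    qed
    then show "\<exists>N. \<forall>n n'. N \<le> n \<longrightarrow> N \<le> n' \<longrightarrow> av (?b n - ?b n') < \<epsilon>" by blast
  qed auto
  then obtain c where c: "limitin mtopology ?b c sequentially"
    using complete unfolding mcomplete_def by blast
  have "av (c ^ ?q - a) = 0"
  proof (rule ccontr)
    assume "av (c ^ ?q - a) \<noteq> 0"
    then have pos: "av (c ^ ?q - a) > 0" using av_nonneg[of "c ^ ?q - a"] by simp
    \<comment> \<open>The bound 1 serves to estimate \<open>av (c - b n) ^ q\<close> by
      \<open>av (c - b n)\<close> itself.\<close>
    define \<epsilon> where "\<epsilon> = min 1 (av (c ^ ?q - a))"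
    have e: "0 < \<epsilon>" "\<epsilon> \<le> 1" "\<epsilon> \<le> av (c ^ ?q - a)" using pos by (auto simp: \<epsilon>_def)
    have "\<forall>\<^sub>F n in sequentially. av (?b n - c) < \<epsilon>"
      using c e(1) unfolding limitin_metric by simp
    then obtain N where N: "\<And>n. n \<ge> N \<Longrightarrow> av (?b n - c) < \<epsilon>"
      by (auto simp: eventually_sequentially)
    obtain N' where N': "inverse (Suc N') < \<epsilon>"
      using reals_Archimedean[OF e(1)] by auto
    define n where "n = max N N'"
    have "inverse (Suc n) \<le> inverse (real (Suc N'))"
      by (simp add: n_def le_imp_inverse_le)
    then have 1: "av (emb (y n) - a) < \<epsilon>"
      using y[of n] N' commute[of a "emb (y n)"] by linarith
    have 2: "av (c ^ ?q - emb (y n)) < \<epsilon>"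
    proof -
      have "av (c ^ ?q - emb (y n)) = av (c - ?b n) ^ ?q"
        by (simp flip: av_power add: diff bq)
      also have "\<dots> \<le> av (c - ?b n) ^ 1"
        using N[of n] e q commute[of c "?b n"]
        by (intro power_decreasing) (auto simp: n_def av_nonneg)
      also have "\<dots> < \<epsilon>" using N[of n] commute[of c "?b n"] by (simp add: n_def)
      finally show ?thesis .
    qed
    have "av (c ^ ?q - a) \<le> max (av (c ^ ?q - emb (y n))) (av (emb (y n) - a))"
      using av_ultrametric[of "c ^ ?q - emb (y n)" "emb (y n) - a"]
      by (simp only: diff_add_cancel add_diff_eq)
    then show False using 1 2 e by linarith
  qed
  then show "\<exists>b. b ^ ?q = a"
    by (intro exI[of _ c]) (simp only: av_eq_0_iff right_minus_eq)
qed

end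


section \<open>Filtered modules over \<open>\<complex>\<^sub>\<infinity>[\<tau>]\<close>\<close>

text \<open>Independence is required of an indexed family. A repetition \<open>e i = e j\<close>
  would give the relation with coefficients 1 and -1, so the family is injective and its image is an
  independent set of the same size.\<close>

lemma (in vector_space) card_le_of_independent_family:
  assumes "finite I" "finite T" "e ` I \<subseteq> span T"
    and indep: "\<And>a. (\<Sum>i\<in>I. scale (a i) (e i)) = 0 \<Longrightarrow> \<forall>i\<in>I. a i = 0"
  shows "card I \<le> card T"
proof -
  have inj: "inj_on e I"
  proof (rule inj_onI, rule ccontr)
    fix i j assume ij: "i \<in> I" "j \<in> I" "e i = e j" "i \<noteq> j"
    define a :: "'c \<Rightarrow> 'a" where "a = (\<lambda>k. if k = i then 1 else if k = j then - 1 else 0)"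
    have "(\<Sum>k\<in>I. scale (a k) (e k)) = (\<Sum>k\<in>{i, j}. scale (a k) (e k))"
      using ij assms(1) by (intro sum.mono_neutral_right) (auto simp: a_def)
    also have "\<dots> = 0" using ij by (simp add: a_def)
    finally show False using indep[of a] ij(1) by (auto simp: a_def)
  qed
  have "independent (e ` I)"
  proof (rule independent_if_scalars_zero)
    fix f x assume "(\<Sum>x\<in>e ` I. scale (f x) x) = 0" "x \<in> e ` I"
    then show "f x = 0"
      using indep[of "f \<circ> e"] by (auto simp: sum.reindex[OF inj])
  qed (use assms in simp)
  then show ?thesis
    using independent_span_bound[OF assms(2) _ assms(3)] by (simp add: card_image[OF inj])
qed

text \<open>Dividing by \<open>J\<close> and letting it grow compares the slopes. One value
  suffices: if \<open>a \<ge> b * c + 1\<close>, then \<open>J = b * \<bar>d\<bar> + 1\<close>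
  already violates the bound.\<close>

lemma int_le_if_linear_bound:
  fixes a b c :: int
  assumes "\<And>J::nat. a * int J \<le> b * max 0 (c * int J + d)" "b \<ge> 0" "c \<ge> 0"
  shows "a \<le> b * c"
proof (rule ccontr)
  assume "\<not> a \<le> b * c"
  then have "b * c + 1 \<le> a" by simp
  define J where "J = nat (b * \<bar>d\<bar> + 1)"
  have J: "int J = b * \<bar>d\<bar> + 1" using assms(2) by (simp add: J_def)
  have "(b * c + 1) * int J \<le> a * int J"
    using \<open>b * c + 1 \<le> a\<close> by (intro mult_right_mono) auto
  also have "\<dots> \<le> b * max 0 (c * int J + d)" by (rule assms)
  also have "\<dots> \<le> b * (c * int J + \<bar>d\<bar>)"
    using assms by (intro mult_left_mono) auto
  finally show False using J by (simp add: algebra_simps)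
qed

section \<open>Vector spaces with a semilinear map: modules over
  \<open>\<complex>\<^sub>\<infinity>[\<tau>]\<close>\<close>

locale frob_space = frobenius_field "TYPE('c)" q + vector_space scale
  for q :: nat and scale :: "'c::field \<Rightarrow> 'm::ab_group_add \<Rightarrow> 'm" +
  fixes tau :: "'m \<Rightarrow> 'm"
  assumes tau_add: "tau (x + y) = tau x + tau y"
    and tau_scale: "tau (scale a x) = scale (a ^ q) (tau x)"
begin

lemma tau_zero [simp]: "tau 0 = 0"
  using tau_add[of 0 0] by simp

lemma tau_pow_zero [simp]: "(tau ^^ d) 0 = 0"
  by (induction d) auto

lemma tau_pow_add: "(tau ^^ d) (x + y) = (tau ^^ d) x + (tau ^^ d) y"
  by (induction d) (auto simp: tau_add)

lemma tau_pow_sum: "(tau ^^ d) (\<Sum>i\<in>I. f i) = (\<Sum>i\<in>I. (tau ^^ d) (f i))"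
  by (induction I rule: infinite_finite_induct) (auto simp: tau_pow_add)

lemma tau_pow_scale: "(tau ^^ d) (scale a x) = scale (a ^ (q ^ d)) ((tau ^^ d) x)"
  by (induction d) (auto simp: tau_scale mult.commute simp flip: power_mult)

text \<open>The polynomial only stores the coefficients of a skew polynomial in \<tau>. The map is
  additive in \<open>p\<close>, but products of commutative polynomials do not correspond to
  composition.\<close>

definition pact :: "'c poly \<Rightarrow> 'm \<Rightarrow> 'm" where
  "pact p x = (\<Sum>j\<le>Polynomial.degree p. scale (Polynomial.coeff p j) ((tau ^^ j) x))"

lemma pact_eq:
  assumes "Polynomial.degree p \<le> N"
  shows "pact p x = (\<Sum>j\<le>N. scale (Polynomial.coeff p j) ((tau ^^ j) x))"
  unfolding pact_def using assms
  by (intro sum.mono_neutral_left) (auto simp: coeff_eq_0)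

lemma pact_0 [simp]: "pact 0 x = 0"
  by (simp add: pact_def)

lemma pact_add: "pact (p + p') x = pact p x + pact p' x"
proof -
  let ?N = "max (Polynomial.degree p) (Polynomial.degree p')"
  have "pact (p + p') x = (\<Sum>j\<le>?N. scale (Polynomial.coeff (p + p') j) ((tau ^^ j) x))"
    by (rule pact_eq) (rule degree_add_le_max)
  then show ?thesis
    by (simp add: pact_eq[of p ?N] pact_eq[of p' ?N] scale_left_distrib sum.distrib)
qed

lemma pact_smult: "pact (Polynomial.smult a p) x = scale a (pact p x)"
  by (simp add: pact_eq[of "Polynomial.smult a p" "Polynomial.degree p"] degree_smult_le
      pact_def[of p] scale_sum_right)

lemma pact_monom: "pact (Polynomial.monom a j) x = scale a ((tau ^^ j) x)"
proof -
  have "pact (Polynomial.monom a j) x =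
      (\<Sum>i\<le>j. if j = i then scale a ((tau ^^ j) x) else 0)"
    by (subst pact_eq[OF degree_monom_le]) (rule sum.cong, auto)
  then show ?thesis by simp
qed

lemma pact_diff: "pact (p - p') x = pact p x - pact p' x"
  using pact_add[of "p - p'" p' x] by (simp add: algebra_simps)

lemma pact_pCons: "pact (pCons a p) x = scale a x + pact p (tau x)"
  by (subst pact_eq[OF degree_pCons_le])
    (simp only: sum.atMost_Suc_shift coeff_pCons_0 coeff_pCons_Suc pact_def funpow_0
      funpow_Suc_right comp_apply)

lemma tau_pact: "tau (pact p x) = pact (map_poly (\<lambda>a. a ^ q) p) (tau x)"
  by (induction p arbitrary: x) (auto simp: pact_pCons tau_add tau_scale map_poly_pCons)

definition tau_comb :: "nat \<Rightarrow> (nat \<Rightarrow> 'm) \<Rightarrow> (nat \<Rightarrow> 'c poly) \<Rightarrow> 'm" where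
  "tau_comb n b c = (\<Sum>i<n. pact (c i) (b i))"

lemma subspace_tau_comb: "subspace (range (tau_comb n b))"
proof (rule subspaceI)
  show "0 \<in> range (tau_comb n b)"
    by (rule range_eqI[of _ _ "\<lambda>i. 0"]) (simp add: tau_comb_def)
  show "x + y \<in> range (tau_comb n b)"
    if xy: "x \<in> range (tau_comb n b)" "y \<in> range (tau_comb n b)" for x y
  proof -
    obtain c d where "x = tau_comb n b c" "y = tau_comb n b d" using xy by auto
    then show ?thesis
      by (intro range_eqI[of _ _ "\<lambda>i. c i + d i"]) (simp add: tau_comb_def pact_add sum.distrib)
  qed
  show "scale a x \<in> range (tau_comb n b)" if x: "x \<in> range (tau_comb n b)" for a x
  proof -
    obtain c where "x = tau_comb n b c" using x by auto
    then show ?thesis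
      by (intro range_eqI[of _ _ "\<lambda>i. Polynomial.smult a (c i)"])
        (simp add: tau_comb_def pact_smult scale_sum_right)
  qed
qed

lemma tau_comb_cong: "(\<And>i. i < n \<Longrightarrow> b i = b' i) \<Longrightarrow> tau_comb n b = tau_comb n b'"
  by (simp add: tau_comb_def fun_eq_iff)

end

text \<open>The equivalence in \<open>F_tau\<close> makes \<tau> strict: a factor \<tau> can also be
  removed, lowering the level by exactly \<open>u\<close>. The bound in \<open>F_growth\<close> is 0
  for \<open>k \<le> - D\<close>, so these levels vanish and every search for a least level
  ends.\<close>

locale filtered_frob_space = frob_space q scale tau
  for q :: nat and scale :: "'c::field \<Rightarrow> 'm::ab_group_add \<Rightarrow> 'm" and tau :: "'m \<Rightarrow> 'm" +
  fixes F :: "int \<Rightarrow> 'm set" and u :: nat and C D :: int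
  assumes u_pos: "u > 0"
    and F_subspace: "subspace (F k)"
    and F_mono: "k \<le> l \<Longrightarrow> F k \<subseteq> F l"
    and F_exhaust: "\<exists>k. x \<in> F k"
    and F_tau: "tau x \<in> F (k + int u) \<longleftrightarrow> x \<in> F k"
    and C_nonneg: "C \<ge> 0"
    and F_growth: "\<exists>T. finite T \<and> F k \<subseteq> span T \<and> int (card T) \<le> C * max 0 (k + D)"
begin

lemma F_small:
  assumes "k \<le> - D"
  shows "F k = {0}"
proof -
  have "max 0 (k + D) = 0" using assms by simp
  then obtain T where "finite T" "F k \<subseteq> span T" "card T = 0"
    using F_growth[of k] by auto
  then show ?thesis using subspace_0[OF F_subspace, of k] by auto
qed

lemma F_tau_pow: "(tau ^^ j) x \<in> F (k + int u * int j) \<longleftrightarrow> x \<in> F k"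
proof (induction j)
  case (Suc j)
  have "(tau ^^ Suc j) x \<in> F (k + int u * int (Suc j))
      \<longleftrightarrow> tau ((tau ^^ j) x) \<in> F ((k + int u * int j) + int u)"
    by (simp add: algebra_simps)
  then show ?case using Suc F_tau by simp
qed simp

lemma pact_in_F:
  assumes "x \<in> F \<kappa>" "\<And>j. Polynomial.coeff p j \<noteq> 0 \<Longrightarrow> \<kappa> + int u * int j \<le> k"
  shows "pact p x \<in> F k"
  unfolding pact_def
proof (intro subspace_sum[OF F_subspace])
  fix j
  show "scale (Polynomial.coeff p j) ((tau ^^ j) x) \<in> F k"
  proof (cases "Polynomial.coeff p j = 0")
    case True
    then show ?thesis by (simp add: subspace_0[OF F_subspace])
  next
    case False
    have "(tau ^^ j) x \<in> F (\<kappa> + int u * int j)"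
      using assms(1) by (simp add: F_tau_pow)
    then show ?thesis
      using F_mono[OF assms(2)[OF False]] subspace_scale[OF F_subspace] by blast
  qed
qed

text \<open>Successive minima with respect to the filtration.\<close>

definition reduced :: "nat \<Rightarrow> (nat \<Rightarrow> 'm) \<Rightarrow> (nat \<Rightarrow> int) \<Rightarrow> bool" where
  "reduced n b \<kappa> \<longleftrightarrow> (\<forall>i<n. b i \<in> F (\<kappa> i) \<and> b i \<notin> range (tau_comb i b) \<and>
     F (\<kappa> i - 1) \<subseteq> range (tau_comb i b))"

lemma tau_comb_mono: "i \<le> j \<Longrightarrow> range (tau_comb i b) \<subseteq> range (tau_comb j b)"
proof safe
  fix c assume "i \<le> j"
  have "tau_comb j b (\<lambda>l. if l < i then c l else 0) = tau_comb i b c"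
    unfolding tau_comb_def using \<open>i \<le> j\<close>
    by (intro sum.mono_neutral_cong_right) auto
  then show "tau_comb i b c \<in> range (tau_comb j b)" by (metis rangeI)
qed

text \<open>Everything in a level below \<kappa> \<open>i\<close> is already a combination of the
  first \<open>i\<close> generators, so no later generator can lie there.\<close>

lemma reduced_mono:
  assumes "reduced n b \<kappa>" "i \<le> j" "j < n"
  shows "\<kappa> i \<le> \<kappa> j"
proof (rule ccontr)
  assume "\<not> \<kappa> i \<le> \<kappa> j"
  then have "b j \<in> F (\<kappa> i - 1)"
    using assms F_mono[of "\<kappa> j" "\<kappa> i - 1"] unfolding reduced_def by auto
  then have "b j \<in> range (tau_comb i b)"
    using assms unfolding reduced_def by (meson le_less_trans subsetD)
  then show False
    using assms tau_comb_mono[of i j b] unfolding reduced_def by blast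
qed

text \<open>Terms of a reduced family do not cancel: a combination in level \<open>k\<close> has all
  its terms in level \<open>k\<close>. Suppose the leading term of the last generator had level
  \<open>K > k\<close>. The terms of level exactly \<open>K\<close> would cancel modulo level
  \<open>K - 1\<close>. Dividing them by \<open>\<tau>^d\<close>, with \<open>d\<close> the degree
  of the last coefficient, would leave a nonzero multiple of \<open>b n\<close> plus a combination
  of earlier generators in level \<kappa> \<open>n - 1\<close>. By minimality \<open>b n\<close>
  would then be a combination of earlier generators.\<close>

lemma reduced_coeff_level:
  assumes "reduced n b \<kappa>" "tau_comb n b c \<in> F k" "i < n" "Polynomial.coeff (c i) j \<noteq> 0"
  shows "\<kappa> i + int u * int j \<le> k"
  using assms
proof (induction n arbitrary: c k i j)
  case (Suc n)
  have red: "reduced n b \<kappa>" using Suc.prems(1) by (simp add: reduced_def)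
  have bn: "b n \<in> F (\<kappa> n)" "b n \<notin> range (tau_comb n b)" "F (\<kappa> n - 1) \<subseteq> range (tau_comb n b)"
    using Suc.prems(1) by (auto simp: reduced_def)
  have split: "tau_comb (Suc n) b c = tau_comb n b c + pact (c n) (b n)"
    by (simp add: tau_comb_def)
  define d where "d = Polynomial.degree (c n)"
  have deg: "\<kappa> n + int u * int d \<le> k" if nz: "c n \<noteq> 0"
  proof (rule ccontr)
    define K where "K = \<kappa> n + int u * int d"
    assume "\<not> \<kappa> n + int u * int d \<le> k"
    then have "k \<le> K - 1" by (simp add: K_def)
    then have x: "tau_comb (Suc n) b c \<in> F (K - 1)"
      using Suc.prems(2) F_mono by blast
    have "pact (c n) (b n) \<in> F K"
    proof (rule pact_in_F[OF bn(1)])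
      fix j assume "Polynomial.coeff (c n) j \<noteq> 0"
      then have "j \<le> d" by (simp add: d_def le_degree)
      then show "\<kappa> n + int u * int j \<le> K" by (simp add: K_def mult_left_mono)
    qed
    then have "tau_comb n b c \<in> F K"
      using subspace_diff[OF F_subspace, of "tau_comb (Suc n) b c" K "pact (c n) (b n)"]
        x F_mono[of "K - 1" K]
      by (auto simp: split)
    then have le: "\<kappa> i + int u * int j \<le> K"
      if "i < n" "Polynomial.coeff (c i) j \<noteq> 0" for i j
      using Suc.IH[OF red] that by blast
    \<comment> \<open>\<open>top i\<close> is the exponent at which the \<open>i\<close>-th
      generator reaches level exactly \<open>K\<close>, and \<open>e i\<close> is the coefficient
      found there. If \<open>K\<close> is not reached by any exponent, the integer division returns
      a wrong one and the test inside \<open>e i\<close> replaces the coefficient by 0.\<close>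
    define top where "top i = nat ((K - \<kappa> i) div int u)" for i
    define e where "e i = (if \<kappa> i + int u * int (top i) = K
        then Polynomial.coeff (c i) (top i) else 0)" for i
    \<comment> \<open>With these roots as coefficients, \<open>\<tau>^d\<close> applied to
      \<open>s\<close> below gives precisely the terms of level \<open>K\<close> of the first
      \<open>n\<close> generators.\<close>
    have "\<forall>i. \<exists>a. a ^ (q ^ d) = e i"
      using frobenius_field.frob_surj[OF frobenius_field_power] by blast
    then obtain a where a: "\<And>i. a i ^ (q ^ d) = e i" by metis
    define s where "s = tau_comb n b (\<lambda>i. Polynomial.monom (a i) (top i - d))"
    have e_term: "(tau ^^ d) (pact (Polynomial.monom (a i) (top i - d)) (b i)) =
        pact (Polynomial.monom (e i) (top i)) (b i)" if "i < n" for i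
    proof (cases "\<kappa> i + int u * int (top i) = K")
      case True
      \<comment> \<open>Here the order of the minima enters: a generator of smaller level needs at
        least \<open>d\<close> factors \<tau> to reach \<open>K\<close>, so \<open>\<tau>^d\<close>
        can be split off.\<close>
      have "\<kappa> i \<le> \<kappa> n" using reduced_mono[OF Suc.prems(1)] that by simp
      then have "int u * int d \<le> int u * int (top i)" using True by (simp add: K_def)
      then have "d \<le> top i" using u_pos by (simp flip: of_nat_mult)
      then have "(tau ^^ d) ((tau ^^ (top i - d)) (b i)) = (tau ^^ top i) (b i)"
        by (metis comp_apply funpow_add le_add_diff_inverse)
      then show ?thesis by (simp add: pact_monom tau_pow_scale a)
    qed (simp add: pact_monom tau_pow_scale a e_def)
    have low: "pact (c i - Polynomial.monom (e i) (top i)) (b i) \<in> F (K - 1)" if "i < n" for i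
    proof (rule pact_in_F)
      show "b i \<in> F (\<kappa> i)" using red that by (simp add: reduced_def)
      fix j assume nz: "Polynomial.coeff (c i - Polynomial.monom (e i) (top i)) j \<noteq> 0"
      show "\<kappa> i + int u * int j \<le> K - 1"
      proof (rule ccontr)
        assume *: "\<not> \<kappa> i + int u * int j \<le> K - 1"
        show False
        proof (cases "Polynomial.coeff (c i) j = 0")
          case True
          then show False using nz by (auto simp: e_def split: if_splits)
        next
          case False
          then have "\<kappa> i + int u * int j = K" using le[OF that False] * by simp
          moreover from this have "top i = j" using u_pos by (auto simp: top_def)
          ultimately show False using nz by (simp add: e_def)
        qed
      qed
    qed
    obtain a' where a': "a' ^ (q ^ d) = Polynomial.lead_coeff (c n)"
      using frobenius_field.frob_surj[OF frobenius_field_power] by blast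
    have "a' \<noteq> 0" using a' nz q_pos by (auto simp: zero_power)
    have low_n: "pact (c n - Polynomial.monom (Polynomial.lead_coeff (c n)) d) (b n) \<in> F (K - 1)"
    proof (rule pact_in_F[OF bn(1)])
      fix j assume "Polynomial.coeff (c n - Polynomial.monom (Polynomial.lead_coeff (c n)) d) j \<noteq> 0"
      then have "j < d"
        by (auto simp: d_def split: if_splits intro: ccontr)
          (metis coeff_eq_0 linorder_neqE_nat)
      then have "int u * int j < int u * int d" using u_pos by simp
      then show "\<kappa> n + int u * int j \<le> K - 1" by (simp add: K_def)
    qed
    \<comment> \<open>All terms of level \<open>K\<close> are removed, so the difference lies in
      level \<open>K - 1\<close>. The combination itself lies there too, hence so does the image
      under \<open>\<tau>^d\<close>, and strictness of \<tau> removes the power.\<close>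
    have "tau_comb (Suc n) b c - (tau ^^ d) (s + scale a' (b n)) =
        (\<Sum>i<n. pact (c i - Polynomial.monom (e i) (top i)) (b i)) +
        pact (c n - Polynomial.monom (Polynomial.lead_coeff (c n)) d) (b n)"
      using e_term
      by (simp add: split s_def tau_comb_def tau_pow_add tau_pow_sum tau_pow_scale a'
          pact_diff pact_monom[of "Polynomial.lead_coeff (c n)"] sum_subtractf)
    also have "\<dots> \<in> F (K - 1)"
      by (intro subspace_add[OF F_subspace] subspace_sum[OF F_subspace] low low_n) auto
    finally have "(tau ^^ d) (s + scale a' (b n)) \<in> F (K - 1)"
      using subspace_diff[OF F_subspace x] by fastforce
    moreover have "K - 1 = (\<kappa> n - 1) + int u * int d" by (simp add: K_def)
    ultimately have "s + scale a' (b n) \<in> F (\<kappa> n - 1)"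
      by (simp only: F_tau_pow)
    then have "s + scale a' (b n) \<in> range (tau_comb n b)" using bn(3) by blast
    moreover have "s \<in> range (tau_comb n b)" by (simp add: s_def)
    ultimately have "scale a' (b n) \<in> range (tau_comb n b)"
      using subspace_diff[OF subspace_tau_comb, of "s + scale a' (b n)" n b s] by simp
    then have "scale (inverse a') (scale a' (b n)) \<in> range (tau_comb n b)"
      by (rule subspace_scale[OF subspace_tau_comb])
    then show False using bn(2) \<open>a' \<noteq> 0\<close> by simp
  qed
  have le_n: "\<kappa> n + int u * int j \<le> k" if "Polynomial.coeff (c n) j \<noteq> 0" for j
  proof -
    have "j \<le> d" using that by (simp add: d_def le_degree)
    then have "int u * int j \<le> int u * int d" by (simp add: mult_left_mono)
    moreover have "c n \<noteq> 0" using that by auto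
    ultimately show ?thesis using deg by linarith
  qed
  show ?case
  proof (cases "i = n")
    case True
    then show ?thesis using le_n Suc.prems by simp
  next
    case False
    have "pact (c n) (b n) \<in> F k"
      by (rule pact_in_F[OF bn(1)]) (rule le_n)
    then have "tau_comb n b c \<in> F k"
      using subspace_diff[OF F_subspace Suc.prems(2), of "pact (c n) (b n)"] by (simp add: split)
    then show ?thesis using Suc.IH[OF red] Suc.prems False by simp
  qed
qed simp

text \<open>Zero lies in every level, in particular just below the level of any term with a nonzero
  coefficient.\<close>

lemma reduced_independent:
  assumes "reduced n b \<kappa>" "tau_comb n b c = 0" "i < n"
  shows "c i = 0"
proof (rule poly_eqI, rule ccontr)
  fix j assume "Polynomial.coeff (c i) j \<noteq> Polynomial.coeff 0 j"
  moreover have "tau_comb n b c \<in> F (\<kappa> i + int u * int j - 1)"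
    by (simp add: assms(2) subspace_0[OF F_subspace])
  ultimately show False
    using reduced_coeff_level[OF assms(1) _ assms(3), of c "\<kappa> i + int u * int j - 1" j] by simp
qed

lemma reduced_inj:
  assumes "reduced n b \<kappa>" "tau_comb n b c = tau_comb n b c'" "i < n"
  shows "c i = c' i"
proof -
  have "tau_comb n b (\<lambda>i. c i - c' i) = 0"
    using assms(2) by (simp add: tau_comb_def pact_diff sum_subtractf)
  from reduced_independent[OF assms(1) this assms(3)] show ?thesis by simp
qed

lemma reduced_family_independent:
  assumes "reduced n b \<kappa>" "(\<Sum>(i, j)\<in>{..<n} \<times> {..<J}. scale (a (i, j)) ((tau ^^ j) (b i))) = 0"
    "i < n" "j < J"
  shows "a (i, j) = 0"
proof -
  define c where "c i = (\<Sum>j<J. Polynomial.monom (a (i, j)) j)" for i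
  have "pact (\<Sum>j\<in>S. Polynomial.monom (f j) j) x = (\<Sum>j\<in>S. scale (f j) ((tau ^^ j) x))"
    for S :: "nat set" and f x
    by (induction S rule: infinite_finite_induct) (auto simp: pact_add pact_monom)
  then have "tau_comb n b c = 0"
    using assms(2) by (simp add: tau_comb_def c_def sum.cartesian_product)
  then have "Polynomial.coeff (c i) j = 0"
    using reduced_independent[OF assms(1) _ assms(3), of c] by simp
  then show ?thesis using assms(4) by (simp add: c_def coeff_sum sum.delta')
qed

text \<open>The \<open>n * J\<close> independent elements \<open>\<tau>^j b_i\<close> with
  \<open>j < J\<close> lie in a level of height \<open>u * J\<close> plus a constant, whose
  dimension grows in \<open>J\<close> with slope at most \<open>C * u\<close>. This bound makes the
  construction by successive minima stop.\<close>

lemma reduced_bound: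
  assumes "reduced n b \<kappa>"
  shows "int n \<le> C * int u"
proof (rule int_le_if_linear_bound[where d = "Max (insert 0 (\<kappa> ` {..<n})) + D"])
  define k where "k = Max (insert 0 (\<kappa> ` {..<n}))"
  fix J :: nat
  let ?I = "{..<n} \<times> {..<J}"
  obtain T where T: "finite T" "F (k + int u * int J) \<subseteq> span T"
      "int (card T) \<le> C * max 0 (k + int u * int J + D)"
    using F_growth by blast
  have "card ?I \<le> card T"
  proof (rule card_le_of_independent_family[where e = "\<lambda>(i, j). (tau ^^ j) (b i)"])
    show "(\<lambda>(i, j). (tau ^^ j) (b i)) ` ?I \<subseteq> span T"
    proof clarsimp
      fix i j assume ij: "i < n" "j < J"
      have "\<kappa> i \<le> k" unfolding k_def using ij by (intro Max_ge) auto
      moreover have "int u * int j \<le> int u * int J" using ij by (simp add: mult_left_mono)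
      ultimately have "F (\<kappa> i + int u * int j) \<subseteq> F (k + int u * int J)"
        by (intro F_mono) linarith
      moreover have "(tau ^^ j) (b i) \<in> F (\<kappa> i + int u * int j)"
        using assms ij by (simp add: F_tau_pow reduced_def)
      ultimately show "(tau ^^ j) (b i) \<in> span T" using T by blast
    qed
    show "\<forall>i\<in>?I. a i = 0"
      if "(\<Sum>i\<in>?I. scale (a i) (case i of (i, j) \<Rightarrow> (tau ^^ j) (b i))) = 0" for a
    proof -
      have "(\<Sum>(i, j)\<in>?I. scale (a (i, j)) ((tau ^^ j) (b i))) = 0"
        using that by (simp add: case_prod_unfold)
      then show ?thesis using reduced_family_independent[OF assms] by auto
    qed
  qed (use T in auto)
  then have "int n * int J \<le> int (card T)" by (simp flip: of_nat_mult)
  also note T(3)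
  finally show "int n * int J \<le> C * max 0 (int u * int J + (k + D))"
    by (simp add: algebra_simps)
qed (use C_nonneg in auto)

text \<open>The next generator is any element outside the present span in the least level that is
  not contained in the span.\<close>

lemma reduced_extend:
  assumes "reduced n b \<kappa>" "range (tau_comb n b) \<noteq> UNIV"
  shows "\<exists>b \<kappa>. reduced (Suc n) b \<kappa>"
proof -
  let ?S = "range (tau_comb n b)"
  obtain x where "x \<notin> ?S" using assms(2) by auto
  then obtain k where "\<not> F k \<subseteq> ?S" using F_exhaust[of x] by auto
  \<comment> \<open>Shifting by \<open>D\<close> turns levels into natural numbers, so that a least
    one exists. At the boundary value 0 the level just below is zero by
    \<open>F_small\<close>.\<close>
  define P where "P l \<longleftrightarrow> \<not> F (int l - D) \<subseteq> ?S" for l :: nat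
  have "0 \<in> ?S" by (rule subspace_0[OF subspace_tau_comb])
  then have "k > - D" using \<open>\<not> F k \<subseteq> ?S\<close> F_small[of k] by (cases "k \<le> - D") auto
  then have "P (nat (k + D))" using \<open>\<not> F k \<subseteq> ?S\<close> by (simp add: P_def)
  then have P: "P (Least P)" by (rule LeastI)
  have min: "\<not> P l" if "l < Least P" for l using that by (rule not_less_Least)
  define k0 where "k0 = int (Least P) - D"
  obtain y where y: "y \<in> F k0" "y \<notin> ?S" using P by (auto simp: P_def k0_def)
  have low: "F (k0 - 1) \<subseteq> ?S"
  proof (cases "Least P")
    case 0
    then have "F (k0 - 1) = {0}" by (intro F_small) (simp add: k0_def)
    then show ?thesis using \<open>0 \<in> ?S\<close> by simp
  next
    case (Suc l)
    then show ?thesis using min[of l] by (simp add: P_def k0_def algebra_simps)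
  qed
  have "tau_comb i (b(n := y)) = tau_comb i b" if "i \<le> n" for i
    using that by (intro tau_comb_cong) auto
  then have "reduced (Suc n) (b(n := y)) (\<kappa>(n := k0))"
    using assms(1) y low by (auto simp: reduced_def less_Suc_eq)
  then show ?thesis by blast
qed

text \<open>A reduced family of greatest length generates, since otherwise
  \<open>reduced_extend\<close> would lengthen it.\<close>

theorem reduced_basis_exists:
  obtains n b \<kappa> where "reduced n b \<kappa>" "range (tau_comb n b) = UNIV"
proof -
  let ?P = "\<lambda>n. \<exists>b \<kappa>. reduced n b \<kappa>"
  have "?P 0" by (simp add: reduced_def)
  have bound: "\<And>n. ?P n \<Longrightarrow> n \<le> nat (C * int u)"
    using reduced_bound by (auto simp: le_nat_iff C_nonneg)
  have "?P (Greatest ?P)" using \<open>?P 0\<close> bound by (rule GreatestI_nat)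
  have max: "n \<le> Greatest ?P" if "?P n" for n using that bound by (rule Greatest_le_nat)
  from \<open>?P (Greatest ?P)\<close> obtain b \<kappa> where red: "reduced (Greatest ?P) b \<kappa>" by auto
  have "range (tau_comb (Greatest ?P) b) = UNIV"
    using reduced_extend[OF red] max[of "Suc (Greatest ?P)"] by auto
  then show thesis using that red by blast
qed

text \<open>Since terms do not cancel, level \<open>k\<close> is spanned by the elements
  \<open>\<tau>^j b_i\<close> with \<kappa> \<open>i + u * j \<le> k\<close>. Counting the exponents
  gives slope \<open>n / u\<close>; the factor \<open>u\<close> stands on the left to stay within
  the integers.\<close>

lemma reduced_basis_growth:
  assumes "reduced n b \<kappa>" "range (tau_comb n b) = UNIV"
  obtains D' where "\<And>k. \<exists>T. finite T \<and> F k \<subseteq> span T \<and> int u * int (card T) \<le> int n * max 0 (k + D')"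
proof
  define m where "m = Max (insert 0 ((\<lambda>i. - \<kappa> i) ` {..<n}))"
  have m: "- \<kappa> i \<le> m" if "i < n" for i
    unfolding m_def using that by (intro Max_ge) auto
  fix k
  \<comment> \<open>All minima are at least \<open>- m\<close>, so \<open>N\<close> counts the
    exponents \<open>j\<close> with \<open>u * j \<le> k + m\<close>. The extra one for
    \<open>j = 0\<close> accounts for the summand \<open>u\<close> in the final constant.\<close>
  define N where "N = (if k + m \<ge> 0 then Suc (nat ((k + m) div int u)) else 0)"
  define T where "T = (\<lambda>(i, j). (tau ^^ j) (b i)) ` ({..<n} \<times> {..<N})"
  have "x \<in> span T" if x: "x \<in> F k" for x
  proof -
    obtain c where c: "x = tau_comb n b c" using assms(2) by (metis UNIV_I imageE)
    show ?thesis unfolding c tau_comb_def pact_def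
    proof (intro span_sum)
      fix i j assume i: "i \<in> {..<n}"
      show "scale (Polynomial.coeff (c i) j) ((tau ^^ j) (b i)) \<in> span T"
      proof (cases "Polynomial.coeff (c i) j = 0")
        case False
        then have "\<kappa> i + int u * int j \<le> k"
          using reduced_coeff_level[OF assms(1)] x i c by auto
        then have le: "int j * int u \<le> k + m" using m[of i] i by (simp add: algebra_simps)
        moreover have "0 \<le> int j * int u" by simp
        ultimately have "k + m \<ge> 0" by linarith
        moreover have "int j \<le> (k + m) div int u"
          using le u_pos zdiv_mono1[OF le, of "int u"] by simp
        ultimately have "j < N" by (simp add: N_def nat_le_eq_zle flip: le_nat_iff less_Suc_eq_le)
        then show ?thesis
          using i by (intro span_scale span_base) (auto simp: T_def intro!: image_eqI[of _ _ "(i, j)"])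
      qed (simp add: span_zero)
    qed
  qed
  moreover have "int u * int (card T) \<le> int n * max 0 (k + (m + int u))"
  proof -
    have "card T \<le> n * N"
      unfolding T_def by (rule order.trans[OF card_image_le]) auto
    then have "int u * int (card T) \<le> int u * (int n * int N)"
      by (intro mult_left_mono) (auto simp flip: of_nat_mult)
    also have "\<dots> = int n * (int u * int N)" by simp
    also have "int u * int N \<le> max 0 (k + (m + int u))"
    proof (cases "k + m \<ge> 0")
      case True
      then have "int N = (k + m) div int u + 1"
        using u_pos by (simp add: N_def pos_imp_zdiv_nonneg_iff)
      moreover have "int u * ((k + m) div int u) \<le> k + m"
        using u_pos pos_mod_sign[of "int u" "k + m"] mult_div_mod_eq[of "int u" "k + m"] by linarith
      ultimately show ?thesis by (simp add: distrib_left)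
    qed (simp add: N_def)
    finally show ?thesis by (simp add: mult_left_mono)
  qed
  ultimately show "\<exists>T. finite T \<and> F k \<subseteq> span T \<and> int u * int (card T) \<le> int n * max 0 (k + (m + int u))"
    by (intro exI[of _ T]) (auto simp: T_def)
qed

text \<open>Taking constant coefficients is a linear projection onto the span of the
  \<open>b i\<close> that kills the image of \<tau>. The projections of the \<open>g i\<close>
  therefore span this \<open>n\<close>-dimensional space, which is a copy of M/\<tau>M.\<close>

lemma reduced_basis_card_le:
  assumes red: "reduced n b \<kappa>" and full: "range (tau_comb n b) = UNIV"
    and gen: "\<And>x. \<exists>a y. x = (\<Sum>i<n'. scale (a i) (g i)) + tau y"
  shows "n \<le> n'"
proof -
  have "\<forall>x. \<exists>c. x = tau_comb n b c" using full by (metis UNIV_I imageE)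
  then obtain co where co: "\<And>x. x = tau_comb n b (co x)" by metis
  define \<pi> where "\<pi> x = (\<Sum>i<n. scale (Polynomial.coeff (co x i) 0) (b i))" for x
  have \<pi>: "\<pi> (tau_comb n b c) = (\<Sum>i<n. scale (Polynomial.coeff (c i) 0) (b i))" for c
    unfolding \<pi>_def using reduced_inj[OF red co[of "tau_comb n b c"]]
    by (auto intro!: sum.cong)
  have \<pi>_add: "\<pi> (x + y) = \<pi> x + \<pi> y" for x y
  proof -
    have "x + y = tau_comb n b (\<lambda>i. co x i + co y i)"
      by (subst co[of x], subst co[of y]) (simp add: tau_comb_def pact_add sum.distrib)
    then show ?thesis
      using \<pi>[of "\<lambda>i. co x i + co y i"] by (simp add: \<pi>_def[of x] \<pi>_def[of y] scale_left_distrib sum.distrib)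
  qed
  have \<pi>_scale: "\<pi> (scale a x) = scale a (\<pi> x)" for a x
  proof -
    have "scale a x = tau_comb n b (\<lambda>i. Polynomial.smult a (co x i))"
      by (subst co[of x]) (simp add: tau_comb_def pact_smult scale_sum_right)
    then show ?thesis
      using \<pi>[of "\<lambda>i. Polynomial.smult a (co x i)"] by (simp add: \<pi>_def[of x] scale_sum_right)
  qed
  have \<pi>_sum: "\<pi> (\<Sum>i\<in>I. scale (a i) (g i)) = (\<Sum>i\<in>I. scale (a i) (\<pi> (g i)))" if "finite I" for I a
    using that
  proof (induction I)
    case empty
    show ?case using \<pi>_scale[of 0 0] by simp
  qed (simp add: \<pi>_add \<pi>_scale)
  have \<pi>_tau: "\<pi> (tau y) = 0" for y
  proof -
    have "tau y = tau_comb n b (\<lambda>i. pCons 0 (map_poly (\<lambda>a. a ^ q) (co y i)))"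
      by (subst co[of y])
        (simp add: tau_comb_def pact_pCons tau_pact tau_pow_sum[of 1, simplified])
    then show ?thesis
      using \<pi>[of "\<lambda>i. pCons 0 (map_poly (\<lambda>a. a ^ q) (co y i))"] by simp
  qed
  have \<pi>_b: "\<pi> (b i) = b i" if "i < n" for i
  proof -
    have "b i = tau_comb n b (\<lambda>j. if j = i then 1 else 0)"
      using that pact_monom[of 1 0 "b i"]
      by (simp add: tau_comb_def if_distrib[of "\<lambda>p. pact p _"] monom_0 one_pCons cong: if_cong)
    then show ?thesis
      using \<pi>[of "\<lambda>j. if j = i then 1 else 0"] that
      by (simp add: if_distrib[of "\<lambda>p. Polynomial.coeff p _"] if_distrib[of "\<lambda>a. scale a _"] cong: if_cong)
  qed
  have "card {..<n} \<le> card ((\<pi> \<circ> g) ` {..<n'})"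
  proof (rule card_le_of_independent_family[where e = b])
    show "b ` {..<n} \<subseteq> span ((\<pi> \<circ> g) ` {..<n'})"
    proof clarsimp
      fix i assume "i < n"
      obtain a y where "b i = (\<Sum>j<n'. scale (a j) (g j)) + tau y" using gen by blast
      then have "b i = (\<Sum>j<n'. scale (a j) (\<pi> (g j)))"
        using \<pi>_b[OF \<open>i < n\<close>] by (metis \<pi>_add \<pi>_sum \<pi>_tau add.right_neutral finite_lessThan)
      then show "b i \<in> span ((\<lambda>x. \<pi> (g x)) ` {..<n'})"
        by (auto simp only: intro!: span_sum span_scale intro: span_base)
    qed
    show "\<forall>i\<in>{..<n}. a i = 0" if "(\<Sum>i<n. scale (a i) (b i)) = 0" for a
    proof -
      have "tau_comb n b (\<lambda>i. Polynomial.monom (a i) 0) = 0"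
        using that by (simp only: tau_comb_def pact_monom funpow_0)
      then show ?thesis
        using reduced_independent[OF red, of "\<lambda>i. Polynomial.monom (a i) 0"] by auto
    qed
  qed auto
  also have "\<dots> \<le> n'" by (rule order.trans[OF card_image_le]) auto
  finally show ?thesis by simp
qed

text \<open>The growth rate of the filtration, computed from a \<open>\<tau>\<close>-basis, bounds that of any other family.\<close>

theorem filtered_rank_le:
  assumes gen: "\<And>x. \<exists>a y. x = (\<Sum>i<n. scale (a i) (g i)) + tau y"
    and level: "\<And>i j. i < r \<Longrightarrow> e i j \<in> F (int v * int j + c)"
    and indep: "\<And>J a. (\<Sum>(i, j)\<in>{..<r} \<times> {..<J}. scale (a (i, j)) (e i j)) = 0 \<Longrightarrow>
      \<forall>i<r. \<forall>j<J. a (i, j) = 0"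
  shows "r * u \<le> n * v"
proof -
  obtain n' b \<kappa> where red: "reduced n' b \<kappa>" "range (tau_comb n' b) = UNIV"
    using reduced_basis_exists by blast
  obtain D' where D': "\<And>k. \<exists>T. finite T \<and> F k \<subseteq> span T \<and> int u * int (card T) \<le> int n' * max 0 (k + D')"
    using reduced_basis_growth[OF red] by blast
  have "int r * int u \<le> int n' * int v"
  proof (rule int_le_if_linear_bound[where d = "c + D'"])
    fix J :: nat
    let ?I = "{..<r} \<times> {..<J}"
    obtain T where T: "finite T" "F (int v * int J + c) \<subseteq> span T"
        "int u * int (card T) \<le> int n' * max 0 (int v * int J + c + D')"
      using D' by blast
    have "card ?I \<le> card T"
    proof (rule card_le_of_independent_family[where e = "\<lambda>(i, j). e i j"])
      show "(\<lambda>(i, j). e i j) ` ?I \<subseteq> span T"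
      proof clarsimp
        fix i j assume ij: "i < r" "j < J"
        have "int v * int j \<le> int v * int J" using ij by (simp add: mult_left_mono)
        then have "F (int v * int j + c) \<subseteq> F (int v * int J + c)" by (intro F_mono) linarith
        then show "e i j \<in> span T" using level[OF ij(1)] T by blast
      qed
      show "\<forall>i\<in>?I. a i = 0" if "(\<Sum>i\<in>?I. scale (a i) (case i of (i, j) \<Rightarrow> e i j)) = 0" for a
        using indep[of a J] that by (auto simp: case_prod_unfold)
    qed (use T in auto)
    then have "int r * int J \<le> int (card T)" by (simp flip: of_nat_mult)
    then have "int u * (int r * int J) \<le> int u * int (card T)" by (rule mult_left_mono) simp
    also note T(3)
    finally show "int r * int u * int J \<le> int n' * max 0 (int v * int J + (c + D'))"
      by (simp add: algebra_simps)
  qed auto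
  also have "\<dots> \<le> int n * int v"
    using reduced_basis_card_le[OF red gen] by (simp add: mult_right_mono)
  finally show ?thesis by (simp flip: of_nat_mult)
qed

end


section \<open>Laurent series in \<open>1/T\<close>\<close>

text \<open>\<open>fls_deg_le k h\<close> means \<open>h \<in> T\<^sup>k \<complex>\<^sub>\<infinity>[[1/T]]\<close>.\<close>

definition fls_deg_le :: "int \<Rightarrow> 'c::field fls \<Rightarrow> bool" where
  "fls_deg_le k h \<longleftrightarrow> (\<forall>i. i < - k \<longrightarrow> fls_nth h i = 0)"

lemma fls_deg_le_0 [simp]: "fls_deg_le k 0"
  by (simp add: fls_deg_le_def)

lemma fls_deg_le_iff: "fls_deg_le k h \<longleftrightarrow> h = 0 \<or> - fls_subdegree h \<le> k"
proof (cases "h = 0")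
  case False
  then have "fls_nth h (fls_subdegree h) \<noteq> 0" by simp
  then show ?thesis
    unfolding fls_deg_le_def using False by (smt (verit) fls_eq0_below_subdegree)
qed simp

lemma fls_deg_le_mono: "fls_deg_le k h \<Longrightarrow> k \<le> l \<Longrightarrow> fls_deg_le l h"
  by (auto simp: fls_deg_le_def)

lemma fls_deg_le_add: "fls_deg_le k g \<Longrightarrow> fls_deg_le k h \<Longrightarrow> fls_deg_le k (g + h)"
  by (simp add: fls_deg_le_def)

lemma fls_deg_le_sum: "(\<And>i. i \<in> I \<Longrightarrow> fls_deg_le k (h i)) \<Longrightarrow> fls_deg_le k (\<Sum>i\<in>I. h i)"
  by (induction I rule: infinite_finite_induct) (auto intro: fls_deg_le_add)

lemma fls_deg_le_mult: "fls_deg_le k g \<Longrightarrow> fls_deg_le l h \<Longrightarrow> fls_deg_le (k + l) (g * h)"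
  by (cases "g = 0 \<or> h = 0") (auto simp: fls_deg_le_iff)

lemma fls_deg_le_X_inv_power_mult:
  "fls_deg_le (k + int n) (fls_X_inv ^ n * h) \<longleftrightarrow> fls_deg_le k h"
  by (cases "h = 0") (auto simp: fls_deg_le_iff fls_subdegree_mult_fls_X_inv_power)

lemma fls_deg_le_1 [simp]: "fls_deg_le 0 1"
  by (simp add: fls_deg_le_iff)

lemma fls_deg_le_ex: "\<exists>k::nat. fls_deg_le (int k) h"
  by (rule exI[of _ "nat (- fls_subdegree h)"]) (auto simp: fls_deg_le_iff)

lemma range_fps_to_fls: "(range fps_to_fls :: 'a::field fls set) = {h. fls_deg_le 0 h}"
proof safe
  fix h :: "'a fls" assume "fls_deg_le 0 h"
  then have "fls_subdegree h \<ge> 0" by (auto simp: fls_deg_le_iff)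
  then have "fps_to_fls (fls_regpart h) = h" by simp
  then show "h \<in> range fps_to_fls" by (metis rangeI)
qed (auto simp: fls_deg_le_def)

lemma poly_to_fls_inv_0 [simp]: "poly_to_fls_inv 0 = 0"
  by (simp add: poly_to_fls_inv_def)

lemma poly_to_fls_inv_pCons:
  "poly_to_fls_inv (pCons a p) = fls_const a + fls_X_inv * poly_to_fls_inv p"
  by (simp add: poly_to_fls_inv_def map_poly_pCons)

lemma fls_nth_poly_to_fls_inv:
  "fls_nth (poly_to_fls_inv p) i = (if i \<le> 0 then Polynomial.coeff p (nat (- i)) else 0)"
proof (induction p arbitrary: i)
  case (pCons a p)
  have "i < 0 \<Longrightarrow> nat (- i) = Suc (nat (- i - 1))" by linarith
  then show ?case
    by (auto simp: poly_to_fls_inv_pCons fls_X_inv_times_conv_shift pCons.IH)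
qed simp

lemma poly_to_fls_inv_add: "poly_to_fls_inv (p + p') = poly_to_fls_inv p + poly_to_fls_inv p'"
  by (rule fls_eqI) (simp add: fls_nth_poly_to_fls_inv)

lemma poly_to_fls_inv_mult: "poly_to_fls_inv (p * p') = poly_to_fls_inv p * poly_to_fls_inv p'"
proof (induction p)
  case (pCons a p)
  have "poly_to_fls_inv (Polynomial.smult a p') = fls_const a * poly_to_fls_inv p'"
    by (rule fls_eqI) (simp add: fls_nth_poly_to_fls_inv)
  then show ?case
    by (simp add: mult_pCons_left poly_to_fls_inv_add poly_to_fls_inv_pCons pCons.IH distrib_right mult.assoc)
qed simp

lemma comm_ring_hom_poly_to_fls_inv: "comm_ring_hom (poly_to_fls_inv :: 'c::field poly \<Rightarrow> _)"
proof
  show "poly_to_fls_inv 1 = (1 :: 'c fls)"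
    by (simp add: one_pCons poly_to_fls_inv_pCons)
qed (simp_all add: poly_to_fls_inv_add poly_to_fls_inv_mult)

interpretation pfi: comm_ring_hom "poly_to_fls_inv :: 'c::field poly \<Rightarrow> _"
  by (rule comm_ring_hom_poly_to_fls_inv)

lemma poly_to_fls_inv_eq_0_iff [simp]: "poly_to_fls_inv p = 0 \<longleftrightarrow> p = 0"
proof
  assume *: "poly_to_fls_inv p = 0"
  have "Polynomial.coeff p n = 0" for n
    using fls_nth_poly_to_fls_inv[of p "- int n"] * by simp
  then show "p = 0" by (simp add: poly_eq_iff)
qed simp

lemma poly_to_fls_inv_eq_iff [simp]: "poly_to_fls_inv p = poly_to_fls_inv p' \<longleftrightarrow> p = p'"
  using poly_to_fls_inv_eq_0_iff[of "p - p'"] by (simp add: pfi.hom_minus)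

lemma coeff_eq_0_if_fls_deg_le:
  assumes "fls_deg_le k (poly_to_fls_inv p)" "int i > k"
  shows "Polynomial.coeff p i = 0"
  using assms fls_nth_poly_to_fls_inv[of p "- int i"] by (simp add: fls_deg_le_def)

lemma fls_subdegree_linear_power:
  "fls_subdegree (poly_to_fls_inv ([:a, 1:] ^ m)) = - int m"
proof -
  have "fls_subdegree (poly_to_fls_inv [:a, 1:]) = - 1"
    by (rule fls_subdegree_eqI) (auto simp: fls_nth_poly_to_fls_inv coeff_pCons split: nat.splits)
  then show ?thesis by (simp add: pfi.hom_power fls_subdegree_pow)
qed

section \<open>The coefficientwise q-th power on Laurent series and polynomials\<close>

context frobenius_field
begin

lemma fls_nth_frob [simp]: "fls_nth (frob_fls q (k :: 'c fls)) i = fls_nth k i ^ q"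
  unfolding frob_fls_def
proof (rule nth_Abs_fls_lower_bound, intro allI impI)
  show "fls_nth k i ^ q = 0" if "i < fls_subdegree k" for i
    using that by simp
qed

lemma fls_deg_le_frob [simp]: "fls_deg_le k (frob_fls q (h :: 'c fls)) \<longleftrightarrow> fls_deg_le k h"
  using q_pos by (simp add: fls_deg_le_def)

lemma frob_fls_eq_0_iff [simp]: "frob_fls q (h :: 'c fls) = 0 \<longleftrightarrow> h = 0"
  using q_pos by (simp add: fls_eq_iff)

lemma frob_fls_0 [simp]: "frob_fls q (0 :: 'c fls) = 0"
  by simp

lemma fls_subdegree_frob [simp]: "fls_subdegree (frob_fls q (h :: 'c fls)) = fls_subdegree h"
proof (cases "h = 0")
  case False
  then have "fls_nth h (fls_subdegree h) \<noteq> 0" by simp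
  then show ?thesis by (intro fls_subdegree_eqI) auto
qed simp

lemma comm_ring_hom_frob_fls: "comm_ring_hom (frob_fls q :: 'c fls \<Rightarrow> 'c fls)"
proof
  show "frob_fls q (g * h) = frob_fls q g * frob_fls q h" for g h :: "'c fls"
    by (rule fls_eqI) (simp add: fls_times_nth(2) frob_sum power_mult_distrib)
  show "frob_fls q (g + h) = frob_fls q g + frob_fls q h" for g h :: "'c fls"
    by (rule fls_eqI) (simp add: frob_add)
  show "frob_fls q 0 = (0 :: 'c fls)" by simp
  show "frob_fls q 1 = (1 :: 'c fls)" by (rule fls_eqI) simp
qed

lemma frob_fls_iterate: "frob_fls q (frob_fls (q ^ v) (h :: 'c fls)) = frob_fls (q ^ Suc v) h"
proof -
  interpret v: frobenius_field "TYPE('c)" "q ^ v" by (rule frobenius_field_power)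
  interpret v': frobenius_field "TYPE('c)" "q ^ Suc v" by (rule frobenius_field_power)
  show ?thesis
    by (rule fls_eqI) (metis fls_nth_frob v.fls_nth_frob v'.fls_nth_frob power_mult power_Suc2)
qed

lemma coeff_frob_poly [simp]: "Polynomial.coeff (frob_poly q (p :: 'c poly)) i = Polynomial.coeff p i ^ q"
  by (simp add: frob_poly_def coeff_map_poly)

lemma poly_to_fls_inv_frob: "poly_to_fls_inv (frob_poly q (p :: 'c poly)) = frob_fls q (poly_to_fls_inv p)"
  by (rule fls_eqI) (simp add: fls_nth_poly_to_fls_inv)

text \<open>The homomorphism laws are pulled back from Laurent series along the injective map
  \<open>poly_to_fls_inv\<close>, which commutes with the twist.\<close>

lemma comm_ring_hom_frob_poly: "comm_ring_hom (frob_poly q :: 'c poly \<Rightarrow> 'c poly)"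
proof -
  interpret s: comm_ring_hom "frob_fls q :: 'c fls \<Rightarrow> 'c fls" by (rule comm_ring_hom_frob_fls)
  show ?thesis
    by unfold_locales
      (simp_all only: poly_to_fls_inv_eq_iff[symmetric] poly_to_fls_inv_frob
        pfi.hom_add pfi.hom_mult s.hom_add s.hom_mult pfi.hom_one s.hom_one pfi.hom_zero s.hom_zero)
qed

lemma frob_poly_surj: "\<exists>p'. frob_poly q p' = (p :: 'c poly)"
proof (induction p)
  case 0
  show ?case by (rule exI[of _ 0]) (simp add: frob_poly_def)
next
  case (pCons a p)
  then obtain p' b where "frob_poly q p' = p" "b ^ q = a" using frob_surj by blast
  then show ?case
    by (intro exI[of _ "pCons b p'"]) (simp add: frob_poly_def map_poly_pCons)
qed

end


section \<open>Lattices\<close>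

declare One_nat_def [simp del]

lemma smult_mat_cancel:
  assumes "c \<cdot>\<^sub>m A = c \<cdot>\<^sub>m B" "(c :: 'a::field) \<noteq> 0"
  shows "A = B"
proof -
  have "inverse c \<cdot>\<^sub>m (c \<cdot>\<^sub>m Y) = Y" for Y :: "'a mat"
    using assms(2) by (intro eq_matI) auto
  then show ?thesis using assms(1) by metis
qed

section \<open>Matrices of bounded degree in T, and spans of rows\<close>

definition fls_mat_le :: "int \<Rightarrow> 'c::field fls mat \<Rightarrow> bool" where
  "fls_mat_le k A \<longleftrightarrow> (\<forall>i<dim_row A. \<forall>j<dim_col A. fls_deg_le k (A $$ (i, j)))"

lemma fls_mat_le_mono: "fls_mat_le k A \<Longrightarrow> k \<le> l \<Longrightarrow> fls_mat_le l A"
  by (auto simp: fls_mat_le_def intro: fls_deg_le_mono)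

lemma fls_mat_le_mult:
  assumes "fls_mat_le k A" "fls_mat_le l B" "A \<in> carrier_mat n m" "B \<in> carrier_mat m p"
  shows "fls_mat_le (k + l) (A * B)"
  using assms
  by (auto simp: fls_mat_le_def scalar_prod_def intro!: fls_deg_le_sum fls_deg_le_mult)

lemma fls_mat_le_add:
  assumes "fls_mat_le k A" "fls_mat_le k B" "A \<in> carrier_mat n m" "B \<in> carrier_mat n m"
  shows "fls_mat_le k (A + B)"
  using assms by (auto simp: fls_mat_le_def intro!: fls_deg_le_add)

lemma fls_mat_le_smult:
  assumes "fls_deg_le l c" "fls_mat_le k A"
  shows "fls_mat_le (l + k) (c \<cdot>\<^sub>m A)"
  using assms by (auto simp: fls_mat_le_def intro!: fls_deg_le_mult)

lemma fls_mat_le_transpose [simp]: "fls_mat_le k (transpose_mat A) \<longleftrightarrow> fls_mat_le k A"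
  by (auto simp: fls_mat_le_def)

lemma fls_mat_le_zero [simp]: "fls_mat_le k (0\<^sub>m n m)"
  by (simp add: fls_mat_le_def)

lemma fls_mat_le_X_inv_power_smult:
  "fls_mat_le (k + int n) (fls_X_inv ^ n \<cdot>\<^sub>m A) \<longleftrightarrow> fls_mat_le k A"
  by (simp add: fls_mat_le_def fls_deg_le_X_inv_power_mult)

lemma fls_mat_le_ex: "\<exists>k::nat. fls_mat_le (int k) A"
proof -
  have "\<forall>h. \<exists>k::nat. fls_deg_le (int k) h" using fls_deg_le_ex by blast
  then obtain d :: "'a fls \<Rightarrow> nat" where d: "\<And>h. fls_deg_le (int (d h)) h" by metis
  let ?I = "{..<dim_row A} \<times> {..<dim_col A}"
  have "fls_mat_le (int (\<Sum>e\<in>?I. d (A $$ e))) A"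
    unfolding fls_mat_le_def
  proof (intro allI impI)
    fix i j assume "i < dim_row A" "j < dim_col A"
    then have "d (A $$ (i, j)) \<le> (\<Sum>e\<in>?I. d (A $$ e))"
      by (intro member_le_sum) auto
    then show "fls_deg_le (int (\<Sum>e\<in>?I. d (A $$ e))) (A $$ (i, j))"
      by (intro fls_deg_le_mono[OF d]) (simp only: of_nat_le_iff)
  qed
  then show ?thesis by blast
qed

text \<open>Rows are kept as one-row matrices, so that the elements of a lattice are matrix products
  \<open>a * P\<close> and associativity applies to them directly.\<close>

definition row_mat :: "'a mat \<Rightarrow> nat \<Rightarrow> 'a mat" where
  "row_mat A i = mat 1 (dim_col A) (\<lambda>(_, j). A $$ (i, j))"

lemma row_mat_carrier [simp]: "A \<in> carrier_mat r n \<Longrightarrow> row_mat A i \<in> carrier_mat 1 n"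
  by (simp add: row_mat_def)

lemma row_mat_mult:
  "A \<in> carrier_mat r n \<Longrightarrow> B \<in> carrier_mat n m \<Longrightarrow> i < r \<Longrightarrow> row_mat (A * B) i = row_mat A i * B"
  by (rule eq_matI) (auto simp: row_mat_def scalar_prod_def intro!: sum.cong)

lemma row_mat_map: "A \<in> carrier_mat r n \<Longrightarrow> i < r \<Longrightarrow> row_mat (map_mat f A) i = map_mat f (row_mat A i)"
  by (rule eq_matI) (auto simp: row_mat_def)

lemma row_mat_smult: "A \<in> carrier_mat r n \<Longrightarrow> i < r \<Longrightarrow> row_mat (c \<cdot>\<^sub>m A) i = c \<cdot>\<^sub>m row_mat A i"
  by (rule eq_matI) (auto simp: row_mat_def)

lemma eq_row_matI:
  assumes "A \<in> carrier_mat r n" "B \<in> carrier_mat r n" "\<And>i. i < r \<Longrightarrow> row_mat A i = row_mat B i"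
  shows "A = B"
proof (rule eq_matI)
  fix i j assume "i < dim_row B" "j < dim_col B"
  then have "row_mat A i $$ (0, j) = row_mat B i $$ (0, j)" using assms by simp
  then show "A $$ (i, j) = B $$ (i, j)"
    using assms \<open>j < dim_col B\<close> by (simp add: row_mat_def)
qed (use assms in auto)

lemma fls_mat_le_row_mat: "fls_mat_le k A \<Longrightarrow> i < dim_row A \<Longrightarrow> fls_mat_le k (row_mat A i)"
  by (simp add: fls_mat_le_def row_mat_def)

definition stack_mat :: "nat \<Rightarrow> (nat \<Rightarrow> 'a mat) \<Rightarrow> 'a mat" where
  "stack_mat r h = mat r r (\<lambda>(i, j). h i $$ (0, j))"

lemma stack_mat_carrier [simp]: "stack_mat r h \<in> carrier_mat r r"
  by (simp add: stack_mat_def)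

lemma row_mat_stack [simp]: "h i \<in> carrier_mat 1 r \<Longrightarrow> i < r \<Longrightarrow> row_mat (stack_mat r h) i = h i"
  by (rule eq_matI) (auto simp: row_mat_def stack_mat_def)

lemma fls_mat_le_stack:
  "(\<And>i. i < r \<Longrightarrow> h i \<in> carrier_mat 1 r) \<Longrightarrow> (\<And>i. i < r \<Longrightarrow> fls_mat_le k (h i)) \<Longrightarrow>
    fls_mat_le k (stack_mat r h)"
  unfolding fls_mat_le_def stack_mat_def by fastforce

text \<open>The cofactors along row \<open>k\<close> do not involve that row. The determinant is
  thus an explicit linear function of the replaced row, which gives both multilinearity and Cramer's
  rule.\<close>

lemma det_stack_mat_update:
  fixes h :: "nat \<Rightarrow> 'a::comm_ring_1 mat"
  assumes "k < r"
  shows "det (stack_mat r (h(k := Y))) = (\<Sum>j<r. Y $$ (0, j) * cofactor (stack_mat r h) k j)"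
proof -
  have "mat_delete (stack_mat r (h(k := Y))) k j = mat_delete (stack_mat r h) k j" if "j < r" for j
    using that by (intro eq_matI) (auto simp: mat_delete_def stack_mat_def)
  then show ?thesis
    using assms by (subst laplace_expansion_row[OF stack_mat_carrier assms])
      (auto simp: cofactor_def stack_mat_def intro!: sum.cong)
qed

text \<open>The rules mirror those of \<open>tensor_span\<close>, so that the coordinate map carries
  one set to the other rule by rule.\<close>

inductive_set row_span :: "nat \<Rightarrow> 'a::comm_ring_1 set \<Rightarrow> 'a mat set \<Rightarrow> 'a mat set"
  for r S G where
  zero: "0\<^sub>m 1 r \<in> row_span r S G"
| add: "c \<in> S \<Longrightarrow> A \<in> G \<Longrightarrow> B \<in> row_span r S G \<Longrightarrow> c \<cdot>\<^sub>m A + B \<in> row_span r S G"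

lemma row_span_carrier:
  assumes "G \<subseteq> carrier_mat 1 r"
  shows "row_span r S G \<subseteq> carrier_mat 1 r"
proof
  fix x assume "x \<in> row_span r S G"
  then show "x \<in> carrier_mat 1 r" by induction (use assms in auto)
qed

lemma row_span_base: "1 \<in> S \<Longrightarrow> A \<in> G \<Longrightarrow> A \<in> carrier_mat 1 r \<Longrightarrow> A \<in> row_span r S G"
proof -
  assume *: "1 \<in> S" "A \<in> G" "A \<in> carrier_mat 1 r"
  have "1 \<cdot>\<^sub>m A = A" by (rule eq_matI) auto
  then show ?thesis using row_span.add[OF *(1,2) row_span.zero, of r] *(3) by simp
qed

lemma mult_mat_in_row_span:
  fixes a P :: "'a::comm_ring_1 mat"
  assumes "a \<in> carrier_mat 1 r" "P \<in> carrier_mat r n"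
    and "\<And>i. i < r \<Longrightarrow> a $$ (0, i) \<in> S" "\<And>i. i < r \<Longrightarrow> row_mat P i \<in> G"
  shows "a * P \<in> row_span n S G"
proof -
  have *: "mat 1 n (\<lambda>(_, j). \<Sum>i<k. a $$ (0, i) * P $$ (i, j)) \<in> row_span n S G" if "k \<le> r" for k
    using that
  proof (induction k)
    case 0
    have "mat 1 n (\<lambda>(_, j). \<Sum>i<0. a $$ (0, i) * P $$ (i, j)) = 0\<^sub>m 1 n"
      by (rule eq_matI) auto
    then show ?case by (simp only: row_span.zero)
  next
    case (Suc k)
    have "mat 1 n (\<lambda>(_, j). \<Sum>i<Suc k. a $$ (0, i) * P $$ (i, j)) =
        a $$ (0, k) \<cdot>\<^sub>m row_mat P k + mat 1 n (\<lambda>(_, j). \<Sum>i<k. a $$ (0, i) * P $$ (i, j))"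
      using assms(2) by (intro eq_matI) (auto simp: row_mat_def)
    then show ?case using Suc assms(3,4)[of k] by (auto intro: row_span.add)
  qed
  have "mat 1 n (\<lambda>(_, j). \<Sum>i<r. a $$ (0, i) * P $$ (i, j)) = a * P"
    using assms(1,2) by (intro eq_matI) (auto simp: scalar_prod_def atLeast0LessThan)
  with *[OF order_refl] show ?thesis by (simp only:)
qed

lemma row_mat_eq_mult:
  assumes "i < r" "(A :: 'c::field fls mat) \<in> carrier_mat r r"
  shows "\<exists>a. a \<in> carrier_mat 1 r \<and> fls_mat_le 0 a \<and> row_mat A i = a * A"
proof (intro exI conjI)
  show "row_mat A i = row_mat (1\<^sub>m r) i * A"
    using row_mat_mult[of "1\<^sub>m r" r r A r i] assms by simp
  show "fls_mat_le 0 (row_mat (1\<^sub>m r) i :: 'c fls mat)"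
    using assms by (intro fls_mat_le_row_mat) (auto simp: fls_mat_le_def)
qed (simp add: row_mat_carrier[of _ r])

lemma row_span_in_row_lattice:
  fixes A :: "'c::field fls mat"
  assumes "x \<in> row_span r (range fps_to_fls) H" and A: "A \<in> carrier_mat r r"
    and H: "\<And>y. y \<in> H \<Longrightarrow> \<exists>a. a \<in> carrier_mat 1 r \<and> fls_mat_le 0 a \<and> y = a * A"
  shows "\<exists>a. a \<in> carrier_mat 1 r \<and> fls_mat_le 0 a \<and> x = a * A"
  using assms(1)
proof induction
  case zero
  show ?case using A by (intro exI[of _ "0\<^sub>m 1 r"]) auto
next
  case (add c y z)
  then obtain a where a: "a \<in> carrier_mat 1 r" "fls_mat_le 0 a" "z = a * A" by blast
  obtain b where b: "b \<in> carrier_mat 1 r" "fls_mat_le 0 b" "y = b * A"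
    using H add by blast
  have "c \<cdot>\<^sub>m y + z = (c \<cdot>\<^sub>m b + a) * A"
    using a b A by (simp add: add_mult_distrib_mat[of _ 1 r _ _ r] mult_smult_assoc_mat[of _ 1 r _ r])
  moreover have "fls_mat_le 0 (c \<cdot>\<^sub>m b + a)"
    using fls_mat_le_smult[of 0 c 0 b] add a b
    by (intro fls_mat_le_add[of _ _ _ 1 r]) (auto simp: range_fps_to_fls)
  ultimately show ?case using a b by (intro exI[of _ "c \<cdot>\<^sub>m b + a"]) auto
qed

text \<open>If every choice of \<open>r\<close> rows from \<open>G\<close> had determinant 0, the
  rows could be freed one at a time: linearity in row \<open>k\<close> extends the vanishing from
  \<open>G\<close> to its span and then to all rows. In the induction the first \<open>k\<close>
  rows are arbitrary and the others are in \<open>G\<close>. For \<open>k = r\<close> the identity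
  matrix gives a contradiction.\<close>

lemma det_nonzero_in_spanning_set:
  fixes G :: "'a::field mat set"
  assumes G: "G \<subseteq> carrier_mat 1 r"
    and span: "row_span r UNIV (row_span r S G) = carrier_mat 1 r"
  shows "\<exists>h. (\<forall>i<r. h i \<in> G) \<and> det (stack_mat r h) \<noteq> 0"
proof (rule ccontr)
  assume "\<not> ?thesis"
  then have zero: "det (stack_mat r h) = 0" if "\<forall>i<r. h i \<in> G" for h using that by blast
  have "det (stack_mat r h) = 0"
    if "k \<le> r" "\<forall>i<r. h i \<in> carrier_mat 1 r" "\<forall>i<r. k \<le> i \<longrightarrow> h i \<in> G" for k h
    using that
  proof (induction k arbitrary: h)
    case 0
    then show ?case using zero by simp
  next
    case (Suc k)
    then have k: "k < r" by simp
    define \<phi> where "\<phi> Y = det (stack_mat r (h(k := Y)))" for Y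
    have \<phi>: "\<phi> Y = (\<Sum>j<r. Y $$ (0, j) * cofactor (stack_mat r h) k j)" for Y
      unfolding \<phi>_def by (rule det_stack_mat_update[OF k])
    have \<phi>_lin: "\<phi> (c \<cdot>\<^sub>m A + B) = c * \<phi> A + \<phi> B"
      if "A \<in> carrier_mat 1 r" "B \<in> carrier_mat 1 r" for c A B
      unfolding \<phi> using that by (simp add: sum_distrib_left algebra_simps sum.distrib)
    have \<phi>_zero: "\<phi> (0\<^sub>m 1 r) = 0" by (simp add: \<phi>)
    have \<phi>_span: "\<phi> Y = 0"
      if "Y \<in> row_span r S' H" "H \<subseteq> carrier_mat 1 r" "\<And>A. A \<in> H \<Longrightarrow> \<phi> A = 0" for Y S' H
      using that(1)
    proof induction
      case (add c A B)
      then have "A \<in> carrier_mat 1 r" "B \<in> carrier_mat 1 r"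
        using that(2) row_span_carrier[OF that(2)] by auto
      then show ?case using add that(3) by (simp add: \<phi>_lin)
    qed (rule \<phi>_zero)
    have "\<phi> A = 0" if "A \<in> G" for A
      unfolding \<phi>_def using Suc that k G by (intro Suc.IH) (auto simp: le_Suc_eq)
    then have "\<phi> Y = 0" if "Y \<in> row_span r S G" for Y
      using \<phi>_span[OF that G] by blast
    then have "\<phi> Y = 0" if "Y \<in> row_span r UNIV (row_span r S G)" for Y
      using \<phi>_span[OF that row_span_carrier[OF G]] by blast
    then have "\<phi> (h k) = 0" using Suc.prems k by (simp add: span)
    then show ?case by (simp add: \<phi>_def)
  qed
  from this[of r "row_mat (1\<^sub>m r)"] have "det (stack_mat r (row_mat (1\<^sub>m r :: 'a mat))) = 0"
    by (simp add: row_mat_carrier[of _ r])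
  moreover have "stack_mat r (row_mat (1\<^sub>m r)) = (1\<^sub>m r :: 'a mat)"
    by (rule eq_matI) (auto simp: stack_mat_def row_mat_def)
  ultimately show False by simp
qed

text \<open>
  Among the generators choose \<open>r\<close> rows whose determinant has maximal degree; by Cramer's rule
  every other generator is an integral combination of these rows.
\<close>

lemma lattice_basis:
  fixes G :: "'c::field fls mat set"
  assumes "finite G" and G: "G \<subseteq> carrier_mat 1 r"
    and span: "row_span r UNIV (row_span r (range fps_to_fls) G) = carrier_mat 1 r"
  obtains P Pi where "P \<in> carrier_mat r r" "Pi \<in> carrier_mat r r" "P * Pi = 1\<^sub>m r" "Pi * P = 1\<^sub>m r"
    "row_span r (range fps_to_fls) G = {a * P | a. a \<in> carrier_mat 1 r \<and> fls_mat_le 0 a}"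
proof -
  \<comment> \<open>The selections are extensional functions, so that there are only finitely many
    of them; \<open>restr\<close> shows that restricting changes no determinant.\<close>
  define H where "H = {h \<in> {..<r} \<rightarrow>\<^sub>E G. det (stack_mat r h) \<noteq> 0}"
  have "finite H" using assms(1) by (simp add: H_def finite_PiE)
  obtain h0 where h0: "\<forall>i<r. h0 i \<in> G" "det (stack_mat r h0) \<noteq> 0"
    using det_nonzero_in_spanning_set[OF G span] by blast
  have restr: "stack_mat r (restrict h {..<r}) = stack_mat r h" for h :: "nat \<Rightarrow> 'c fls mat"
    by (rule eq_matI) (auto simp: stack_mat_def)
  have "restrict h0 {..<r} \<in> H" using h0 by (auto simp: H_def restr)
  then have "H \<noteq> {}" by blast
  \<comment> \<open>The series variable is \<open>1/T\<close>, so the greatest degree of a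
    determinant is the least subdegree.\<close>
  obtain h where h: "h \<in> H"
      and min: "\<And>h'. h' \<in> H \<Longrightarrow> fls_subdegree (det (stack_mat r h)) \<le> fls_subdegree (det (stack_mat r h'))"
    using ex_min_if_finite[of "(\<lambda>h. fls_subdegree (det (stack_mat r h))) ` H"] \<open>finite H\<close> \<open>H \<noteq> {}\<close>
    by (auto simp: not_less)
  define P where "P = stack_mat r h"
  have P: "P \<in> carrier_mat r r" and d: "det P \<noteq> 0" and hG: "\<And>i. i < r \<Longrightarrow> h i \<in> G"
    using h by (auto simp: P_def H_def)
  note adj = adj_mat[OF P]
  define Pi where "Pi = inverse (det P) \<cdot>\<^sub>m adj_mat P"
  have Pi: "Pi \<in> carrier_mat r r" using adj(1) by (simp add: Pi_def)
  have PPi: "P * Pi = 1\<^sub>m r"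
    unfolding Pi_def mult_smult_distrib[OF P adj(1)] adj(2) using d by (intro eq_matI) auto
  have PiP: "Pi * P = 1\<^sub>m r"
    unfolding Pi_def mult_smult_assoc_mat[OF adj(1) P] adj(3) using d by (intro eq_matI) auto
  have integral: "fls_mat_le 0 (g * Pi)" if g: "g \<in> G" for g
  proof -
    have gc: "g \<in> carrier_mat 1 r" using g G by blast
    have "fls_deg_le 0 ((g * Pi) $$ (0, i))" if i: "i < r" for i
    proof -
      define d' where "d' = det (stack_mat r (h(i := g)))"
      have "(g * Pi) $$ (0, i) = inverse (det P) * (\<Sum>j<r. g $$ (0, j) * cofactor P i j)"
        using i gc P by (simp add: Pi_def adj_mat_def scalar_prod_def sum_distrib_left
            atLeast0LessThan mult_ac)
      then have eq: "(g * Pi) $$ (0, i) = inverse (det P) * d'"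
        by (simp add: d'_def det_stack_mat_update[OF i] P_def)
      show ?thesis
      proof (cases "d' = 0")
        case False
        have "restrict (h(i := g)) {..<r} \<in> H"
          using False g hG by (auto simp: H_def restr d'_def)
        then have "fls_subdegree (det P) \<le> fls_subdegree d'"
          using min[of "restrict (h(i := g)) {..<r}"] by (simp only: P_def d'_def restr)
        then show ?thesis using False d by (simp add: eq fls_deg_le_iff fls_inverse_subdegree)
      qed (simp add: eq)
    qed
    then show ?thesis using gc Pi by (simp add: fls_mat_le_def)
  qed
  have "row_span r (range fps_to_fls) G = {a * P | a. a \<in> carrier_mat 1 r \<and> fls_mat_le 0 a}"
  proof safe
    fix x assume "x \<in> row_span r (range fps_to_fls) G"
    then have "\<exists>a. a \<in> carrier_mat 1 r \<and> fls_mat_le 0 a \<and> x = a * P"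
    proof (rule row_span_in_row_lattice[OF _ P])
      fix g assume g: "g \<in> G"
      then have gc: "g \<in> carrier_mat 1 r" using G by blast
      show "\<exists>a. a \<in> carrier_mat 1 r \<and> fls_mat_le 0 a \<and> g = a * P"
      proof (intro exI conjI)
        show "g = g * Pi * P"
          using gc Pi P PiP by (simp add: assoc_mult_mat[of _ 1 r _ r _ r])
      qed (use gc Pi integral[OF g] in auto)
    qed
    then show "\<exists>a. x = a * P \<and> a \<in> carrier_mat 1 r \<and> fls_mat_le 0 a" by blast
  next
    fix a :: "'c fls mat" assume "a \<in> carrier_mat 1 r" "fls_mat_le 0 a"
    then show "a * P \<in> row_span r (range fps_to_fls) G"
      using hG G by (intro mult_mat_in_row_span[OF _ P])
        (auto simp: fls_mat_le_def range_fps_to_fls P_def subset_iff)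
  qed
  then show thesis using that P Pi PPi PiP by blast
qed

text \<open>The action of \<tau> on coordinate rows, since \<tau> sends \<open>Y f\<close> to
  \<sigma>\<open>(Y) Q f\<close>.\<close>

definition frob_step :: "nat \<Rightarrow> 'c::field fls mat \<Rightarrow> 'c fls mat \<Rightarrow> 'c fls mat" where
  "frob_step q Q Y = map_mat (frob_fls q) Y * Q"

text \<open>The matrix of \<open>\<tau>\<^sup>v\<close>.\<close>

fun frob_pow :: "nat \<Rightarrow> 'c::field fls mat \<Rightarrow> nat \<Rightarrow> 'c fls mat" where
  "frob_pow q Q 0 = 1\<^sub>m (dim_row Q)"
| "frob_pow q Q (Suc v) = frob_step q Q (frob_pow q Q v)"

lemma frob_pow_carrier [simp]: "Q \<in> carrier_mat r r \<Longrightarrow> frob_pow q Q v \<in> carrier_mat r r"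
  by (induction v) (auto simp: frob_step_def)

text \<open>This is \<open>pure_motive\<close> transported to coordinate rows, with a lattice still
  given by generators instead of a basis.\<close>

definition pure_rows :: "nat \<Rightarrow> nat \<Rightarrow> 'c::field fls mat \<Rightarrow> bool" where
  "pure_rows q r Q \<longleftrightarrow>
     (\<exists>W G u v. finite G \<and> G \<subseteq> carrier_mat 1 r \<and> W = row_span r (range fps_to_fls) G \<and>
        row_span r UNIV W = carrier_mat 1 r \<and> u > 0 \<and> v > 0 \<and>
        row_span r (range fps_to_fls) ((frob_step q Q ^^ v) ` W) = (\<lambda>Y. fls_X_inv ^ u \<cdot>\<^sub>m Y) ` W)"

text \<open>
  The rows of \<open>P\<close> form a basis of a lattice \<open>W\<close> with \<open>\<tau>\<^sup>v W = T\<^sup>u W\<close>.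
\<close>

definition pure_matrix :: "nat \<Rightarrow> nat \<Rightarrow> 'c::field fls mat \<Rightarrow> nat \<Rightarrow> nat \<Rightarrow> bool" where
  "pure_matrix q r Q u v \<longleftrightarrow>
     (\<exists>P Pi U Ui. P \<in> carrier_mat r r \<and> Pi \<in> carrier_mat r r \<and> P * Pi = 1\<^sub>m r \<and> Pi * P = 1\<^sub>m r \<and>
        U \<in> carrier_mat r r \<and> Ui \<in> carrier_mat r r \<and> U * Ui = 1\<^sub>m r \<and> Ui * U = 1\<^sub>m r \<and>
        fls_mat_le 0 U \<and> fls_mat_le 0 Ui \<and>
        map_mat (frob_fls (q ^ v)) P * frob_pow q Q v = fls_X_inv ^ u \<cdot>\<^sub>m (U * P))"

section \<open>Lattices stable up to a power of T, and the matrix equation for a basis\<close>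

context frobenius_field
begin

lemma fls_mat_le_frob [simp]:
  "fls_mat_le k (map_mat (frob_fls q) (A :: 'c fls mat)) \<longleftrightarrow> fls_mat_le k A"
  by (simp add: fls_mat_le_def)

lemma map_mat_frob_mult:
  "(A :: 'c fls mat) \<in> carrier_mat n m \<Longrightarrow> B \<in> carrier_mat m p \<Longrightarrow>
    map_mat (frob_fls q) (A * B) = map_mat (frob_fls q) A * map_mat (frob_fls q) B"
proof -
  interpret s: comm_ring_hom "frob_fls q :: 'c fls \<Rightarrow> 'c fls" by (rule comm_ring_hom_frob_fls)
  show "A \<in> carrier_mat n m \<Longrightarrow> B \<in> carrier_mat m p \<Longrightarrow> ?thesis" by (rule s.mat_hom_mult)
qed

lemma map_mat_frob_one [simp]: "map_mat (frob_fls q) (1\<^sub>m r :: 'c fls mat) = 1\<^sub>m r"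
proof -
  interpret s: comm_ring_hom "frob_fls q :: 'c fls \<Rightarrow> 'c fls" by (rule comm_ring_hom_frob_fls)
  show ?thesis by (rule s.mat_hom_one)
qed

lemma map_mat_frob_iterate:
  "map_mat (frob_fls q) (map_mat (frob_fls (q ^ v)) (A :: 'c fls mat)) = map_mat (frob_fls (q ^ Suc v)) A"
  by (rule eq_matI) (auto simp: frob_fls_iterate simp del: power_Suc)

lemma frob_step_iterate:
  assumes "Q \<in> carrier_mat r r" "(Y :: 'c fls mat) \<in> carrier_mat n r"
  shows "(frob_step q Q ^^ v) Y = map_mat (frob_fls (q ^ v)) Y * frob_pow q Q v"
proof (induction v)
  case 0
  have "map_mat (frob_fls 1) Y = Y"
    by (rule eq_matI) (auto simp: frob_fls_def fls_nth_inverse)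
  then show ?case using assms by simp
next
  case (Suc v)
  have "(frob_step q Q ^^ Suc v) Y =
      map_mat (frob_fls q) (map_mat (frob_fls (q ^ v)) Y * frob_pow q Q v) * Q"
    unfolding funpow.simps comp_apply Suc by (rule frob_step_def)
  also have "\<dots> = map_mat (frob_fls (q ^ Suc v)) Y * map_mat (frob_fls q) (frob_pow q Q v) * Q"
    using assms by (subst map_mat_frob_mult[of _ n r _ r]) (auto simp: map_mat_frob_iterate simp del: power_Suc)
  also have "\<dots> = map_mat (frob_fls (q ^ Suc v)) Y * frob_pow q Q (Suc v)"
    using assms by (subst assoc_mult_mat[of _ n r _ r _ r]) (auto simp: frob_step_def)
  finally show ?case .
qed

text \<open>The rows of \<open>B\<close> are the images under \<open>\<tau>^v\<close> of a lattice
  basis, and they generate the integral span of the image of \<open>W\<close> because the twist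
  preserves integrality. The rows of \<open>T^u P\<close> generate \<open>T^u W\<close>. These
  lattices agree, so each set of rows is an integral combination of the other, and cancelling
  \<open>P\<close> shows that the two transition matrices are inverse to each other.\<close>

lemma pure_matrix_if_pure_rows:
  assumes Q: "(Q :: 'c fls mat) \<in> carrier_mat r r" and "pure_rows q r Q"
  shows "\<exists>u>0. \<exists>v>0. pure_matrix q r Q u v"
proof -
  obtain W G u v where G: "finite G" "G \<subseteq> carrier_mat 1 r" and WG: "W = row_span r (range fps_to_fls) G"
    and span: "row_span r UNIV W = carrier_mat 1 r" and uv: "u > 0" "v > 0"
    and eq: "row_span r (range fps_to_fls) ((frob_step q Q ^^ v) ` W) = (\<lambda>Y. fls_X_inv ^ u \<cdot>\<^sub>m Y) ` W"
    using assms(2) unfolding pure_rows_def by (elim exE conjE) (rule that)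
  interpret v: frobenius_field "TYPE('c)" "q ^ v" by (rule frobenius_field_power)
  obtain P Pi where P: "P \<in> carrier_mat r r" "Pi \<in> carrier_mat r r" "P * Pi = 1\<^sub>m r" "Pi * P = 1\<^sub>m r"
    and W: "W = {a * P | a. a \<in> carrier_mat 1 r \<and> fls_mat_le 0 a}"
    using lattice_basis[OF G] span unfolding WG by blast
  define B where "B = map_mat (frob_fls (q ^ v)) P * frob_pow q Q v"
  have B: "B \<in> carrier_mat r r" using P Q by (simp add: B_def)
  have rowP: "row_mat P i \<in> W" if "i < r" for i
    using row_mat_eq_mult[OF that P(1)] by (auto simp: W)
  have step: "(frob_step q Q ^^ v) (a * P) = map_mat (frob_fls (q ^ v)) a * B"
    if "a \<in> carrier_mat 1 r" for a
  proof -
    have "(frob_step q Q ^^ v) (a * P) = map_mat (frob_fls (q ^ v)) (a * P) * frob_pow q Q v"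
      using that P by (intro frob_step_iterate[OF Q, of _ 1]) auto
    then show ?thesis
      using that P Q by (simp add: v.map_mat_frob_mult[of _ 1 r _ r] B_def assoc_mult_mat[of _ 1 r _ r _ r])
  qed
  have "\<exists>a. a \<in> carrier_mat 1 r \<and> fls_mat_le 0 a \<and> row_mat B i = fls_X_inv ^ u \<cdot>\<^sub>m (a * P)"
    if i: "i < r" for i
  proof -
    have "row_mat B i = (frob_step q Q ^^ v) (row_mat P i)"
      using i P Q by (simp add: B_def row_mat_mult[of _ r r _ r] row_mat_map frob_step_iterate[OF Q, of _ 1])
    also have "\<dots> \<in> row_span r (range fps_to_fls) ((frob_step q Q ^^ v) ` W)"
    proof (rule row_span_base)
      show "(frob_step q Q ^^ v) (row_mat P i) \<in> carrier_mat 1 r"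
        using P(1) Q by (subst frob_step_iterate[OF Q, of _ 1]) (auto intro!: mult_carrier_mat[of _ 1 r])
    qed (use rowP[OF i] in \<open>auto simp: range_fps_to_fls\<close>)
    finally show ?thesis unfolding eq by (auto simp: W)
  qed
  then obtain a where a: "\<And>i. i < r \<Longrightarrow> a i \<in> carrier_mat 1 r" "\<And>i. i < r \<Longrightarrow> fls_mat_le 0 (a i)"
    "\<And>i. i < r \<Longrightarrow> row_mat B i = fls_X_inv ^ u \<cdot>\<^sub>m (a i * P)" by metis
  define U where "U = stack_mat r a"
  have U: "U \<in> carrier_mat r r" "fls_mat_le 0 U"
    using a by (auto simp: U_def intro: fls_mat_le_stack)
  have BU: "B = fls_X_inv ^ u \<cdot>\<^sub>m (U * P)"
  proof (rule eq_row_matI[of _ r r])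
    show "row_mat B i = row_mat (fls_X_inv ^ u \<cdot>\<^sub>m (U * P)) i" if "i < r" for i
      unfolding row_mat_smult[OF mult_carrier_mat[OF U(1) P(1)] that] row_mat_mult[OF U(1) P(1) that]
      using a[OF that] that by (simp add: U_def)
  qed (use B U P in auto)
  have "\<exists>a. a \<in> carrier_mat 1 r \<and> fls_mat_le 0 a \<and> x = a * B"
    if "x \<in> row_span r (range fps_to_fls) ((frob_step q Q ^^ v) ` W)" for x
    using that B
  proof (rule row_span_in_row_lattice)
    fix y assume "y \<in> (frob_step q Q ^^ v) ` W"
    then obtain a where "a \<in> carrier_mat 1 r" "fls_mat_le 0 a" "y = map_mat (frob_fls (q ^ v)) a * B"
      using step by (auto simp: W)
    then show "\<exists>a. a \<in> carrier_mat 1 r \<and> fls_mat_le 0 a \<and> y = a * B"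
      by (intro exI[of _ "map_mat (frob_fls (q ^ v)) a"]) auto
  qed
  then have "\<exists>a. a \<in> carrier_mat 1 r \<and> fls_mat_le 0 a \<and> fls_X_inv ^ u \<cdot>\<^sub>m row_mat P i = a * B"
    if "i < r" for i
    using rowP[OF that] unfolding eq by blast
  then obtain b where b: "\<And>i. i < r \<Longrightarrow> b i \<in> carrier_mat 1 r" "\<And>i. i < r \<Longrightarrow> fls_mat_le 0 (b i)"
    "\<And>i. i < r \<Longrightarrow> fls_X_inv ^ u \<cdot>\<^sub>m row_mat P i = b i * B" by metis
  define Ui where "Ui = stack_mat r b"
  have Ui: "Ui \<in> carrier_mat r r" "fls_mat_le 0 Ui"
    using b by (auto simp: Ui_def intro: fls_mat_le_stack)
  have "fls_X_inv ^ u \<cdot>\<^sub>m P = Ui * B"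
  proof (rule eq_row_matI[of _ r r])
    show "row_mat (fls_X_inv ^ u \<cdot>\<^sub>m P) i = row_mat (Ui * B) i" if "i < r" for i
      using that b B P Ui by (simp add: row_mat_smult[of _ r r] row_mat_mult[of _ r r _ r] Ui_def)
  qed (use B Ui P in auto)
  also have "\<dots> = fls_X_inv ^ u \<cdot>\<^sub>m (Ui * U * P)"
    unfolding BU using Ui U P
    by (simp add: mult_smult_distrib[of _ r r _ r] assoc_mult_mat[of _ r r _ r _ r])
  finally have "P = Ui * U * P"
    by (rule smult_mat_cancel) simp
  then have "P * Pi = Ui * U * P * Pi" by (rule arg_cong)
  also have "\<dots> = Ui * U * (P * Pi)"
    using U Ui P by (intro assoc_mult_mat[of _ r r _ r _ r]) auto
  also have "\<dots> = Ui * U" unfolding P(3) using U Ui by (intro right_mult_one_mat[of _ r]) auto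
  finally have UiU: "Ui * U = 1\<^sub>m r" unfolding P(3) by (rule sym)
  then have "U * Ui = 1\<^sub>m r"
    using mat_mult_left_right_inverse[OF Ui(1) U(1)] by simp
  then show ?thesis
    unfolding pure_matrix_def using uv P U Ui UiU BU[unfolded B_def]
    by (intro exI[of _ u] exI[of _ v] exI[of _ P] exI[of _ Pi] exI[of _ U] exI[of _ Ui] conjI)
qed

text \<open>The rows of \<open>P\<close> serve as generators. With \<open>U\<close> and
  \<open>Ui\<close> integral, the identities \<open>a * B = T^u (a * U * P)\<close> and
  \<open>T^u (a * P) = a * Ui * B\<close> give the two inclusions between the lattices.\<close>

lemma pure_rows_if_pure_matrix:
  assumes Q: "(Q :: 'c fls mat) \<in> carrier_mat r r" and "pure_matrix q r Q u v" "u > 0" "v > 0"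
  shows "pure_rows q r Q"
proof -
  interpret v: frobenius_field "TYPE('c)" "q ^ v" by (rule frobenius_field_power)
  obtain P Pi U Ui where P: "P \<in> carrier_mat r r" "Pi \<in> carrier_mat r r" "P * Pi = 1\<^sub>m r" "Pi * P = 1\<^sub>m r"
    and U: "U \<in> carrier_mat r r" "Ui \<in> carrier_mat r r" "U * Ui = 1\<^sub>m r" "Ui * U = 1\<^sub>m r"
      "fls_mat_le 0 U" "fls_mat_le 0 Ui"
    and eq: "map_mat (frob_fls (q ^ v)) P * frob_pow q Q v = fls_X_inv ^ u \<cdot>\<^sub>m (U * P)"
    using assms(2) unfolding pure_matrix_def by (elim exE conjE) (rule that)
  define B where "B = map_mat (frob_fls (q ^ v)) P * frob_pow q Q v"
  have B: "B \<in> carrier_mat r r" using P Q by (simp add: B_def)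
  define G where "G = row_mat P ` {..<r}"
  have G: "G \<subseteq> carrier_mat 1 r" using P by (auto simp: G_def)
  define W where "W = row_span r (range fps_to_fls) G"
  have span: "a * A \<in> row_span r (range fps_to_fls) H"
    if "a \<in> carrier_mat 1 r" "fls_mat_le 0 a" "A \<in> carrier_mat r r" "\<And>i. i < r \<Longrightarrow> row_mat A i \<in> H"
    for a A :: "'c fls mat" and H
    using that by (intro mult_mat_in_row_span) (auto simp: range_fps_to_fls fls_mat_le_def)
  have W: "W = {a * P | a. a \<in> carrier_mat 1 r \<and> fls_mat_le 0 a}"
  proof (intro equalityI subsetI)
    fix x assume "x \<in> W"
    then have "\<exists>a. a \<in> carrier_mat 1 r \<and> fls_mat_le 0 a \<and> x = a * P"
      unfolding W_def
    proof (rule row_span_in_row_lattice[OF _ P(1)])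
      show "\<exists>a. a \<in> carrier_mat 1 r \<and> fls_mat_le 0 a \<and> y = a * P" if "y \<in> G" for y
        using that row_mat_eq_mult[OF _ P(1)] unfolding G_def by blast
    qed
    then show "x \<in> {a * P | a. a \<in> carrier_mat 1 r \<and> fls_mat_le 0 a}" by blast
  next
    fix x assume "x \<in> {a * P | a. a \<in> carrier_mat 1 r \<and> fls_mat_le 0 a}"
    then show "x \<in> W"
      unfolding W_def using span[OF _ _ P(1), of _ G] by (auto simp: G_def)
  qed
  have "row_span r UNIV W = carrier_mat 1 r"
  proof
    show "row_span r UNIV W \<subseteq> carrier_mat 1 r"
      using P(1) by (intro row_span_carrier) (auto simp: W)
    show "carrier_mat 1 r \<subseteq> row_span r UNIV W"
    proof
      fix x :: "'c fls mat" assume x: "x \<in> carrier_mat 1 r"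
      have "row_mat P i \<in> W" if "i < r" for i
        using row_mat_eq_mult[OF that P(1)] by (auto simp: W)
      then have "x * Pi * P \<in> row_span r UNIV W"
        using x P by (intro mult_mat_in_row_span) auto
      then show "x \<in> row_span r UNIV W"
        using x P by (simp add: assoc_mult_mat[of _ 1 r _ r _ r])
    qed
  qed
  moreover have "row_span r (range fps_to_fls) ((frob_step q Q ^^ v) ` W) = (\<lambda>Y. fls_X_inv ^ u \<cdot>\<^sub>m Y) ` W"
  proof -
    have step: "(frob_step q Q ^^ v) (a * P) = map_mat (frob_fls (q ^ v)) a * B"
      if "a \<in> carrier_mat 1 r" for a
    proof -
      have "(frob_step q Q ^^ v) (a * P) = map_mat (frob_fls (q ^ v)) (a * P) * frob_pow q Q v"
        using that P by (intro frob_step_iterate[OF Q, of _ 1]) auto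
      then show ?thesis
        using that P Q by (simp add: v.map_mat_frob_mult[of _ 1 r _ r] B_def assoc_mult_mat[of _ 1 r _ r _ r])
    qed
    have aB: "a * B = fls_X_inv ^ u \<cdot>\<^sub>m (a * U * P)" if "a \<in> carrier_mat 1 r" for a
      unfolding B_def eq using that U P
      by (simp add: mult_smult_distrib[of _ 1 r _ r] assoc_mult_mat[of _ 1 r _ r _ r])
    have aP: "fls_X_inv ^ u \<cdot>\<^sub>m (a * P) = a * Ui * B" if "a \<in> carrier_mat 1 r" for a
    proof -
      have "a * Ui * B = fls_X_inv ^ u \<cdot>\<^sub>m (a * (Ui * U) * P)"
        using that U P by (subst aB) (auto simp: assoc_mult_mat[of _ 1 r _ r _ r] assoc_mult_mat[of _ r r _ r _ r])
      then show ?thesis using that U by simp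
    qed
    show ?thesis
    proof (intro equalityI subsetI)
      fix x assume x: "x \<in> row_span r (range fps_to_fls) ((frob_step q Q ^^ v) ` W)"
      have "\<exists>a. a \<in> carrier_mat 1 r \<and> fls_mat_le 0 a \<and> x = a * B"
      proof (rule row_span_in_row_lattice[OF x B])
        fix y assume "y \<in> (frob_step q Q ^^ v) ` W"
        then obtain a where "a \<in> carrier_mat 1 r" "fls_mat_le 0 a" "y = map_mat (frob_fls (q ^ v)) a * B"
          using step by (auto simp: W)
        then show "\<exists>a. a \<in> carrier_mat 1 r \<and> fls_mat_le 0 a \<and> y = a * B"
          by (intro exI[of _ "map_mat (frob_fls (q ^ v)) a"]) auto
      qed
      then obtain a where a: "a \<in> carrier_mat 1 r" "fls_mat_le 0 a" "x = a * B" by blast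
      then have "x = fls_X_inv ^ u \<cdot>\<^sub>m (a * U * P)" using aB by simp
      moreover have "fls_mat_le 0 (a * U)" using fls_mat_le_mult[of 0 a 0 U 1 r r] a U by simp
      moreover have "a * U \<in> carrier_mat 1 r" using a U by simp
      ultimately show "x \<in> (\<lambda>Y. fls_X_inv ^ u \<cdot>\<^sub>m Y) ` W" unfolding W by blast
    next
      fix x assume "x \<in> (\<lambda>Y. fls_X_inv ^ u \<cdot>\<^sub>m Y) ` W"
      then obtain a where a: "a \<in> carrier_mat 1 r" "fls_mat_le 0 a" "x = a * Ui * B"
        using aP by (auto simp: W)
      have "fls_mat_le 0 (a * Ui)" using fls_mat_le_mult[of 0 a 0 Ui 1 r r] a U by simp
      then show "x \<in> row_span r (range fps_to_fls) ((frob_step q Q ^^ v) ` W)"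
        unfolding a(3)
      proof (rule span[rotated])
        fix i assume i: "i < r"
        have "row_mat B i = (frob_step q Q ^^ v) (row_mat P i)"
          using i P Q by (simp add: B_def row_mat_mult[of _ r r _ r] row_mat_map frob_step_iterate[OF Q, of _ 1])
        moreover have "row_mat P i \<in> W" using row_mat_eq_mult[OF i P(1)] by (auto simp: W)
        ultimately show "row_mat B i \<in> (frob_step q Q ^^ v) ` W" by blast
      qed (use a U B in auto)
    qed
  qed
  moreover have "finite G" by (simp add: G_def)
  ultimately show ?thesis
    unfolding pure_rows_def using G assms(3,4) W_def
    by (intro exI[of _ W] exI[of _ G] exI[of _ u] exI[of _ v] conjI)
qed

end


section \<open>Modules over \<open>\<complex>\<^sub>\<infinity>[T,\<tau>]\<close> and purity in coordinates\<close>

locale skew_mod = frobenius_field "TYPE('c)" q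
  for q :: nat and act :: "'c::field poly poly \<Rightarrow> 'm::ab_group_add \<Rightarrow> 'm" +
  assumes skew_module: "skew_module q act"
begin

abbreviation pm :: "'c poly \<Rightarrow> 'm \<Rightarrow> 'm" where "pm p \<equiv> act [:p:]"
abbreviation tau :: "'m \<Rightarrow> 'm" where "tau \<equiv> act sk_tau"
abbreviation scale :: "'c \<Rightarrow> 'm \<Rightarrow> 'm" where "scale a \<equiv> act [:[:a:]:]"

lemma act_add_right: "act s (x + y) = act s x + act s y"
  and act_add_left: "act (s + t) x = act s x + act t x"
  and act_skew_mult: "act (skew_mult q s t) x = act s (act t x)"
  and act_1 [simp]: "act 1 x = x"
  using skew_module by (auto simp: skew_module_def)

lemma act_0_left [simp]: "act 0 x = 0"
  using act_add_left[of 0 0 x] by simp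

lemma act_0_right [simp]: "act s 0 = 0"
  using act_add_right[of s 0 0] by simp

lemma act_sum_left: "act (\<Sum>i\<in>I. s i) x = (\<Sum>i\<in>I. act (s i) x)"
  by (induction I rule: infinite_finite_induct) (auto simp: act_add_left)

lemma act_sum_right: "act s (\<Sum>i\<in>I. x i) = (\<Sum>i\<in>I. act s (x i))"
  by (induction I rule: infinite_finite_induct) (auto simp: act_add_right)

lemma pm_1 [simp]: "pm 1 x = x"
  using act_1 by (simp add: one_pCons)

lemma pm_add: "pm (p + p') x = pm p x + pm p' x"
  using act_add_left[of "[:p:]" "[:p':]"] by simp

lemma pm_diff: "pm (p - p') x = pm p x - pm p' x"
  using pm_add[of "p - p'" p' x] by (simp add: eq_diff_eq)

lemma pm_sum: "pm (\<Sum>i\<in>I. p i) x = (\<Sum>i\<in>I. pm (p i) x)"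
  by (induction I rule: infinite_finite_induct) (auto simp: pm_add)

lemma pm_mult: "pm (p * p') x = pm p (pm p' x)"
  by (simp add: skew_mult_def monom_0 flip: act_skew_mult)

lemma tau_pm: "tau (pm p x) = pm (frob_poly q p) (tau x)"
proof -
  have "skew_mult q sk_tau [:p:] = skew_mult q [:frob_poly q p:] sk_tau"
    by (simp add: skew_mult_def sk_tau_def frob_poly_def)
  then show ?thesis by (metis act_skew_mult)
qed

lemma frob_poly_iterate_1 [simp]: "(frob_poly q ^^ i) (1 :: 'c poly) = 1"
  by (induction i) (auto simp: frob_poly_def one_pCons map_poly_pCons)

lemma skew_mult_monom_right:
  "skew_mult q (s :: 'c poly poly) (Polynomial.monom 1 k) =
    (\<Sum>i\<le>Polynomial.degree s. Polynomial.monom (Polynomial.coeff s i) (i + k))"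
proof -
  have *: "(frob_poly q ^^ i) (0 :: 'c poly) = 0" for i
    by (induction i) (auto simp: frob_poly_def)
  have "(\<Sum>j\<le>k. Polynomial.monom (Polynomial.coeff s i *
      (frob_poly q ^^ i) (Polynomial.coeff (Polynomial.monom 1 k) j)) (i + j)) =
      (\<Sum>j\<le>k. if j = k then Polynomial.monom (Polynomial.coeff s i) (i + k) else 0)" for i
    by (rule sum.cong) (auto simp: *)
  then show ?thesis
    unfolding skew_mult_def by (simp add: degree_monom_eq)
qed

lemma act_monom_1: "act (Polynomial.monom 1 k) x = (tau ^^ k) x"
proof (induction k)
  case 0
  show ?case by (simp add: monom_0 flip: one_pCons)
next
  case (Suc k)
  have "(Polynomial.monom 1 (Suc k) :: 'c poly poly) = skew_mult q sk_tau (Polynomial.monom 1 k)"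
    by (subst skew_mult_monom_right) (simp add: sk_tau_def)
  then show ?case by (simp add: act_skew_mult Suc)
qed

lemma act_monom: "act (Polynomial.monom p k) x = pm p ((tau ^^ k) x)"
proof -
  have "Polynomial.monom p k = skew_mult q [:p:] (Polynomial.monom 1 k)"
    by (subst skew_mult_monom_right) simp
  then show ?thesis by (simp add: act_skew_mult act_monom_1)
qed

lemma act_eq: "act s x = (\<Sum>i\<le>Polynomial.degree s. pm (Polynomial.coeff s i) ((tau ^^ i) x))"
  by (subst poly_as_sum_of_monoms[of s, symmetric]) (simp add: act_sum_left act_monom)

sublocale frob_space q scale tau
proof
  show "scale a (x + y) = scale a x + scale a y" for a x y by (rule act_add_right)
  show "scale (a + b) x = scale a x + scale b x" for a b x
    using pm_add[of "[:a:]" "[:b:]"] by simp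
  show "scale a (scale b x) = scale (a * b) x" for a b x
    using pm_mult[of "[:a:]" "[:b:]"] by (simp add: mult.commute)
  show "scale 1 x = x" for x by (simp flip: one_pCons)
  show "tau (x + y) = tau x + tau y" for x y by (rule act_add_right)
  show "tau (scale a x) = scale (a ^ q) (tau x)" for a x
    by (simp add: tau_pm frob_poly_def map_poly_pCons)
qed

lemma act_map_poly: "act (map_poly (\<lambda>a. [:a:]) p) x = pact p x"
proof -
  have "Polynomial.degree (map_poly (\<lambda>a. [:a:]) p) = Polynomial.degree p"
    by (rule degree_map_poly) simp
  then show ?thesis by (subst act_eq) (simp add: pact_def coeff_map_poly)
qed

lemma basis_T_span:
  assumes "is_basis act sk_ring_T r f"
  obtains c where "x = (\<Sum>i<r. pm (c i) (f i))"
proof -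
  obtain s where s: "\<forall>i<r. s i \<in> sk_ring_T" "x = (\<Sum>i<r. act (s i) (f i))"
    using conjunct1[OF assms[unfolded is_basis_def], THEN spec[of _ x]]
    by (elim exE conjE) (rule that)
  have "\<forall>i. \<exists>p. i < r \<longrightarrow> s i = [:p:]" using s(1) by (auto simp: sk_ring_T_def)
  then obtain c where "\<And>i. i < r \<Longrightarrow> s i = [:c i:]" by metis
  then have "x = (\<Sum>i<r. pm (c i) (f i))" using s(2) by simp
  then show thesis by (rule that)
qed

lemma basis_T_indep:
  assumes "is_basis act sk_ring_T r f" "(\<Sum>i<r. pm (c i) (f i)) = 0" "i < r"
  shows "c i = 0"
proof -
  have "[:c i:] = 0"
    using conjunct2[OF assms(1)[unfolded is_basis_def], THEN spec[of _ "\<lambda>i. [:c i:]"]] assms(2,3)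
    by (simp add: sk_ring_T_def)
  then show ?thesis by simp
qed

lemma basis_TI:
  assumes "\<And>x. \<exists>c. x = (\<Sum>i<r. pm (c i) (f i))"
    and "\<And>c i. (\<Sum>i<r. pm (c i) (f i)) = 0 \<Longrightarrow> i < r \<Longrightarrow> c i = 0"
  shows "is_basis act sk_ring_T r f"
  unfolding is_basis_def
proof (intro conjI allI impI)
  fix x
  obtain c where "x = (\<Sum>i<r. pm (c i) (f i))" using assms(1) by blast
  then show "\<exists>s. (\<forall>i<r. s i \<in> sk_ring_T) \<and> x = (\<Sum>i<r. act (s i) (f i))"
    by (intro exI[of _ "\<lambda>i. [:c i:]"]) (auto simp: sk_ring_T_def)
next
  fix s i assume s: "(\<forall>i<r. s i \<in> sk_ring_T) \<and> (\<Sum>i<r. act (s i) (f i)) = 0" and i: "i < r"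
  have eq: "s i = [:Polynomial.coeff (s i) 0:]" if "i < r" for i
    using s that by (auto simp: sk_ring_T_def)
  have "(\<Sum>i<r. pm (Polynomial.coeff (s i) 0) (f i)) = (\<Sum>i<r. act (s i) (f i))"
    by (rule sum.cong[OF refl]) (simp flip: eq)
  then have "(\<Sum>i<r. pm (Polynomial.coeff (s i) 0) (f i)) = 0" using s by simp
  then have "Polynomial.coeff (s i) 0 = 0" using assms(2)[of "\<lambda>i. Polynomial.coeff (s i) 0"] i by simp
  then show "s i = 0" using eq[OF i] by simp
qed

lemma basis_tau_span:
  assumes "is_basis act sk_ring_tau n g"
  obtains c where "x = tau_comb n g c"
proof -
  obtain s where s: "\<forall>i<n. s i \<in> sk_ring_tau" "x = (\<Sum>i<n. act (s i) (g i))"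
    using conjunct1[OF assms[unfolded is_basis_def], THEN spec[of _ x]]
    by (elim exE conjE) (rule that)
  have "\<forall>i. \<exists>p. i < n \<longrightarrow> s i = map_poly (\<lambda>a. [:a:]) p" using s(1) by (auto simp: sk_ring_tau_def)
  then obtain c where "\<And>i. i < n \<Longrightarrow> s i = map_poly (\<lambda>a. [:a:]) (c i)" by metis
  then have "x = tau_comb n g c" using s(2) by (simp add: tau_comb_def act_map_poly)
  then show thesis by (rule that)
qed

lemma basis_tauI:
  assumes full: "range (tau_comb n g) = UNIV"
    and indep: "\<And>c i. tau_comb n g c = 0 \<Longrightarrow> i < n \<Longrightarrow> c i = 0"
  shows "is_basis act sk_ring_tau n g"
  unfolding is_basis_def
proof (intro conjI allI impI)
  fix x
  obtain c where "x = tau_comb n g c" using full by (metis UNIV_I imageE)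
  then show "\<exists>s. (\<forall>i<n. s i \<in> sk_ring_tau) \<and> x = (\<Sum>i<n. act (s i) (g i))"
    by (intro exI[of _ "\<lambda>i. map_poly (\<lambda>a. [:a:]) (c i)"])
      (auto simp: sk_ring_tau_def tau_comb_def act_map_poly)
next
  fix s i assume s: "(\<forall>i<n. s i \<in> sk_ring_tau) \<and> (\<Sum>i<n. act (s i) (g i)) = 0" and i: "i < n"
  have "\<forall>i. \<exists>p. i < n \<longrightarrow> s i = map_poly (\<lambda>a. [:a:]) p" using s by (auto simp: sk_ring_tau_def)
  then obtain c where c: "\<And>i. i < n \<Longrightarrow> s i = map_poly (\<lambda>a. [:a:]) (c i)" by metis
  then have "tau_comb n g c = 0" using s by (simp add: tau_comb_def act_map_poly)
  then show "s i = 0" using indep[of c i] c i by simp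
qed

end

section \<open>Coordinates on the tensor product\<close>

definition frag_eval :: "('e \<Rightarrow> 'c::comm_ring_1) \<Rightarrow> ('e \<Rightarrow>\<^sub>0 int) \<Rightarrow> 'c" where
  "frag_eval h z = (\<Sum>e\<in>Poly_Mapping.keys z. of_int (Poly_Mapping.lookup z e) * h e)"

lemma frag_eval_superset:
  assumes "finite S" "Poly_Mapping.keys z \<subseteq> S"
  shows "frag_eval h z = (\<Sum>e\<in>S. of_int (Poly_Mapping.lookup z e) * h e)"
  unfolding frag_eval_def using assms
  by (intro sum.mono_neutral_left) (auto simp: in_keys_iff)

lemma frag_eval_0 [simp]: "frag_eval h 0 = 0"
  by (simp add: frag_eval_def)

lemma frag_eval_of [simp]: "frag_eval h (frag_of e) = h e"
  by (simp add: frag_eval_def)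

lemma frag_eval_diff: "frag_eval h (z - w) = frag_eval h z - frag_eval h w"
proof -
  let ?S = "Poly_Mapping.keys z \<union> Poly_Mapping.keys w"
  have "Poly_Mapping.keys (z - w) \<subseteq> ?S" by (rule keys_diff)
  then show ?thesis
    by (simp add: frag_eval_superset[of ?S] lookup_minus left_diff_distrib sum_subtractf)
qed

lemma frag_eval_add: "frag_eval h (z + w) = frag_eval h z + frag_eval h w"
  using frag_eval_diff[of h "z + w" w] by simp

lemma frag_eval_sum: "frag_eval h (\<Sum>i\<in>I. z i) = (\<Sum>i\<in>I. frag_eval h (z i))"
  by (induction I rule: infinite_finite_induct) (auto simp: frag_eval_add)

locale motive_basis = skew_mod q act
  for q :: nat and act :: "'c::field poly poly \<Rightarrow> 'm::ab_group_add \<Rightarrow> 'm" +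
  fixes r :: nat and f :: "nat \<Rightarrow> 'm" and Q :: "'c poly mat"
  assumes basis: "is_basis act sk_ring_T r f"
    and tau_matrix: "tau_matrix act r f Q"
begin

definition co :: "'m \<Rightarrow> nat \<Rightarrow> 'c poly" where
  "co x = (SOME c. x = (\<Sum>i<r. pm (c i) (f i)))"

lemma co: "x = (\<Sum>i<r. pm (co x i) (f i))"
proof -
  have "\<exists>c. x = (\<Sum>i<r. pm (c i) (f i))"
    using basis_T_span[OF basis, of x] by blast
  then show ?thesis unfolding co_def by (rule someI_ex)
qed

lemma co_unique:
  assumes "x = (\<Sum>i<r. pm (c i) (f i))" "i < r"
  shows "co x i = c i"
proof -
  have "(\<Sum>i<r. pm (co x i) (f i)) = (\<Sum>i<r. pm (c i) (f i))"
    using assms(1) co[of x] by simp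
  then have "(\<Sum>i<r. pm (co x i - c i) (f i)) = 0"
    by (simp add: pm_diff sum_subtractf)
  from basis_T_indep[OF basis this assms(2)] show ?thesis by simp
qed

lemma co_add: "i < r \<Longrightarrow> co (x + y) i = co x i + co y i"
  by (rule co_unique) (simp_all only: pm_add sum.distrib flip: co)

lemma co_pm: "i < r \<Longrightarrow> co (pm p x) i = p * co x i"
  by (rule co_unique) (simp_all only: pm_mult flip: act_sum_right co)

lemma co_zero [simp]: "i < r \<Longrightarrow> co 0 i = 0"
  by (rule co_unique) simp_all

lemma co_basis: "i < r \<Longrightarrow> j < r \<Longrightarrow> co (f i) j = (if i = j then 1 else 0)"
  by (rule co_unique) (simp_all add: if_distrib[of "\<lambda>p. pm p _"] cong: if_cong)

lemma co_eqI: "(\<And>i. i < r \<Longrightarrow> co x i = co y i) \<Longrightarrow> x = y"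
  by (subst co, subst (2) co) simp

lemma Q_carrier [simp]: "Q \<in> carrier_mat r r"
  using tau_matrix by (simp add: tau_matrix_def)

lemma dim_Q [simp]: "dim_row Q = r" "dim_col Q = r"
  using Q_carrier by blast+

lemma co_tau: "j < r \<Longrightarrow> co (tau x) j = (\<Sum>i<r. frob_poly q (co x i) * Q $$ (i, j))"
proof (rule co_unique)
  have "tau x = (\<Sum>i<r. pm (frob_poly q (co x i)) (tau (f i)))"
    by (subst co[of x]) (simp only: act_sum_right tau_pm)
  also have "\<dots> = (\<Sum>i<r. \<Sum>j<r. pm (frob_poly q (co x i) * Q $$ (i, j)) (f j))"
    using tau_matrix by (simp add: tau_matrix_def act_sum_right pm_mult)
  also have "\<dots> = (\<Sum>j<r. pm (\<Sum>i<r. frob_poly q (co x i) * Q $$ (i, j)) (f j))"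
    by (subst sum.swap) (simp only: pm_sum)
  finally show "tau x = (\<Sum>j<r. pm (\<Sum>i<r. frob_poly q (co x i) * Q $$ (i, j)) (f j))" .
qed

definition Qh :: "'c fls mat" where "Qh = map_mat poly_to_fls_inv Q"

lemma Qh_carrier [simp]: "Qh \<in> carrier_mat r r"
  by (simp add: Qh_def)

definition cv :: "'m \<Rightarrow> 'c fls mat" where
  "cv x = mat 1 r (\<lambda>(_, j). poly_to_fls_inv (co x j))"

lemma cv_carrier [simp]: "cv x \<in> carrier_mat 1 r"
  by (simp add: cv_def)

lemma cv_tau: "cv (tau x) = frob_step q Qh (cv x)"
  by (rule eq_matI)
    (auto simp: cv_def frob_step_def Qh_def scalar_prod_def co_tau pfi.hom_sum pfi.hom_mult
      poly_to_fls_inv_frob atLeast0LessThan)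

lemma cv_tau_pow: "cv ((tau ^^ v) x) = (frob_step q Qh ^^ v) (cv x)"
  by (induction v) (auto simp: cv_tau)

text \<open>The isomorphism of the tensor product with rows over the Laurent series, written on
  formal sums: a pair \<open>(x, k)\<close> goes to \<open>k\<close> times the coordinate row of
  \<open>x\<close>.\<close>

definition tensor_coord :: "('m \<times> 'c fls \<Rightarrow>\<^sub>0 int) \<Rightarrow> 'c fls mat" where
  "tensor_coord z = mat 1 r (\<lambda>(_, j). frag_eval (\<lambda>(x, k). k * poly_to_fls_inv (co x j)) z)"

lemma tensor_coord_carrier [simp]: "tensor_coord z \<in> carrier_mat 1 r"
  by (simp add: tensor_coord_def)

lemma tensor_coord_0 [simp]: "tensor_coord 0 = 0\<^sub>m 1 r"
  by (rule eq_matI) (auto simp: tensor_coord_def)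

lemma tensor_coord_of: "tensor_coord (frag_of (x, k)) = k \<cdot>\<^sub>m cv x"
  by (rule eq_matI) (auto simp: tensor_coord_def cv_def)

lemma tensor_coord_diff: "tensor_coord (z - w) = tensor_coord z - tensor_coord w"
  by (rule eq_matI) (auto simp: tensor_coord_def frag_eval_diff)

lemma tensor_coord_add: "tensor_coord (z + w) = tensor_coord z + tensor_coord w"
  by (rule eq_matI) (auto simp: tensor_coord_def frag_eval_add)

text \<open>A section of \<open>tensor_coord\<close>, the normal form with one term for each basis
  element.\<close>

definition tensor_vec :: "'c fls mat \<Rightarrow> ('m \<times> 'c fls \<Rightarrow>\<^sub>0 int)" where
  "tensor_vec Y = (\<Sum>j<r. frag_of (f j, Y $$ (0, j)))"

lemma tensor_coord_vec: "Y \<in> carrier_mat 1 r \<Longrightarrow> tensor_coord (tensor_vec Y) = Y"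
  by (rule eq_matI)
    (auto simp: tensor_coord_def tensor_vec_def frag_eval_sum co_basis if_distrib[of poly_to_fls_inv]
      if_distrib[of "\<lambda>h. _ * h"] cong: if_cong)

lemma tensor_null_gens:
  "frag_of (x + y, k) - frag_of (x, k) - frag_of (y, k) \<in> tensor_null act"
  "frag_of (x, k + l) - frag_of (x, k) - frag_of (x, l) \<in> tensor_null act"
  "frag_of (pm p x, k) - frag_of (x, poly_to_fls_inv p * k) \<in> tensor_null act"
  unfolding tensor_null_def by (rule group_closure.base, blast)+

lemma tensor_null_diff:
  "z \<in> tensor_null act \<Longrightarrow> w \<in> tensor_null act \<Longrightarrow> z - w \<in> tensor_null act"
  unfolding tensor_null_def by (rule group_closure.diff)

lemma tensor_null_add:
  "z \<in> tensor_null act \<Longrightarrow> w \<in> tensor_null act \<Longrightarrow> z + w \<in> tensor_null act"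
  unfolding tensor_null_def by (rule group_closure_add)

lemma tensor_null_0 [simp]: "0 \<in> tensor_null act"
  unfolding tensor_null_def by simp

lemma tensor_null_sum:
  "(\<And>i. i \<in> I \<Longrightarrow> z i \<in> tensor_null act) \<Longrightarrow> (\<Sum>i\<in>I. z i) \<in> tensor_null act"
  by (induction I rule: infinite_finite_induct) (auto intro: tensor_null_add)

lemma tensor_coord_null: "z \<in> tensor_null act \<Longrightarrow> tensor_coord z = 0\<^sub>m 1 r"
  unfolding tensor_null_def
proof (induction rule: group_closure.induct)
  case (base s)
  then show ?case
    by (auto simp: tensor_coord_diff tensor_coord_of)
      (auto intro!: eq_matI simp: cv_def co_add co_pm pfi.hom_add pfi.hom_mult algebra_simps)
next
  case (diff s t)
  then show ?case by (simp add: tensor_coord_diff)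
qed

text \<open>Modulo the relations, the first entry of a generator can be expanded in the basis and
  the polynomial coefficients moved to the second entry. This gives the normal form of a generator;
  differences of normal forms are regrouped by additivity in the second entry.\<close>

lemma tensor_null_reduce: "z - tensor_vec (tensor_coord z) \<in> tensor_null act"
proof (rule frag_induction[of z UNIV])
  have "frag_of (x, 0) \<in> tensor_null act" for x
    using tensor_null_diff[OF tensor_null_0 tensor_null_gens(2)[of x 0 0]] by simp
  then have "(\<Sum>j<r. frag_of (f j, 0)) \<in> tensor_null act" by (rule tensor_null_sum)
  from tensor_null_diff[OF tensor_null_0 this]
  show "0 - tensor_vec (tensor_coord 0) \<in> tensor_null act"
    by (simp add: tensor_vec_def)
next
  fix e :: "'m \<times> 'c fls"
  obtain x k where e: "e = (x, k)" by (cases e)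
  have zero: "frag_of (0, k) \<in> tensor_null act" for k
    using tensor_null_diff[OF tensor_null_0 tensor_null_gens(1)[of 0 0 k]] by simp
  have split: "frag_of (\<Sum>i\<in>I. y i, k) - (\<Sum>i\<in>I. frag_of (y i, k)) \<in> tensor_null act"
    if "finite I" for I :: "nat set" and y
    using that
  proof (induction I)
    case (insert i I)
    have "frag_of (\<Sum>j\<in>insert i I. y j, k) - (\<Sum>j\<in>insert i I. frag_of (y j, k)) =
        (frag_of (y i + (\<Sum>j\<in>I. y j), k) - frag_of (y i, k) - frag_of (\<Sum>j\<in>I. y j, k)) +
        (frag_of (\<Sum>j\<in>I. y j, k) - (\<Sum>j\<in>I. frag_of (y j, k)))"
      using insert by simp
    also have "\<dots> \<in> tensor_null act"
      by (intro tensor_null_add tensor_null_gens insert.IH)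
    finally show ?case .
  qed (simp add: zero)
  have "frag_of (x, k) - tensor_vec (k \<cdot>\<^sub>m cv x) =
      (frag_of (\<Sum>i<r. pm (co x i) (f i), k) - (\<Sum>i<r. frag_of (pm (co x i) (f i), k))) +
      (\<Sum>i<r. frag_of (pm (co x i) (f i), k) - frag_of (f i, poly_to_fls_inv (co x i) * k))"
    by (simp add: tensor_vec_def cv_def sum_subtractf mult.commute flip: co)
  also have "\<dots> \<in> tensor_null act"
    by (intro tensor_null_add split tensor_null_sum tensor_null_gens) auto
  finally show "frag_of e - tensor_vec (tensor_coord (frag_of e)) \<in> tensor_null act"
    by (simp add: e tensor_coord_of)
next
  fix a b
  assume ab: "a - tensor_vec (tensor_coord a) \<in> tensor_null act"
    "b - tensor_vec (tensor_coord b) \<in> tensor_null act"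
  define A B where "A = tensor_coord a" and "B = tensor_coord b"
  have AB: "A \<in> carrier_mat 1 r" "B \<in> carrier_mat 1 r" by (auto simp: A_def B_def)
  \<comment> \<open>Additivity is used for the decomposition \<open>A = (A - B) + B\<close>, because
    the relations are stated for sums.\<close>
  have "a - b - tensor_vec (A - B) = (a - tensor_vec A) - (b - tensor_vec B) +
      (\<Sum>j<r. frag_of (f j, (A $$ (0, j) - B $$ (0, j)) + B $$ (0, j)) -
        frag_of (f j, A $$ (0, j) - B $$ (0, j)) - frag_of (f j, B $$ (0, j)))"
    using AB by (simp add: tensor_vec_def sum_subtractf)
  also have "\<dots> \<in> tensor_null act"
    using tensor_null_diff[OF ab]
    by (intro tensor_null_add tensor_null_sum tensor_null_gens) (simp add: A_def B_def)
  finally show "a - b - tensor_vec (tensor_coord (a - b)) \<in> tensor_null act"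
    by (simp add: tensor_coord_diff A_def B_def)
qed auto

text \<open>This identifies the tensor classes with the fibres of \<open>tensor_coord\<close>, so
  that a class may be replaced by its row.\<close>

lemma tensor_null_iff: "z \<in> tensor_null act \<longleftrightarrow> tensor_coord z = 0\<^sub>m 1 r"
proof
  assume "tensor_coord z = 0\<^sub>m 1 r"
  moreover have "tensor_vec (0\<^sub>m 1 r) \<in> tensor_null act"
    using tensor_null_diff[OF tensor_null_0 tensor_null_reduce[of 0]] by simp
  ultimately show "z \<in> tensor_null act"
    using tensor_null_add[OF tensor_null_reduce[of z]] by fastforce
qed (rule tensor_coord_null)

definition tensor_pt :: "'c fls mat \<Rightarrow> ('m \<times> 'c fls \<Rightarrow>\<^sub>0 int) set" where
  "tensor_pt Y = {w. tensor_coord w = Y}"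

lemma tensor_class_eq: "tensor_class act z = tensor_pt (tensor_coord z)"
proof -
  have "A - B = 0\<^sub>m 1 r \<longleftrightarrow> A = B" if "A \<in> carrier_mat 1 r" "B \<in> carrier_mat 1 r" for A B :: "'c fls mat"
    using that by (auto simp: mat_eq_iff)
  then show ?thesis
    by (auto simp: tensor_class_def tensor_pt_def tensor_null_iff tensor_coord_diff)
qed

lemma tensor_space_eq: "tensor_space act = tensor_pt ` carrier_mat 1 r"
proof (intro equalityI subsetI)
  fix A assume "A \<in> tensor_pt ` carrier_mat 1 r"
  then obtain Y where "A = tensor_pt Y" "Y \<in> carrier_mat 1 r" by blast
  then have "A = tensor_class act (tensor_vec Y)" by (simp add: tensor_class_eq tensor_coord_vec)
  then show "A \<in> tensor_space act" by (simp add: tensor_space_def)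
qed (auto simp: tensor_space_def tensor_class_eq)

lemma tensor_pt_inj: "inj_on tensor_pt (carrier_mat 1 r)"
proof (rule inj_onI)
  fix Y Z assume YZ: "Y \<in> carrier_mat 1 r" "Z \<in> carrier_mat 1 r" "tensor_pt Y = tensor_pt Z"
  have "tensor_vec Y \<in> tensor_pt Y" using YZ(1) by (simp add: tensor_pt_def tensor_coord_vec)
  then have "tensor_vec Y \<in> tensor_pt Z" by (simp only: YZ(3))
  then show "Y = Z" using YZ(1) by (simp add: tensor_pt_def tensor_coord_vec)
qed

lemma tensor_add_pt:
  assumes "Y \<in> carrier_mat 1 r" "Z \<in> carrier_mat 1 r"
  shows "tensor_add (tensor_pt Y) (tensor_pt Z) = tensor_pt (Y + Z)"
proof (intro equalityI subsetI)
  fix w assume w: "w \<in> tensor_pt (Y + Z)"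
  have "tensor_coord (w - tensor_vec Y) = Z"
    using w assms by (auto simp: tensor_coord_diff tensor_coord_vec tensor_pt_def mat_eq_iff)
  then have "tensor_vec Y \<in> tensor_pt Y" "w - tensor_vec Y \<in> tensor_pt Z"
    using assms by (auto simp: tensor_pt_def tensor_coord_vec)
  moreover have "w = tensor_vec Y + (w - tensor_vec Y)" by simp
  ultimately show "w \<in> tensor_add (tensor_pt Y) (tensor_pt Z)"
    unfolding tensor_add_def by blast
qed (auto simp: tensor_add_def tensor_pt_def tensor_coord_add)

text \<open>If \<open>h\<close> acts on coordinates through an additive \<open>g\<close>, every
  representative of the class of \<open>Y\<close> is sent into the class of \<open>g Y\<close>. All
  members of the union in \<open>tensor_map\<close> then coincide.\<close>

lemma tensor_map_pt:
  assumes Y: "Y \<in> carrier_mat 1 r"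
    and g0: "g (0\<^sub>m 1 r) = 0\<^sub>m 1 r"
    and g_diff: "\<And>A B. A \<in> carrier_mat 1 r \<Longrightarrow> B \<in> carrier_mat 1 r \<Longrightarrow> g (A - B) = g A - g B"
    and g_of: "\<And>e. tensor_coord (frag_of (h e)) = g (tensor_coord (frag_of e))"
  shows "tensor_map act h (tensor_pt Y) = tensor_pt (g Y)"
proof -
  have "tensor_coord (frag_extend (\<lambda>e. frag_of (h e)) z) = g (tensor_coord z)" for z
    by (rule frag_induction[of z UNIV])
      (auto simp: g0 g_of g_diff frag_extend_diff tensor_coord_diff)
  moreover have "tensor_vec Y \<in> tensor_pt Y" using Y by (simp add: tensor_pt_def tensor_coord_vec)
  ultimately show ?thesis
    unfolding tensor_map_def tensor_class_eq by (auto simp: tensor_pt_def)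
qed

lemma tensor_scale_pt:
  "Y \<in> carrier_mat 1 r \<Longrightarrow> tensor_scale act c (tensor_pt Y) = tensor_pt (c \<cdot>\<^sub>m Y)"
  unfolding tensor_scale_def
proof (rule tensor_map_pt)
  fix e :: "'m \<times> 'c fls"
  show "tensor_coord (frag_of (case e of (x, k) \<Rightarrow> (x, c * k))) = c \<cdot>\<^sub>m tensor_coord (frag_of e)"
    by (cases e) (auto simp: tensor_coord_of intro!: eq_matI)
qed (auto intro!: eq_matI simp: algebra_simps)

lemma frob_step_smult:
  "Y \<in> carrier_mat 1 r \<Longrightarrow> frob_step q Qh (k \<cdot>\<^sub>m Y) = frob_fls q k \<cdot>\<^sub>m frob_step q Qh Y"
proof -
  interpret s: comm_ring_hom "frob_fls q :: 'c fls \<Rightarrow> 'c fls" by (rule comm_ring_hom_frob_fls)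
  assume Y: "Y \<in> carrier_mat 1 r"
  have "map_mat (frob_fls q) (k \<cdot>\<^sub>m Y) = frob_fls q k \<cdot>\<^sub>m map_mat (frob_fls q) Y"
    by (rule eq_matI) (auto simp: s.hom_mult)
  then show ?thesis using Y by (simp add: frob_step_def mult_smult_assoc_mat[of _ 1 r _ r])
qed

lemma tensor_tau_pt:
  "Y \<in> carrier_mat 1 r \<Longrightarrow> tensor_tau q act (tensor_pt Y) = tensor_pt (frob_step q Qh Y)"
  unfolding tensor_tau_def
proof (rule tensor_map_pt)
  interpret s: comm_ring_hom "frob_fls q :: 'c fls \<Rightarrow> 'c fls" by (rule comm_ring_hom_frob_fls)
  show "frob_step q Qh (0\<^sub>m 1 r) = 0\<^sub>m 1 r"
  proof -
    have "map_mat (frob_fls q) (0\<^sub>m 1 r) = (0\<^sub>m 1 r :: 'c fls mat)" by (rule eq_matI) auto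
    then show ?thesis by (simp add: frob_step_def left_mult_zero_mat[of _ r r])
  qed
  show "frob_step q Qh (A - B) = frob_step q Qh A - frob_step q Qh B"
    if "A \<in> carrier_mat 1 r" "B \<in> carrier_mat 1 r" for A B
  proof -
    have "map_mat (frob_fls q) (A - B) = map_mat (frob_fls q) A - map_mat (frob_fls q) B"
      using that by (intro eq_matI) (auto simp: s.hom_minus)
    then show ?thesis
      using that by (simp add: frob_step_def minus_mult_distrib_mat[of _ 1 r _ _ r])
  qed
  fix e :: "'m \<times> 'c fls"
  show "tensor_coord (frag_of (case e of (x, k) \<Rightarrow> (tau x, frob_fls q k))) =
      frob_step q Qh (tensor_coord (frag_of e))"
    by (cases e) (simp add: tensor_coord_of frob_step_smult cv_tau)
qed

lemma frob_step_carrier: "Y \<in> carrier_mat 1 r \<Longrightarrow> (frob_step q Qh ^^ v) Y \<in> carrier_mat 1 r"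
  by (induction v) (auto simp: frob_step_def intro!: mult_carrier_mat[of _ 1 r])

lemma tensor_tau_pow_pt:
  "Y \<in> carrier_mat 1 r \<Longrightarrow> (tensor_tau q act ^^ v) (tensor_pt Y) = tensor_pt ((frob_step q Qh ^^ v) Y)"
  by (induction v) (auto simp: tensor_tau_pt frob_step_carrier)

lemma tensor_span_pt:
  assumes G: "G \<subseteq> carrier_mat 1 r"
  shows "tensor_span act S (tensor_pt ` G) = tensor_pt ` row_span r S G"
proof (intro equalityI subsetI)
  fix A assume "A \<in> tensor_span act S (tensor_pt ` G)"
  then show "A \<in> tensor_pt ` row_span r S G"
  proof induction
    case zero
    show ?case by (auto simp: tensor_class_eq intro: row_span.zero)
  next
    case (add c A B)
    then obtain Z Y where ZY: "A = tensor_pt Z" "Z \<in> G" "B = tensor_pt Y" "Y \<in> row_span r S G" by blast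
    have "Z \<in> carrier_mat 1 r" "Y \<in> carrier_mat 1 r"
      using ZY G row_span_carrier[OF G] by auto
    then have "tensor_add (tensor_scale act c A) B = tensor_pt (c \<cdot>\<^sub>m Z + Y)"
      using ZY by (simp add: tensor_scale_pt tensor_add_pt)
    then show ?case using ZY add by (auto intro: row_span.add)
  qed
next
  fix A assume "A \<in> tensor_pt ` row_span r S G"
  then obtain Y where A: "A = tensor_pt Y" and "Y \<in> row_span r S G" by blast
  from this(2) show "A \<in> tensor_span act S (tensor_pt ` G)"
    unfolding A
  proof induction
    case zero
    show ?case using tensor_span.zero[of act S "tensor_pt ` G"] by (simp add: tensor_class_eq)
  next
    case (add c Z Y)
    have "Z \<in> carrier_mat 1 r" "Y \<in> carrier_mat 1 r"
      using add G row_span_carrier[OF G] by auto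
    then have "tensor_add (tensor_scale act c (tensor_pt Z)) (tensor_pt Y) = tensor_pt (c \<cdot>\<^sub>m Z + Y)"
      by (simp add: tensor_scale_pt tensor_add_pt)
    then show ?case using tensor_span.add[OF add(1) imageI[OF add(2)] add.IH] by simp
  qed
qed

lemma pure_data_pt_iff:
  assumes G: "G \<subseteq> carrier_mat 1 r"
  defines "W \<equiv> row_span r (range fps_to_fls) G"
  shows "tensor_span act UNIV (tensor_pt ` W) = tensor_space act \<longleftrightarrow> row_span r UNIV W = carrier_mat 1 r"
    and "tensor_span act (range fps_to_fls) ((tensor_tau q act ^^ v) ` tensor_pt ` W) =
        tensor_scale act (fls_X_inv ^ u) ` tensor_pt ` W \<longleftrightarrow>
      row_span r (range fps_to_fls) ((frob_step q Qh ^^ v) ` W) = (\<lambda>Y. fls_X_inv ^ u \<cdot>\<^sub>m Y) ` W"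
proof -
  have W: "W \<subseteq> carrier_mat 1 r" unfolding W_def by (rule row_span_carrier[OF G])
  show "tensor_span act UNIV (tensor_pt ` W) = tensor_space act \<longleftrightarrow> row_span r UNIV W = carrier_mat 1 r"
    unfolding tensor_span_pt[OF W] tensor_space_eq
    by (rule inj_on_image_eq_iff[OF tensor_pt_inj row_span_carrier[OF W] order_refl])
  have "(tensor_tau q act ^^ v) ` tensor_pt ` W = tensor_pt ` (frob_step q Qh ^^ v) ` W"
    unfolding image_image using W by (intro image_cong) (auto simp: tensor_tau_pow_pt)
  moreover have "tensor_scale act (fls_X_inv ^ u) ` tensor_pt ` W =
      tensor_pt ` (\<lambda>Y. fls_X_inv ^ u \<cdot>\<^sub>m Y) ` W"
    unfolding image_image using W by (intro image_cong) (auto simp: tensor_scale_pt)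
  moreover have W': "(frob_step q Qh ^^ v) ` W \<subseteq> carrier_mat 1 r"
    using W frob_step_carrier by blast
  moreover have "(\<lambda>Y. fls_X_inv ^ u \<cdot>\<^sub>m Y) ` W \<subseteq> carrier_mat 1 r"
    using W by auto
  ultimately show "tensor_span act (range fps_to_fls) ((tensor_tau q act ^^ v) ` tensor_pt ` W) =
        tensor_scale act (fls_X_inv ^ u) ` tensor_pt ` W \<longleftrightarrow>
      row_span r (range fps_to_fls) ((frob_step q Qh ^^ v) ` W) = (\<lambda>Y. fls_X_inv ^ u \<cdot>\<^sub>m Y) ` W"
    by (simp add: tensor_span_pt inj_on_image_eq_iff[OF tensor_pt_inj row_span_carrier])
qed

lemma pure_motive_iff_pure_rows: "pure_motive q act \<longleftrightarrow> pure_rows q r Qh"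
proof
  assume "pure_motive q act"
  then obtain W G u v where G: "finite G" "G \<subseteq> tensor_space act"
    and W: "W = tensor_span act (range fps_to_fls) G"
    and *: "tensor_span act UNIV W = tensor_space act" "u > 0" "v > 0"
      "tensor_span act (range fps_to_fls) ((tensor_tau q act ^^ v) ` W) =
        tensor_scale act (fls_X_inv ^ u) ` W"
    unfolding pure_motive_def by (elim exE conjE) (rule that)
  obtain G' where G': "G' \<subseteq> carrier_mat 1 r" "finite G'" "G = tensor_pt ` G'"
    using finite_subset_image[OF G(1) G(2)[unfolded tensor_space_eq]] by (elim exE conjE) (rule that)
  have W': "W = tensor_pt ` row_span r (range fps_to_fls) G'"
    unfolding W G'(3) by (rule tensor_span_pt[OF G'(1)])
  show "pure_rows q r Qh"
    unfolding pure_rows_def using G' * unfolding W' pure_data_pt_iff[OF G'(1)]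
    by (intro exI[of _ "row_span r (range fps_to_fls) G'"] exI[of _ G'] exI[of _ u] exI[of _ v] conjI refl)
next
  assume "pure_rows q r Qh"
  then obtain W G u v where G: "finite G" "G \<subseteq> carrier_mat 1 r"
    and W: "W = row_span r (range fps_to_fls) G"
    and *: "row_span r UNIV W = carrier_mat 1 r" "u > 0" "v > 0"
      "row_span r (range fps_to_fls) ((frob_step q Qh ^^ v) ` W) = (\<lambda>Y. fls_X_inv ^ u \<cdot>\<^sub>m Y) ` W"
    unfolding pure_rows_def by (elim exE conjE) (rule that)
  show "pure_motive q act"
    unfolding pure_motive_def
  proof (intro exI conjI)
    show "finite (tensor_pt ` G)" using G by simp
    show "tensor_pt ` G \<subseteq> tensor_space act" using G by (auto simp: tensor_space_eq)
    show "tensor_pt ` W = tensor_span act (range fps_to_fls) (tensor_pt ` G)"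
      unfolding W by (rule tensor_span_pt[OF G(2), symmetric])
    show "tensor_span act UNIV (tensor_pt ` W) = tensor_space act"
      using *(1) unfolding W pure_data_pt_iff(1)[OF G(2)] .
    show "tensor_span act (range fps_to_fls) ((tensor_tau q act ^^ v) ` tensor_pt ` W) =
        tensor_scale act (fls_X_inv ^ u) ` tensor_pt ` W"
      using *(4) unfolding W pure_data_pt_iff(2)[OF G(2)] .
  qed fact+
qed

lemma pure_motive_iff: "pure_motive q act \<longleftrightarrow> (\<exists>u>0. \<exists>v>0. pure_matrix q r Qh u v)"
  unfolding pure_motive_iff_pure_rows
  by (rule iffI, rule pure_matrix_if_pure_rows[OF Qh_carrier], assumption)
    (elim exE conjE, rule pure_rows_if_pure_matrix[OF Qh_carrier])

end


section \<open>The filtration of a pure motive\<close>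

lemma poly_to_fls_inv_const: "poly_to_fls_inv [:a:] = fls_const a"
  by (simp add: poly_to_fls_inv_pCons)

lemma poly_to_fls_inv_monom: "poly_to_fls_inv (Polynomial.monom 1 j) = fls_X_inv ^ j"
  by (induction j) (auto simp: monom_0 monom_Suc poly_to_fls_inv_pCons)

context frob_space
begin

lemma tau_sum: "tau (\<Sum>i\<in>I. x i) = (\<Sum>i\<in>I. tau (x i))"
  by (induction I rule: infinite_finite_induct) (auto simp: tau_add)

text \<open>After the constant term is split off, one factor \<tau> has to be moved to the left of
  the remaining coefficients. That replaces them by their \<open>q\<close>-th roots.\<close>

lemma pact_mod_tau: "\<exists>y. pact p x = scale (Polynomial.coeff p 0) x + tau y"
proof (cases p)
  case (pCons a p1)
  obtain p' where "frob_poly q p' = p1" using frob_poly_surj by blast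
  then have "pact p1 (tau x) = tau (pact p' x)"
    by (auto simp: tau_pact frob_poly_def)
  then show ?thesis by (auto simp: pCons pact_pCons)
qed

lemma tau_comb_mod_tau: "\<exists>y. tau_comb n g c = (\<Sum>i<n. scale (Polynomial.coeff (c i) 0) (g i)) + tau y"
proof -
  have "\<forall>i. \<exists>y. pact (c i) (g i) = scale (Polynomial.coeff (c i) 0) (g i) + tau y"
    using pact_mod_tau by blast
  then obtain y where "\<And>i. pact (c i) (g i) = scale (Polynomial.coeff (c i) 0) (g i) + tau (y i)"
    by metis
  then have "tau_comb n g c = (\<Sum>i<n. scale (Polynomial.coeff (c i) 0) (g i)) + tau (\<Sum>i<n. y i)"
    by (simp add: tau_comb_def sum.distrib tau_sum)
  then show ?thesis by blast
qed

end

context skew_mod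
begin

lemma pm_eq_sum_monom:
  assumes "\<And>i. i \<ge> N \<Longrightarrow> Polynomial.coeff p i = 0"
  shows "pm p x = (\<Sum>i<N. scale (Polynomial.coeff p i) (pm (Polynomial.monom 1 i) x))"
proof -
  have "p = (\<Sum>i<N. [:Polynomial.coeff p i:] * Polynomial.monom 1 i)"
    using assms by (intro poly_eqI) (auto simp: coeff_sum if_distrib[of "\<lambda>a. _ * a"] cong: if_cong)
  then have "pm p x = pm (\<Sum>i<N. [:Polynomial.coeff p i:] * Polynomial.monom 1 i) x" by simp
  then show ?thesis by (simp only: pm_sum pm_mult)
qed

lemma frob_poly_monom_1: "frob_poly q (Polynomial.monom 1 j :: 'c poly) = Polynomial.monom 1 j"
  by (rule poly_eqI) simp

lemma tau_pow_pm_monom: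
  "(tau ^^ i) (pm (Polynomial.monom 1 j) x) = pm (Polynomial.monom 1 j) ((tau ^^ i) x)"
  by (induction i) (auto simp: tau_pm frob_poly_monom_1)

end

context motive_basis
begin

lemma cv_add: "cv (x + y) = cv x + cv y"
  by (rule eq_matI) (auto simp: cv_def co_add pfi.hom_add)

lemma cv_pm: "cv (pm p x) = poly_to_fls_inv p \<cdot>\<^sub>m cv x"
  by (rule eq_matI) (auto simp: cv_def co_pm pfi.hom_mult)

lemma cv_0: "cv 0 = 0\<^sub>m 1 r"
  by (rule eq_matI) (auto simp: cv_def)

end

locale pure_motive_basis = motive_basis q act r f Q
  for q :: nat and act :: "'c::field poly poly \<Rightarrow> 'm::ab_group_add \<Rightarrow> 'm"
    and r :: nat and f :: "nat \<Rightarrow> 'm" and Q :: "'c poly mat" +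
  fixes u v :: nat and P Pi U Ui :: "'c fls mat"
  assumes u_pos: "u > 0" and v_pos: "v > 0"
    and P [simp]: "P \<in> carrier_mat r r" and Pi [simp]: "Pi \<in> carrier_mat r r"
    and P_Pi: "P * Pi = 1\<^sub>m r" and Pi_P: "Pi * P = 1\<^sub>m r"
    and U [simp]: "U \<in> carrier_mat r r" and Ui [simp]: "Ui \<in> carrier_mat r r"
    and U_Ui: "U * Ui = 1\<^sub>m r"
    and U_le: "fls_mat_le 0 U" and Ui_le: "fls_mat_le 0 Ui"
    and eq: "map_mat (frob_fls (q ^ v)) P * frob_pow q Qh v = fls_X_inv ^ u \<cdot>\<^sub>m (U * P)"
begin

text \<open>The elements of M lying in \<open>T^k W\<close>, where the rows of \<open>P\<close> form
  a basis of the lattice \<open>W\<close>: the product with \<open>Pi\<close> converts to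
  coordinates in that basis.\<close>

definition F :: "int \<Rightarrow> 'm set" where
  "F k = {x. fls_mat_le k (cv x * Pi)}"

lemma F_mono: "k \<le> l \<Longrightarrow> F k \<subseteq> F l"
  by (auto simp: F_def intro: fls_mat_le_mono)

lemma F_subspace: "subspace (F k)"
proof (rule subspaceI)
  show "0 \<in> F k" by (simp add: F_def cv_0 left_mult_zero_mat[of _ r r])
  show "x + y \<in> F k" if "x \<in> F k" "y \<in> F k" for x y
    using that fls_mat_le_add[of k "cv x * Pi" "cv y * Pi" 1 r]
    by (simp add: F_def cv_add add_mult_distrib_mat[of _ 1 r _ _ r] mult_carrier_mat[of _ 1 r _ r])
  show "scale a x \<in> F k" if "x \<in> F k" for a x
    using that fls_mat_le_smult[of 0 "fls_const a" k "cv x * Pi"]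
    by (simp add: F_def cv_pm poly_to_fls_inv_const mult_smult_assoc_mat[of _ 1 r _ r] fls_deg_le_def)
qed

lemma F_exhaust: "\<exists>k::nat. x \<in> F (int k)"
  using fls_mat_le_ex by (auto simp: F_def)

lemma F_pm_monom: "x \<in> F k \<Longrightarrow> pm (Polynomial.monom 1 j) x \<in> F (k + int j)"
  by (simp add: F_def cv_pm poly_to_fls_inv_monom mult_smult_assoc_mat[of _ 1 r _ r]
      fls_mat_le_X_inv_power_smult)

text \<open>In lattice coordinates \<open>\<tau>^v\<close> is the twist followed by multiplication
  with \<open>T^u U\<close>. The twist preserves degrees, and so does \<open>U\<close>, because both
  \<open>U\<close> and its inverse are integral; only \<open>T^u\<close> shifts them.\<close>

lemma F_tau_pow_v: "(tau ^^ v) x \<in> F (k + int u) \<longleftrightarrow> x \<in> F k"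
proof -
  interpret v: frobenius_field "TYPE('c)" "q ^ v" by (rule frobenius_field_power)
  let ?s = "map_mat (frob_fls (q ^ v)) :: 'c fls mat \<Rightarrow> _"
  define A where "A = cv x * Pi"
  have A: "A \<in> carrier_mat 1 r" by (simp add: A_def mult_carrier_mat[of _ 1 r _ r])
  have Qv: "frob_pow q Qh v \<in> carrier_mat r r" by simp
  have "frob_pow q Qh v = ?s (Pi * P) * frob_pow q Qh v"
    using Qv by (simp add: Pi_P left_mult_one_mat[of _ r r])
  also have "\<dots> = ?s Pi * (?s P * frob_pow q Qh v)"
    using Qv by (subst v.map_mat_frob_mult[of _ r r _ r]) (auto intro!: assoc_mult_mat[of _ r r _ r _ r])
  also have "\<dots> = fls_X_inv ^ u \<cdot>\<^sub>m (?s Pi * (U * P))"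
    unfolding eq by (rule mult_smult_distrib[of _ r r _ r]) (auto intro!: mult_carrier_mat[of _ r r])
  finally have "frob_pow q Qh v * Pi = fls_X_inv ^ u \<cdot>\<^sub>m (?s Pi * (U * P)) * Pi" by simp
  also have "\<dots> = fls_X_inv ^ u \<cdot>\<^sub>m (?s Pi * (U * P) * Pi)"
    by (rule mult_smult_assoc_mat[of _ r r _ r]) (auto intro!: mult_carrier_mat[of _ r r])
  also have "?s Pi * (U * P) * Pi = ?s Pi * U * (P * Pi)"
    by (simp add: assoc_mult_mat[of _ r r _ r _ r] mult_carrier_mat[of _ r r _ r])
  also have "\<dots> = ?s Pi * U"
    unfolding P_Pi by (rule right_mult_one_mat[of _ r]) (simp add: mult_carrier_mat[of _ r r _ r])
  finally have Qv_Pi: "frob_pow q Qh v * Pi = fls_X_inv ^ u \<cdot>\<^sub>m (?s Pi * U)" .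
  have "cv ((tau ^^ v) x) * Pi = ?s (cv x) * (frob_pow q Qh v * Pi)"
    unfolding cv_tau_pow frob_step_iterate[OF Qh_carrier cv_carrier]
    by (rule assoc_mult_mat[of _ 1 r _ r _ r]) auto
  also have "\<dots> = fls_X_inv ^ u \<cdot>\<^sub>m (?s (cv x) * (?s Pi * U))"
    unfolding Qv_Pi by (rule mult_smult_distrib[of _ 1 r _ r]) (auto intro!: mult_carrier_mat[of _ r r])
  also have "?s (cv x) * (?s Pi * U) = ?s A * U"
    unfolding A_def v.map_mat_frob_mult[OF cv_carrier Pi]
    by (rule assoc_mult_mat[of _ 1 r _ r _ r, symmetric]) auto
  finally have "(tau ^^ v) x \<in> F (k + int u) \<longleftrightarrow> fls_mat_le k (?s A * U)"
    by (simp add: F_def fls_mat_le_X_inv_power_smult)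
  also have "\<dots> \<longleftrightarrow> fls_mat_le k (?s A)"
  proof
    assume "fls_mat_le k (?s A * U)"
    then have "fls_mat_le (k + 0) (?s A * U * Ui)"
      using A by (intro fls_mat_le_mult[OF _ Ui_le, of _ _ 1 r r]) (auto intro!: mult_carrier_mat[of _ 1 r])
    then show "fls_mat_le k (?s A)"
      using A by (simp add: assoc_mult_mat[of _ 1 r _ r _ r] U_Ui)
  next
    assume "fls_mat_le k (?s A)"
    then have "fls_mat_le (k + 0) (?s A * U)"
      using A by (intro fls_mat_le_mult[OF _ U_le, of _ _ 1 r r]) auto
    then show "fls_mat_le k (?s A * U)" by simp
  qed
  finally show ?thesis by (simp add: F_def A_def)
qed

text \<open>If \<open>P\<close> has degree at most \<open>d\<close>, elements of \<open>F k\<close>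
  have coordinates of degree at most \<open>k + d\<close> in the basis \<open>f\<close>. They are
  combinations of the elements \<open>T^i f_j\<close> with \<open>i \<le> k + d\<close>.\<close>

lemma F_growth:
  obtains d :: nat where
    "\<And>k. \<exists>T. finite T \<and> F k \<subseteq> span T \<and> int (card T) \<le> int r * max 0 (k + int d)"
proof -
  obtain d :: nat where d: "fls_mat_le (int d) P" using fls_mat_le_ex by blast
  have "\<exists>T. finite T \<and> F k \<subseteq> span T \<and> int (card T) \<le> int r * max 0 (k + int (Suc d))" for k
  proof -
    define N where "N = nat (k + int (Suc d))"
    define T where "T = (\<lambda>(j, i). pm (Polynomial.monom 1 i) (f j)) ` ({..<r} \<times> {..<N})"
    have "x \<in> span T" if x: "x \<in> F k" for x
    proof -
      have "cv x * Pi * P = cv x"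
        using cv_carrier[of x]
        by (simp add: assoc_mult_mat[of _ 1 r _ r _ r] Pi_P right_mult_one_mat[of _ 1 r])
      then have le: "fls_mat_le (k + int d) (cv x)"
        using fls_mat_le_mult[OF _ d, of k "cv x * Pi" 1 r r] x
        by (simp add: F_def mult_carrier_mat[of _ 1 r _ r])
      have zero: "Polynomial.coeff (co x j) i = 0" if "j < r" "i \<ge> N" for i j
      proof (rule coeff_eq_0_if_fls_deg_le)
        show "fls_deg_le (k + int d) (poly_to_fls_inv (co x j))"
          using le that by (auto simp: fls_mat_le_def cv_def)
        show "int i > k + int d" using that by (simp add: N_def)
      qed
      have "x = (\<Sum>j<r. \<Sum>i<N. scale (Polynomial.coeff (co x j) i) (pm (Polynomial.monom 1 i) (f j)))"
        by (subst co[of x], rule sum.cong[OF refl], rule pm_eq_sum_monom) (simp add: zero)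
      also have "\<dots> \<in> span T"
        by (intro span_sum span_scale span_base) (auto simp: T_def)
      finally show ?thesis .
    qed
    moreover have "int (card T) \<le> int r * max 0 (k + int (Suc d))"
    proof -
      have "card T \<le> r * N"
        unfolding T_def by (rule order.trans[OF card_image_le]) auto
      then have "int (card T) \<le> int r * int N" by (simp flip: of_nat_mult)
      then show ?thesis by (simp add: N_def max_def)
    qed
    ultimately show ?thesis by (intro exI[of _ T]) (auto simp: T_def)
  qed
  then show thesis by (rule that)
qed

text \<open>Rescaling \<open>F\<close> by \<open>v\<close> and averaging over \<open>\<tau>\<^sup>i\<close> for \<open>i < v\<close> makes \<open>\<tau>\<close> itself shift levels, by \<open>u\<close>.\<close>

definition F' :: "int \<Rightarrow> 'm set" where
  "F' k = {x. \<forall>i<v. (tau ^^ i) x \<in> F ((k + int i * int u) div int v)}"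

lemma F'_exhaust: "\<exists>k. x \<in> F' k"
proof -
  have "\<forall>i. \<exists>k::nat. (tau ^^ i) x \<in> F (int k)" using F_exhaust by blast
  then obtain k :: "nat \<Rightarrow> nat" where k: "\<And>i. (tau ^^ i) x \<in> F (int (k i))" by metis
  define K where "K = (\<Sum>i<v. k i)"
  have "(tau ^^ i) x \<in> F ((int v * int K + int i * int u) div int v)" if "i < v" for i
  proof -
    have "k i \<le> K" unfolding K_def using that by (intro member_le_sum) auto
    then have "int (k i) \<le> int K" by simp
    also have "int K = (int v * int K) div int v" using v_pos by simp
    also have "\<dots> \<le> (int v * int K + int i * int u) div int v"
      using v_pos by (intro zdiv_mono1) auto
    finally show ?thesis by (rule subsetD[OF F_mono k])
  qed
  then have "x \<in> F' (int v * int K)" unfolding F'_def by blast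
  then show ?thesis ..
qed

lemma F'_mono: "k \<le> l \<Longrightarrow> F' k \<subseteq> F' l"
proof
  fix x assume "k \<le> l" and x: "x \<in> F' k"
  have "(tau ^^ i) x \<in> F ((l + int i * int u) div int v)" if "i < v" for i
  proof (rule subsetD[OF F_mono])
    show "(k + int i * int u) div int v \<le> (l + int i * int u) div int v"
      using \<open>k \<le> l\<close> v_pos by (intro zdiv_mono1) auto
    show "(tau ^^ i) x \<in> F ((k + int i * int u) div int v)" using x that by (simp add: F'_def)
  qed
  then show "x \<in> F' l" by (simp add: F'_def)
qed

lemma F'_subspace: "subspace (F' k)"
  using subspace_0[OF F_subspace] subspace_add[OF F_subspace] subspace_scale[OF F_subspace]
  by (intro subspaceI) (auto simp: F'_def tau_pow_add tau_pow_scale)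

text \<open>Passing from \<open>x\<close> to \<tau>\<open>x\<close> moves the window of conditions
  from \<open>0, ..., v - 1\<close> to \<open>1, ..., v\<close>. The conditions at its two ends are
  equivalent by \<open>F_tau_pow_v\<close>, because adding \<open>v * u\<close> before dividing by
  \<open>v\<close> adds \<open>u\<close>.\<close>

lemma F'_tau: "tau x \<in> F' (k + int u) \<longleftrightarrow> x \<in> F' k"
proof -
  define p where "p i \<longleftrightarrow> (tau ^^ i) x \<in> F ((k + int i * int u) div int v)" for i
  have "p v \<longleftrightarrow> p 0"
  proof -
    have "(k + int v * int u) div int v = k div int v + int u" using v_pos by simp
    then show ?thesis by (simp add: p_def F_tau_pow_v)
  qed
  have "tau x \<in> F' (k + int u) \<longleftrightarrow> (\<forall>i<v. p (Suc i))"
    unfolding F'_def p_def by (simp add: funpow_swap1 algebra_simps)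
  also have "\<dots> \<longleftrightarrow> (\<forall>i<v. p i)"
  proof safe
    fix i assume *: "\<forall>i<v. p (Suc i)" "i < v"
    show "p i"
    proof (cases i)
      case 0
      then show ?thesis using *(1)[rule_format, of "v - 1"] v_pos \<open>p v \<longleftrightarrow> p 0\<close> by simp
    qed (use * in auto)
  next
    fix i assume *: "\<forall>i<v. p i" "i < v"
    then show "p (Suc i)" using \<open>p v \<longleftrightarrow> p 0\<close> v_pos by (cases "Suc i = v") auto
  qed
  also have "\<dots> \<longleftrightarrow> x \<in> F' k" by (simp add: F'_def p_def)
  finally show ?thesis .
qed

lemma F'_pm_monom: "x \<in> F' k \<Longrightarrow> pm (Polynomial.monom 1 j) x \<in> F' (int v * int j + k)"
proof -
  assume x: "x \<in> F' k"
  have "(int v * int j + k + int i * int u) div int v = (k + int i * int u) div int v + int j" for i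
    using v_pos by (simp add: add.assoc)
  then show ?thesis
    using x F_pm_monom by (simp add: F'_def tau_pow_pm_monom)
qed

text \<open>The condition for \<open>i = 0\<close> places \<open>F' k\<close> inside
  \<open>F (k div v)\<close>. The resulting bound drops a factor \<open>1/v\<close>; it serves to
  make low levels vanish and reduced families finite, whereas the exact slopes come from
  \<open>reduced_basis_growth\<close>.\<close>

lemma filtered: "\<exists>D. filtered_frob_space q scale tau F' u (int r) D"
proof -
  obtain d where d: "\<And>k. \<exists>T. finite T \<and> F k \<subseteq> span T \<and> int (card T) \<le> int r * max 0 (k + int d)"
    using F_growth by blast
  have "filtered_frob_space q scale tau F' u (int r) (int v * int d)"
  proof
    fix k
    obtain T where T: "finite T" "F (k div int v) \<subseteq> span T"
        "int (card T) \<le> int r * max 0 (k div int v + int d)"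
      using d by blast
    have "F' k \<subseteq> F (k div int v)" using v_pos by (auto simp: F'_def dest: spec[of _ 0])
    moreover have "max 0 (k div int v + int d) \<le> max 0 (k + int v * int d)"
    proof (cases "k div int v + int d \<ge> 0")
      case True
      have "k div int v + int d \<le> int v * (k div int v + int d)"
        using True v_pos by (simp add: mult_le_cancel_right1)
      also have "\<dots> \<le> k + int v * int d"
      proof -
        have "k mod int v \<ge> 0" using v_pos by simp
        then have "int v * (k div int v) \<le> k" using mult_div_mod_eq[of "int v" k] by linarith
        then show ?thesis by (simp add: distrib_left)
      qed
      finally show ?thesis by simp
    qed simp
    ultimately show "\<exists>T. finite T \<and> F' k \<subseteq> span T \<and> int (card T) \<le> int r * max 0 (k + int v * int d)"
      using T by (meson mult_left_mono of_nat_0_le_iff order.trans)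
  qed (use u_pos F'_subspace F'_mono F'_exhaust F'_tau in auto)
  then show ?thesis by blast
qed

theorem tau_basis_exists: "\<exists>n g. is_basis act sk_ring_tau n g"
proof -
  obtain D where "filtered_frob_space q scale tau F' u (int r) D" using filtered by blast
  then interpret filtered_frob_space q scale tau F' u "int r" D .
  obtain n b \<kappa> where red: "reduced n b \<kappa>" and full: "range (tau_comb n b) = UNIV"
    by (rule reduced_basis_exists)
  have "is_basis act sk_ring_tau n b"
    using full reduced_independent[OF red] by (rule basis_tauI)
  then show ?thesis by (intro exI)
qed

text \<open>Multiplication by \<open>T\<close> raises levels by \<open>v\<close>, so the independent
  elements \<open>T^j f0_i\<close> give slope \<open>r0 / v\<close>, while the generators over
  \<open>\<complex>\<^sub>\<infinity>[\<tau>]\<close> allow at most \<open>n0 / u\<close>. The basis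
  \<open>f0\<close> is independent of the basis \<open>f\<close> in which purity is
  expressed.\<close>

theorem weight_le:
  assumes f0: "is_basis act sk_ring_T r0 f0" and g: "is_basis act sk_ring_tau n0 g"
  shows "r0 * u \<le> n0 * v"
proof -
  obtain D where "filtered_frob_space q scale tau F' u (int r) D" using filtered by blast
  then interpret filtered_frob_space q scale tau F' u "int r" D .
  have "\<forall>i. \<exists>k. f0 i \<in> F' k" by (intro allI F'_exhaust)
  from choice[OF this] obtain k where k: "\<And>i. f0 i \<in> F' (k i)" by blast
  define c where "c = Max (insert 0 (k ` {..<r0}))"
  have c: "f0 i \<in> F' c" if "i < r0" for i
  proof -
    have "k i \<le> c" unfolding c_def using that by (intro Max_ge) auto
    then show ?thesis by (rule subsetD[OF F'_mono k])
  qed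
  show ?thesis
  proof (rule filtered_rank_le)
    show "\<exists>a y. x = (\<Sum>i<n0. scale (a i) (g i)) + tau y" for x
    proof -
      obtain c where "x = tau_comb n0 g c" using basis_tau_span[OF g] by blast
      moreover obtain y where
        "tau_comb n0 g c = (\<Sum>i<n0. scale (Polynomial.coeff (c i) 0) (g i)) + tau y"
        using tau_comb_mod_tau[of n0 g c] by blast
      ultimately show ?thesis
        by (intro exI[of _ "\<lambda>i. Polynomial.coeff (c i) 0"] exI[of _ y]) simp
    qed
    show "pm (Polynomial.monom 1 j) (f0 i) \<in> F' (int v * int j + c)" if "i < r0" for i j
      by (rule F'_pm_monom[OF c[OF that]])
    fix J :: nat and a :: "nat \<times> nat \<Rightarrow> 'c"
    assume *: "(\<Sum>(i, j)\<in>{..<r0} \<times> {..<J}. scale (a (i, j)) (pm (Polynomial.monom 1 j) (f0 i))) = 0"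
    define p where "p i = (\<Sum>j<J. [:a (i, j):] * Polynomial.monom 1 j)" for i
    have "(\<Sum>i<r0. pm (p i) (f0 i)) = 0"
      using * by (simp only: p_def pm_sum pm_mult sum.cartesian_product)
    then have p: "p i = 0" if "i < r0" for i using that by (rule basis_T_indep[OF f0])
    have "a (i, j) = Polynomial.coeff (p i) j" if "j < J" for i j
      using that by (simp add: p_def coeff_sum if_distrib[of "\<lambda>a. _ * a"] cong: if_cong)
    then show "\<forall>i<r0. \<forall>j<J. a (i, j) = 0" by (simp add: p)
  qed
qed

end

lemma (in motive_basis) pure_matrix_basis:
  assumes "pure_matrix q r Qh u v" "u > 0" "v > 0"
  shows "\<exists>P Pi U Ui. pure_motive_basis q act r f Q u v P Pi U Ui"
proof -
  obtain P Pi U Ui where *: "P \<in> carrier_mat r r" "Pi \<in> carrier_mat r r" "P * Pi = 1\<^sub>m r" "Pi * P = 1\<^sub>m r"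
      "U \<in> carrier_mat r r" "Ui \<in> carrier_mat r r" "U * Ui = 1\<^sub>m r" "Ui * U = 1\<^sub>m r"
      "fls_mat_le 0 U" "fls_mat_le 0 Ui"
      "map_mat (frob_fls (q ^ v)) P * frob_pow q Qh v = fls_X_inv ^ u \<cdot>\<^sub>m (U * P)"
    using assms(1) unfolding pure_matrix_def by (elim exE conjE) (rule that)
  have "pure_motive_basis q act r f Q u v P Pi U Ui"
    by unfold_locales (fact assms *)+
  then show ?thesis by (intro exI)
qed


section \<open>The dual motive\<close>

lemma transpose_smult: "transpose_mat (c \<cdot>\<^sub>m A) = c \<cdot>\<^sub>m transpose_mat A"
  by (rule eq_matI) auto

lemma smult_smult_mat: "a \<cdot>\<^sub>m (b \<cdot>\<^sub>m A) = (a * b :: 'a::semigroup_mult) \<cdot>\<^sub>m A"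
  by (rule eq_matI) (auto simp: mult.assoc)

section \<open>Inverse transposes and the purity equation\<close>

context frobenius_field
begin

text \<open>In the product for \<open>v + 1\<close> the inner factor \<open>Q' Q^t\<close> is the
  scalar \<open>c\<close>, and what remains is the twist of the product for \<open>v\<close>. So
  \<open>d\<close> is the product of the twists of \<open>c\<close>, each of degree
  \<open>m\<close>.\<close>

lemma frob_pow_dual:
  assumes Q: "(Q :: 'c fls mat) \<in> carrier_mat r r" and Q': "Q' \<in> carrier_mat r r"
    and dual: "Q' * transpose_mat Q = c \<cdot>\<^sub>m 1\<^sub>m r" and c: "c \<noteq> 0" "fls_subdegree c = - int m"
  shows "\<exists>d. d \<noteq> 0 \<and> fls_subdegree d = - int (m * v) \<and>
    frob_pow q Q' v * transpose_mat (frob_pow q Q v) = d \<cdot>\<^sub>m 1\<^sub>m r"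
proof (induction v)
  case 0
  show ?case using Q Q' by (intro exI[of _ 1]) (auto intro!: eq_matI)
next
  case (Suc v)
  interpret s: comm_ring_hom "frob_fls q :: 'c fls \<Rightarrow> 'c fls" by (rule comm_ring_hom_frob_fls)
  let ?s = "map_mat (frob_fls q) :: 'c fls mat \<Rightarrow> _"
  let ?A = "frob_pow q Q v" and ?B = "frob_pow q Q' v"
  obtain d where d: "d \<noteq> 0" "fls_subdegree d = - int (m * v)" "?B * transpose_mat ?A = d \<cdot>\<^sub>m 1\<^sub>m r"
    using Suc by blast
  have A: "?A \<in> carrier_mat r r" and B: "?B \<in> carrier_mat r r" using Q Q' by auto
  have sA: "transpose_mat (?s ?A) \<in> carrier_mat r r" and sB: "?s ?B \<in> carrier_mat r r" using A B by auto
  have Qt: "transpose_mat Q \<in> carrier_mat r r" using Q by simp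
  have "?s ?B * Q' * transpose_mat (?s ?A * Q) = ?s ?B * Q' * (transpose_mat Q * transpose_mat (?s ?A))"
    using A Q by (subst transpose_mult[of _ r r _ r]) auto
  also have "\<dots> = ?s ?B * (Q' * transpose_mat Q * transpose_mat (?s ?A))"
    using sA sB Q' Qt by (simp add: assoc_mult_mat[of _ r r _ r _ r] mult_carrier_mat[of _ r r _ r])
  also have "\<dots> = ?s ?B * (c \<cdot>\<^sub>m transpose_mat (?s ?A))"
    unfolding dual using sA by (simp add: mult_smult_assoc_mat[of _ r r _ r] left_mult_one_mat[of _ r r])
  also have "\<dots> = c \<cdot>\<^sub>m (?s ?B * transpose_mat (?s ?A))"
    by (rule mult_smult_distrib[OF sB sA])
  also have "?s ?B * transpose_mat (?s ?A) = ?s (?B * transpose_mat ?A)"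
    using A B by (simp add: map_mat_frob_mult[of _ r r _ r] map_mat_transpose)
  also have "\<dots> = frob_fls q d \<cdot>\<^sub>m 1\<^sub>m r"
    unfolding d(3) by (rule eq_matI) (auto simp: s.hom_mult)
  finally have "?s ?B * Q' * transpose_mat (?s ?A * Q) = (c * frob_fls q d) \<cdot>\<^sub>m 1\<^sub>m r"
    by (simp add: smult_smult_mat)
  moreover have "fls_subdegree (c * frob_fls q d) = - int (m * Suc v)"
    using c d by (simp add: algebra_simps)
  ultimately show ?case
    using c d by (intro exI[of _ "c * frob_fls q d"]) (auto simp: frob_step_def)
qed

text \<open>The dual lattice has basis \<open>Pi^t\<close>. Transposing and inverting the given
  equation turns \<open>T^u U\<close> into \<open>T^-u Ui^t\<close>, and the scalar \<open>d\<close>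
  of degree \<open>m * v\<close> from \<open>frob_pow_dual\<close> raises the exponent to
  \<open>m * v - u\<close>.\<close>

lemma pure_matrix_dual:
  assumes Q: "(Q :: 'c fls mat) \<in> carrier_mat r r" and Q': "Q' \<in> carrier_mat r r"
    and dual: "Q' * transpose_mat Q = c \<cdot>\<^sub>m 1\<^sub>m r" and c: "c \<noteq> 0" "fls_subdegree c = - int m"
    and "pure_matrix q r Q u v" and less: "u < m * v"
  shows "pure_matrix q r Q' (m * v - u) v"
proof -
  interpret v: frobenius_field "TYPE('c)" "q ^ v" by (rule frobenius_field_power)
  let ?s = "map_mat (frob_fls (q ^ v)) :: 'c fls mat \<Rightarrow> _"
  obtain P Pi U Ui where P: "P \<in> carrier_mat r r" "Pi \<in> carrier_mat r r" "P * Pi = 1\<^sub>m r" "Pi * P = 1\<^sub>m r"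
    and U: "U \<in> carrier_mat r r" "Ui \<in> carrier_mat r r" "U * Ui = 1\<^sub>m r" "Ui * U = 1\<^sub>m r"
      "fls_mat_le 0 U" "fls_mat_le 0 Ui"
    and eq: "?s P * frob_pow q Q v = fls_X_inv ^ u \<cdot>\<^sub>m (U * P)"
    using assms(6) unfolding pure_matrix_def by (elim exE conjE) (rule that)
  let ?A = "frob_pow q Q v" and ?B = "frob_pow q Q' v"
  have AB: "?A \<in> carrier_mat r r" "?B \<in> carrier_mat r r" using Q Q' by auto
  obtain d where d: "d \<noteq> 0" "fls_subdegree d = - int (m * v)" "?B * transpose_mat ?A = d \<cdot>\<^sub>m 1\<^sub>m r"
    using frob_pow_dual[OF Q Q' dual c] by blast
  note mc = mult_carrier_mat[of _ r r _ r] and assoc = assoc_mult_mat[of _ r r _ r _ r]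
  have Xu: "fls_X_inv ^ n * fls_X ^ n = (1 :: 'c fls)" for n
  proof -
    have "fls_X_inv * fls_X = (1 :: 'c fls)"
      by (rule fls_eqI) (simp add: fls_X_inv_times_conv_shift)
    then show ?thesis by (simp flip: power_mult_distrib)
  qed
  \<comment> \<open>\<open>L\<close> is the left side of the wanted equation and \<open>R\<close>
    the transpose of the given one. Since \<open>L * R\<close> is the scalar \<open>d\<close> and
    \<open>E\<close> is the inverse of \<open>R\<close>, it follows that \<open>L\<close> equals
    \<open>d\<close> times \<open>E\<close>.\<close>
  define L where "L = transpose_mat (?s Pi) * ?B"
  define R where "R = transpose_mat (?s P * ?A)"
  define E where "E = fls_X ^ u \<cdot>\<^sub>m transpose_mat (Pi * Ui)"
  have car: "L \<in> carrier_mat r r" "R \<in> carrier_mat r r" "E \<in> carrier_mat r r"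
    using P U AB by (auto simp: L_def R_def E_def mc)
  have LR: "L * R = d \<cdot>\<^sub>m 1\<^sub>m r"
  proof -
    have sP: "transpose_mat (?s P) \<in> carrier_mat r r" "transpose_mat (?s Pi) \<in> carrier_mat r r"
      using P by auto
    have "L * R = transpose_mat (?s Pi) * ?B * (transpose_mat ?A * transpose_mat (?s P))"
      unfolding L_def R_def using P AB by (subst transpose_mult[of _ r r _ r]) auto
    also have "\<dots> = transpose_mat (?s Pi) * (?B * transpose_mat ?A * transpose_mat (?s P))"
      using sP AB by (simp add: assoc mc)
    also have "\<dots> = d \<cdot>\<^sub>m (transpose_mat (?s Pi) * transpose_mat (?s P))"
      unfolding d(3) using sP
      by (simp add: mult_smult_assoc_mat[of _ r r _ r] mult_smult_distrib[of _ r r _ r] left_mult_one_mat[of _ r r])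
    also have "transpose_mat (?s Pi) * transpose_mat (?s P) = transpose_mat (?s (P * Pi))"
      using P(1,2) by (simp add: v.map_mat_frob_mult[of _ r r _ r] transpose_mult[of _ r r _ r])
    also have "\<dots> = 1\<^sub>m r" unfolding P(3) by simp
    finally show ?thesis .
  qed
  have RE: "R * E = 1\<^sub>m r"
  proof -
    have "R * E = (fls_X ^ u * fls_X_inv ^ u) \<cdot>\<^sub>m (transpose_mat (U * P) * transpose_mat (Pi * Ui))"
      unfolding R_def E_def eq transpose_smult using P(1,2) U(1,2)
      by (simp add: mult_smult_assoc_mat[of _ r r _ r] mult_smult_distrib[of _ r r _ r] smult_smult_mat mc)
    also have "transpose_mat (U * P) * transpose_mat (Pi * Ui) = transpose_mat (Pi * Ui * (U * P))"
      using P(1,2) U(1,2) by (simp add: transpose_mult[of _ r r _ r] mc)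
    also have "Pi * Ui * (U * P) = Pi * (Ui * U * P)"
      using P(1,2) U(1,2) by (simp add: assoc mc)
    also have "\<dots> = 1\<^sub>m r" unfolding U(4) using P by (simp add: left_mult_one_mat[of _ r r])
    finally show ?thesis
      by (simp add: Xu mult.commute[of "fls_X ^ u"]) (auto intro!: eq_matI)
  qed
  have "L = L * (R * E)" unfolding RE using car by (simp add: right_mult_one_mat[of _ r r])
  also have "\<dots> = L * R * E" using car by (simp add: assoc)
  also have "\<dots> = d \<cdot>\<^sub>m E"
    unfolding LR using car by (simp add: mult_smult_assoc_mat[of _ r r _ r] left_mult_one_mat[of _ r r])
  finally have L: "L = d \<cdot>\<^sub>m E" .
  \<comment> \<open>Removing \<open>T^(m * v)\<close> from \<open>d\<close> leaves a series of
    degree 0, hence a unit that can be absorbed into the matrix \<open>U\<close> of the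
    dual.\<close>
  define w where "w = d * fls_X ^ (m * v)"
  have w: "w \<noteq> 0" "fls_subdegree w = 0"
    using d by (auto simp: w_def)
  have wi: "fls_deg_le 0 w" "fls_deg_le 0 (inverse w)"
    using w by (auto simp: fls_deg_le_iff fls_inverse_subdegree)
  have dw: "d * fls_X ^ u = fls_X_inv ^ (m * v - u) * w"
  proof -
    have "m * v = (m * v - u) + u" using less by simp
    then have "fls_X ^ (m * v) = fls_X ^ (m * v - u) * (fls_X ^ u :: 'c fls)"
      by (metis power_add)
    then have "fls_X_inv ^ (m * v - u) * w =
        d * fls_X ^ u * (fls_X_inv ^ (m * v - u) * fls_X ^ (m * v - u))"
      by (simp add: w_def mult_ac)
    then show ?thesis by (simp only: Xu mult_1_right)
  qed
  have "?s (transpose_mat Pi) * ?B = L" by (simp add: L_def map_mat_transpose)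
  also have "\<dots> = (fls_X_inv ^ (m * v - u) * w) \<cdot>\<^sub>m transpose_mat (Pi * Ui)"
    unfolding L E_def by (simp add: smult_smult_mat dw)
  also have "\<dots> = fls_X_inv ^ (m * v - u) \<cdot>\<^sub>m ((w \<cdot>\<^sub>m transpose_mat Ui) * transpose_mat Pi)"
    using P(1,2) U(1,2) by (simp add: smult_smult_mat transpose_mult[of _ r r _ r] mult_smult_assoc_mat[of _ r r _ r])
  finally have main: "?s (transpose_mat Pi) * ?B =
    fls_X_inv ^ (m * v - u) \<cdot>\<^sub>m ((w \<cdot>\<^sub>m transpose_mat Ui) * transpose_mat Pi)" .
  have tr1: "transpose_mat (1\<^sub>m r) = (1\<^sub>m r :: 'c fls mat)" by simp
  have tr: "transpose_mat A * transpose_mat B = 1\<^sub>m r"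
    if "A \<in> carrier_mat r r" "B \<in> carrier_mat r r" "B * A = 1\<^sub>m r" for A B :: "'c fls mat"
    using transpose_mult[OF that(2,1)] that(3) tr1 by simp
  have inv: "(a \<cdot>\<^sub>m transpose_mat A) * (b \<cdot>\<^sub>m transpose_mat B) = 1\<^sub>m r"
    if "A \<in> carrier_mat r r" "B \<in> carrier_mat r r" "B * A = 1\<^sub>m r" "a * b = 1" for A B :: "'c fls mat" and a b
  proof -
    have "(a \<cdot>\<^sub>m transpose_mat A) * (b \<cdot>\<^sub>m transpose_mat B) = (a * b) \<cdot>\<^sub>m 1\<^sub>m r"
      using that tr[OF that(1-3)]
      by (simp add: mult_smult_assoc_mat[of _ r r _ r] mult_smult_distrib[of _ r r _ r] smult_smult_mat
          mult.commute)
    then show ?thesis using that(4) by (auto intro!: eq_matI)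
  qed
  show ?thesis
    unfolding pure_matrix_def
  proof (intro exI conjI)
    show "transpose_mat Pi * transpose_mat P = 1\<^sub>m r" "transpose_mat P * transpose_mat Pi = 1\<^sub>m r"
      using P by (auto intro: tr)
    show "(w \<cdot>\<^sub>m transpose_mat Ui) * (inverse w \<cdot>\<^sub>m transpose_mat U) = 1\<^sub>m r"
      using U w by (intro inv) auto
    show "(inverse w \<cdot>\<^sub>m transpose_mat U) * (w \<cdot>\<^sub>m transpose_mat Ui) = 1\<^sub>m r"
      using U w by (intro inv) auto
    show "fls_mat_le 0 (w \<cdot>\<^sub>m transpose_mat Ui)" "fls_mat_le 0 (inverse w \<cdot>\<^sub>m transpose_mat U)"
      using fls_mat_le_smult[of 0 _ 0] wi U by fastforce+
  qed (use P U main in auto)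
qed

end

section \<open>The dual as a second action on the group of M\<close>

context motive_basis
begin

text \<open>The dual lives on the additive group of M with the same action of
  \<open>\<complex>\<^sub>\<infinity>[T]\<close> and the same basis \<open>f\<close>; only \<tau> is
  replaced, by the semilinear map with matrix \<open>Q'\<close>.\<close>

definition semilinear :: "'c poly mat \<Rightarrow> 'm \<Rightarrow> 'm" where
  "semilinear Q' x = (\<Sum>j<r. pm (\<Sum>i<r. frob_poly q (co x i) * Q' $$ (i, j)) (f j))"

definition semilinear_act :: "'c poly mat \<Rightarrow> 'c poly poly \<Rightarrow> 'm \<Rightarrow> 'm" where
  "semilinear_act Q' s x = (\<Sum>i\<le>Polynomial.degree s. pm (Polynomial.coeff s i) ((semilinear Q' ^^ i) x))"

lemma co_semilinear:
  "j < r \<Longrightarrow> co (semilinear Q' x) j = (\<Sum>i<r. frob_poly q (co x i) * Q' $$ (i, j))"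
  by (rule co_unique) (simp_all only: semilinear_def)

lemma semilinear_add: "semilinear Q' (x + y) = semilinear Q' x + semilinear Q' y"
proof -
  interpret s: comm_ring_hom "frob_poly q :: 'c poly \<Rightarrow> 'c poly" by (rule comm_ring_hom_frob_poly)
  show ?thesis
    by (rule co_eqI) (simp add: co_add co_semilinear s.hom_add distrib_right sum.distrib)
qed

lemma semilinear_pm: "semilinear Q' (pm p x) = pm (frob_poly q p) (semilinear Q' x)"
proof -
  interpret s: comm_ring_hom "frob_poly q :: 'c poly \<Rightarrow> 'c poly" by (rule comm_ring_hom_frob_poly)
  show ?thesis
    by (rule co_eqI) (simp add: co_pm co_semilinear s.hom_mult sum_distrib_left mult.assoc)
qed

lemma semilinear_pow_add:
  "(semilinear Q' ^^ i) (x + y) = (semilinear Q' ^^ i) x + (semilinear Q' ^^ i) y"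
  by (induction i) (auto simp: semilinear_add)

lemma semilinear_pow_zero: "(semilinear Q' ^^ i) 0 = 0"
  using semilinear_pow_add[of i Q' 0 0] by simp

lemma semilinear_pow_sum:
  "(semilinear Q' ^^ i) (\<Sum>j\<in>J. x j) = (\<Sum>j\<in>J. (semilinear Q' ^^ i) (x j))"
  by (induction J rule: infinite_finite_induct) (auto simp: semilinear_pow_add semilinear_pow_zero)

lemma semilinear_pow_pm:
  "(semilinear Q' ^^ i) (pm p x) = pm ((frob_poly q ^^ i) p) ((semilinear Q' ^^ i) x)"
  by (induction i) (auto simp: semilinear_pm)

lemma semilinear_act_eq:
  assumes "Polynomial.degree s \<le> N"
  shows "semilinear_act Q' s x = (\<Sum>i\<le>N. pm (Polynomial.coeff s i) ((semilinear Q' ^^ i) x))"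
  unfolding semilinear_act_def using assms
  by (intro sum.mono_neutral_left) (auto simp: coeff_eq_0)

lemma semilinear_act_add_left: "semilinear_act Q' (s + t) x = semilinear_act Q' s x + semilinear_act Q' t x"
proof -
  let ?N = "max (Polynomial.degree s) (Polynomial.degree t)"
  have "semilinear_act Q' (s + t) x = (\<Sum>i\<le>?N. pm (Polynomial.coeff (s + t) i) ((semilinear Q' ^^ i) x))"
    by (rule semilinear_act_eq) (rule degree_add_le_max)
  then show ?thesis
    by (simp only: semilinear_act_eq[of s ?N] semilinear_act_eq[of t ?N] max.cobounded1 max.cobounded2
        coeff_add pm_add sum.distrib)
qed

lemma semilinear_act_zero_left [simp]: "semilinear_act Q' 0 x = 0"
  by (simp add: semilinear_act_def)

lemma semilinear_act_sum_left: "semilinear_act Q' (\<Sum>i\<in>I. s i) x = (\<Sum>i\<in>I. semilinear_act Q' (s i) x)"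
  by (induction I rule: infinite_finite_induct) (auto simp: semilinear_act_add_left)

lemma semilinear_act_monom: "semilinear_act Q' (Polynomial.monom p k) x = pm p ((semilinear Q' ^^ k) x)"
proof -
  have "semilinear_act Q' (Polynomial.monom p k) x =
      (\<Sum>i\<le>k. if k = i then pm p ((semilinear Q' ^^ k) x) else 0)"
    by (subst semilinear_act_eq[OF degree_monom_le]) (rule sum.cong, auto)
  then show ?thesis by simp
qed

lemma semilinear_act_pm [simp]: "semilinear_act Q' [:p:] x = pm p x"
  using semilinear_act_monom[of Q' p 0] by (simp add: monom_0)

lemma semilinear_act_tau [simp]: "semilinear_act Q' sk_tau x = semilinear Q' x"
  using semilinear_act_monom[of Q' 1 1] by (simp add: sk_tau_def monom_altdef One_nat_def)

lemma skew_module_semilinear_act: "skew_module q (semilinear_act Q')"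
  unfolding skew_module_def
proof (intro conjI allI)
  fix s t x y
  show "semilinear_act Q' s (x + y) = semilinear_act Q' s x + semilinear_act Q' s y"
    by (simp add: semilinear_act_def semilinear_pow_add act_add_right sum.distrib)
  show "semilinear_act Q' (s + t) x = semilinear_act Q' s x + semilinear_act Q' t x" by (rule semilinear_act_add_left)
  show "semilinear_act Q' (skew_mult q s t) x = semilinear_act Q' s (semilinear_act Q' t x)"
  proof -
    have "semilinear_act Q' s (semilinear_act Q' t x) = (\<Sum>i\<le>Polynomial.degree s. \<Sum>j\<le>Polynomial.degree t.
        pm (Polynomial.coeff s i * (frob_poly q ^^ i) (Polynomial.coeff t j)) ((semilinear Q' ^^ (i + j)) x))"
      by (simp only: semilinear_act_def semilinear_pow_sum semilinear_pow_pm act_sum_right pm_mult funpow_add comp_apply)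
    then show ?thesis
      by (simp only: skew_mult_def semilinear_act_sum_left semilinear_act_monom)
  qed
  show "semilinear_act Q' 1 x = x" using semilinear_act_pm[of Q' 1 x] by (simp only: act_1 flip: one_pCons)
qed

lemma motive_basis_semilinear_act:
  assumes "Q' \<in> carrier_mat r r"
  shows "motive_basis q (semilinear_act Q') r f Q'"
proof -
  interpret M': skew_mod q "semilinear_act Q'"
    by unfold_locales (rule skew_module_semilinear_act)
  show ?thesis
  proof
    show "is_basis (semilinear_act Q') sk_ring_T r f"
    proof (rule M'.basis_TI)
      show "\<exists>c. x = (\<Sum>i<r. semilinear_act Q' [:c i:] (f i))" for x
        using co[of x] unfolding semilinear_act_pm by (intro exI)
      show "c i = 0" if "(\<Sum>i<r. semilinear_act Q' [:c i:] (f i)) = 0" "i < r" for c i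
        using that unfolding semilinear_act_pm by (rule basis_T_indep[OF basis])
    qed
    have "semilinear Q' (f i) = (\<Sum>j<r. pm (Q' $$ (i, j)) (f j))" if "i < r" for i
    proof -
      interpret s: comm_ring_hom "frob_poly q :: 'c poly \<Rightarrow> 'c poly" by (rule comm_ring_hom_frob_poly)
      have "(\<Sum>l<r. frob_poly q (co (f i) l) * Q' $$ (l, j)) = Q' $$ (i, j)" for j
      proof -
        have "(\<Sum>l<r. frob_poly q (co (f i) l) * Q' $$ (l, j)) = (\<Sum>l<r. if l = i then Q' $$ (l, j) else 0)"
          using that by (intro sum.cong) (auto simp: co_basis)
        then show ?thesis using that by simp
      qed
      then show ?thesis by (simp add: semilinear_def)
    qed
    then show "tau_matrix (semilinear_act Q') r f Q'" using assms by (simp add: tau_matrix_def)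
  qed
qed

text \<open>Writing \<open>(T - \<theta>)^m f_i\<close> as \<tau>\<open>x_i\<close> and comparing
  coordinates gives \<sigma>\<open>(X) Q = (T - \<theta>)^m\<close>, with the coordinates of the
  \<open>x_i\<close> as rows of \<open>X\<close>. Hence \<open>(T - \<theta>)^m Q^-1\<close> is the
  polynomial matrix \<sigma>\<open>(X)\<close>, and \<open>Q'\<close> is its transpose.\<close>

lemma kills_coker_dual_matrix:
  assumes "kills_coker \<theta> m act"
  shows "\<exists>Q'. Q' \<in> carrier_mat r r \<and> transpose_mat Q' * Q = [:- \<theta>, 1:] ^ m \<cdot>\<^sub>m 1\<^sub>m r"
proof -
  let ?\<psi> = "[:- \<theta>, 1:] ^ m"
  have "\<forall>i. \<exists>x. pm ?\<psi> (f i) = tau x"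
    using assms unfolding kills_coker_def by blast
  then obtain x where x: "\<And>i. pm ?\<psi> (f i) = tau (x i)" by metis
  define Q' where "Q' = mat r r (\<lambda>(i, j). frob_poly q (co (x j) i))"
  have "(transpose_mat Q' * Q) $$ (i, j) = (?\<psi> \<cdot>\<^sub>m 1\<^sub>m r) $$ (i, j)" if "i < r" "j < r" for i j
  proof -
    have "(transpose_mat Q' * Q) $$ (i, j) = (\<Sum>l<r. frob_poly q (co (x i) l) * Q $$ (l, j))"
      using that by (simp add: Q'_def scalar_prod_def atLeast0LessThan)
    also have "\<dots> = co (pm ?\<psi> (f i)) j" using that by (simp add: co_tau x)
    also have "\<dots> = (?\<psi> \<cdot>\<^sub>m 1\<^sub>m r) $$ (i, j)" using that by (simp add: co_pm co_basis)
    finally show ?thesis .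
  qed
  then have "transpose_mat Q' * Q = ?\<psi> \<cdot>\<^sub>m 1\<^sub>m r"
    by (intro eq_matI) (auto simp: Q'_def)
  moreover have "Q' \<in> carrier_mat r r" by (simp add: Q'_def)
  ultimately show ?thesis by blast
qed

text \<open>A preimage of \<open>(T - \<theta>)^m x\<close> must have coordinates \<open>Y\<close>
  with \<sigma>\<open>(Y) Q' = (T - \<theta>)^m X\<close>, where \<open>X\<close> is the coordinate
  row of \<open>x\<close>. By \<open>dual\<close> it suffices that
  \<sigma>\<open>(Y) = X Q^t\<close>, which is solvable because the twist is surjective on
  polynomials.\<close>

lemma kills_coker_semilinear_act:
  assumes Q': "Q' \<in> carrier_mat r r" and dual: "transpose_mat Q * Q' = [:- \<theta>, 1:] ^ m \<cdot>\<^sub>m 1\<^sub>m r"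
  shows "kills_coker \<theta> m (semilinear_act Q')"
  unfolding kills_coker_def
proof safe
  let ?\<psi> = "[:- \<theta>, 1:] ^ m"
  fix x
  have "\<forall>k. \<exists>p. frob_poly q p = (\<Sum>i<r. co x i * Q $$ (k, i))"
    using frob_poly_surj by blast
  then obtain p where p: "\<And>k. frob_poly q (p k) = (\<Sum>i<r. co x i * Q $$ (k, i))" by metis
  define y where "y = (\<Sum>k<r. pm (p k) (f k))"
  have "pm ?\<psi> x = semilinear Q' y"
  proof (rule co_eqI)
    fix j assume j: "j < r"
    have "co (semilinear Q' y) j = (\<Sum>k<r. \<Sum>i<r. co x i * (Q $$ (k, i) * Q' $$ (k, j)))"
      using j co_unique[OF y_def] by (simp add: co_semilinear p sum_distrib_right mult.assoc)
    also have "\<dots> = (\<Sum>i<r. co x i * (\<Sum>k<r. Q $$ (k, i) * Q' $$ (k, j)))"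
      by (subst sum.swap) (simp add: sum_distrib_left)
    also have "\<dots> = (\<Sum>i<r. co x i * (transpose_mat Q * Q') $$ (i, j))"
      using j Q' by (intro sum.cong) (auto simp: scalar_prod_def atLeast0LessThan)
    also have "\<dots> = (\<Sum>i<r. if i = j then co x i * ?\<psi> else 0)"
      unfolding dual using j by (intro sum.cong) auto
    also have "\<dots> = co (pm ?\<psi> x) j" using j by (simp add: co_pm)
    finally show "co (pm ?\<psi> x) j = co (semilinear Q' y) j" by simp
  qed
  then show "semilinear_act Q' [:?\<psi>:] x \<in> range (semilinear_act Q' sk_tau)" by simp
qed

end

section \<open>Matrix inverses over the fraction field\<close>

lemma to_fract_eq_iff: "to_fract a = to_fract b \<longleftrightarrow> a = (b :: 'a::idom)"
  by (simp add: to_fract_def eq_fract)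

interpretation fract: comm_ring_hom "to_fract :: 'a::idom \<Rightarrow> 'a fract"
  by unfold_locales (auto simp: to_fract_def One_fract_def Zero_fract_def)

lemma map_mat_to_fract_eqD:
  assumes "map_mat to_fract A = map_mat to_fract (B :: 'a::idom mat)"
  shows "A = B"
proof (rule eq_matI)
  show "dim_row A = dim_row B" "dim_col A = dim_col B"
    using arg_cong[OF assms, of dim_row] arg_cong[OF assms, of dim_col] by auto
  then show "A $$ (i, j) = B $$ (i, j)" if "i < dim_row B" "j < dim_col B" for i j
    using that arg_cong[OF assms, of "\<lambda>M. M $$ (i, j)"] by (simp add: to_fract_eq_iff)
qed

lemma map_mat_smult: "(\<And>x. h (c * x) = h c * h x) \<Longrightarrow> map_mat h (c \<cdot>\<^sub>m A) = h c \<cdot>\<^sub>m map_mat h A"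
  by (rule eq_matI) auto

text \<open>Two bases of M over \<open>\<complex>\<^sub>\<infinity>[T]\<close> occur with separate
  lengths: \<open>f\<close> carries the matrix identity, \<open>f0\<close> the inequality. The
  weight inequality is applied to \<open>f0\<close>, and \<open>r0 u \<le> n0 v < r0 m v\<close>
  gives \<open>u < m v\<close>.\<close>

lemma pure_of_dual:
  fixes M :: "'c::field poly poly \<Rightarrow> 'm::ab_group_add \<Rightarrow> 'm"
    and M' :: "'c poly poly \<Rightarrow> 'n::ab_group_add \<Rightarrow> 'n"
  assumes basis: "motive_basis q M r f Q" and basis': "motive_basis q M' r f' Q'"
    and dual: "Q' * transpose_mat Q = [:- \<theta>, 1:] ^ m \<cdot>\<^sub>m 1\<^sub>m r"
    and pure: "pure_motive q M"
    and T_basis: "is_basis M sk_ring_T r0 f0" and tau_basis: "is_basis M sk_ring_tau n0 g"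
    and less: "n0 < r0 * m"
  shows "\<exists>u>0. \<exists>v>0. pure_matrix q r (map_mat poly_to_fls_inv Q') u v"
proof -
  interpret M: motive_basis q M r f Q by fact
  interpret M': motive_basis q M' r f' Q' by fact
  obtain u v where uv: "u > 0" "v > 0" "pure_matrix q r M.Qh u v"
    using pure M.pure_motive_iff by blast
  obtain P Pi U Ui where "pure_motive_basis q M r f Q u v P Pi U Ui"
    using M.pure_matrix_basis[OF uv(3,1,2)] by blast
  then interpret pm: pure_motive_basis q M r f Q u v P Pi U Ui .
  have le: "r0 * u \<le> n0 * v" by (rule pm.weight_le[OF T_basis tau_basis])
  have "u < m * v"
  proof (rule ccontr)
    assume "\<not> u < m * v"
    then have "r0 * (m * v) \<le> r0 * u" by simp
    also note le
    finally have "r0 * m * v \<le> n0 * v" by (simp add: mult.assoc)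
    then show False using less uv(2) by simp
  qed
  moreover have "pure_matrix q r M'.Qh (m * v - u) v"
  proof (rule M.pure_matrix_dual[OF M.Qh_carrier M'.Qh_carrier _ _ _ uv(3)])
    show "M'.Qh * transpose_mat M.Qh = poly_to_fls_inv ([:- \<theta>, 1:] ^ m) \<cdot>\<^sub>m 1\<^sub>m r"
    proof -
      have "M'.Qh * transpose_mat M.Qh = map_mat poly_to_fls_inv (Q' * transpose_mat Q)"
        unfolding M.Qh_def M'.Qh_def map_mat_transpose
        by (rule pfi.mat_hom_mult[symmetric, of _ r r _ r]) auto
      then show ?thesis
        unfolding dual by (simp add: map_mat_smult pfi.hom_mult pfi.mat_hom_one)
    qed
    show "fls_subdegree (poly_to_fls_inv ([:- \<theta>, 1:] ^ m)) = - int m"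
      by (rule fls_subdegree_linear_power)
  qed (use \<open>u < m * v\<close> in auto)
  ultimately show ?thesis
    using uv(2) unfolding M'.Qh_def by (intro exI[of _ "m * v - u"] exI[of _ v] conjI) auto
qed

text \<open>Over the fraction field \<open>A\<close> divided by \<open>c\<close> is a one-sided
  inverse of the square matrix \<open>B\<close>, hence a two-sided one.\<close>

lemma mult_eq_smult_one_commute:
  fixes A B :: "'a::idom mat"
  assumes A: "A \<in> carrier_mat r r" and B: "B \<in> carrier_mat r r"
    and AB: "A * B = c \<cdot>\<^sub>m 1\<^sub>m r" and c: "c \<noteq> 0"
  shows "B * A = c \<cdot>\<^sub>m 1\<^sub>m r"
proof -
  let ?h = "map_mat to_fract :: 'a mat \<Rightarrow> 'a fract mat"
  have hc: "to_fract c \<noteq> 0" using c to_fract_eq_iff[of c 0] by simp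
  have smult: "?h (c \<cdot>\<^sub>m 1\<^sub>m r) = to_fract c \<cdot>\<^sub>m 1\<^sub>m r"
    by (simp add: map_mat_smult fract.hom_mult fract.mat_hom_one)
  define A' where "A' = inverse (to_fract c) \<cdot>\<^sub>m ?h A"
  have A': "A' \<in> carrier_mat r r" and B': "?h B \<in> carrier_mat r r" using A B by (auto simp: A'_def)
  have hA: "?h A = to_fract c \<cdot>\<^sub>m A'" using hc by (auto simp: A'_def smult_smult_mat intro!: eq_matI)
  have "A' * ?h B = inverse (to_fract c) \<cdot>\<^sub>m ?h (A * B)"
    using A B by (simp add: A'_def mult_smult_assoc_mat[of _ r r _ r] fract.mat_hom_mult[of _ r r _ r])
  also have "\<dots> = 1\<^sub>m r" unfolding AB smult using hc by (auto simp: smult_smult_mat intro!: eq_matI)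
  finally have "?h B * A' = 1\<^sub>m r" by (rule mat_mult_left_right_inverse[OF A' B'])
  then have "?h (B * A) = to_fract c \<cdot>\<^sub>m 1\<^sub>m r"
    using A B A' B' by (simp add: fract.mat_hom_mult[of _ r r _ r] hA mult_smult_distrib[of _ r r _ r])
  then have "?h (B * A) = ?h (c \<cdot>\<^sub>m 1\<^sub>m r)" by (simp only: smult)
  then show ?thesis by (rule map_mat_to_fract_eqD)
qed

lemma (in skew_mod) tau_matrix_exists:
  assumes "is_basis act sk_ring_T r f"
  shows "\<exists>Q. motive_basis q act r f Q"
proof -
  have "\<forall>i. \<exists>c. tau (f i) = (\<Sum>j<r. pm (c j) (f j))"
    using basis_T_span[OF assms] by blast
  then obtain c where c: "\<And>i. tau (f i) = (\<Sum>j<r. pm (c i j) (f j))" by metis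
  have "motive_basis q act r f (mat r r (\<lambda>(i, j). c i j))"
    using assms c by unfold_locales (auto simp: tau_matrix_def)
  then show ?thesis ..
qed

theorem theorem10p3:
  fixes emb :: "'f::{field,finite} fls alg_closure \<Rightarrow> 'c::field"
    and av :: "'c \<Rightarrow> real"
    and M :: "'c poly poly \<Rightarrow> 'm::ab_group_add \<Rightarrow> 'm"
    and r n m :: nat
  assumes "C_infinity emb av"
    and "abelian_T_motive CARD('f) (theta emb) r n M"
    and "pure_motive CARD('f) M"
    and "m \<ge> 1"
    and "kills_coker (theta emb) m M"
    and "int r * int m - int n > 0"
  shows "(\<exists>M' :: 'c poly poly \<Rightarrow> 'm \<Rightarrow> 'm.
            is_mu_dual CARD('f) (theta emb) m M M' \<and> pure_motive CARD('f) M') \<and>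
         (\<forall>M' :: 'c poly poly \<Rightarrow> 'n::ab_group_add \<Rightarrow> 'n.
            is_mu_dual CARD('f) (theta emb) m M M' \<longrightarrow> pure_motive CARD('f) M')"
proof -
  let ?q = "CARD('f)" and ?\<theta> = "theta emb"
  let ?\<psi> = "[:- ?\<theta>, 1:] ^ m"
  interpret frobenius_field "TYPE('c)" ?q by (rule C_infinity.frobenius_field[OF assms(1)])
  have nz: "?\<psi> \<noteq> 0" by simp
  have "int n < int (r * m)" using assms(6) by simp
  then have less: "n < r * m" by (simp only: of_nat_less_iff)
  obtain f g where sk: "skew_module ?q M" and f: "is_basis M sk_ring_T r f"
      and g: "is_basis M sk_ring_tau n g"
    using assms(2) unfolding abelian_T_motive_def by blast
  interpret skew_mod ?q M by unfold_locales (rule sk)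
  \<comment> \<open>The carrier type of the dual is left general, since this is used both for the
    dual on the group of M and for a given dual on another type.\<close>
  have pure': "pure_motive ?q M'"
    if "motive_basis ?q M r' f1 Q" "motive_basis ?q M' r' f' Q'"
      "Q' * transpose_mat Q = ?\<psi> \<cdot>\<^sub>m 1\<^sub>m r'"
    for M' :: "'c poly poly \<Rightarrow> 'k::ab_group_add \<Rightarrow> 'k" and r' f1 Q f' Q'
    using pure_of_dual[OF that assms(3) f g less] motive_basis.pure_motive_iff[OF that(2)]
      motive_basis.Qh_def[OF that(2)] by simp
  show ?thesis
  proof (intro conjI allI impI)
    obtain Q where "motive_basis ?q M r f Q" using tau_matrix_exists[OF f] by blast
    then interpret M: motive_basis ?q M r f Q .
    obtain Q' where Q': "Q' \<in> carrier_mat r r" "transpose_mat Q' * Q = ?\<psi> \<cdot>\<^sub>m 1\<^sub>m r"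
      using M.kills_coker_dual_matrix[OF assms(5)] by blast
    have Qt: "transpose_mat Q \<in> carrier_mat r r" by simp
    have dual: "transpose_mat Q * Q' = ?\<psi> \<cdot>\<^sub>m 1\<^sub>m r"
      using arg_cong[OF Q'(2), of transpose_mat] Q'(1)
      by (simp add: transpose_mult[of _ r r _ r] transpose_smult)
    have dual': "Q' * transpose_mat Q = ?\<psi> \<cdot>\<^sub>m 1\<^sub>m r"
      by (rule mult_eq_smult_one_commute[OF Qt Q'(1) dual nz])
    let ?M' = "M.semilinear_act Q'"
    have basis': "motive_basis ?q ?M' r f Q'" by (rule M.motive_basis_semilinear_act[OF Q'(1)])
    interpret M': motive_basis ?q ?M' r f Q' by (rule basis')
    \<comment> \<open>Purity of the dual comes before the proof that it is an abelian T-motive: its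
      filtration supplies the basis over
      \<open>\<complex>\<^sub>\<infinity>[\<tau>]\<close>.\<close>
    obtain u v where uv: "u > 0" "v > 0" "pure_matrix ?q r M'.Qh u v"
      using pure_of_dual[OF M.motive_basis_axioms basis' dual' assms(3) f g less]
      unfolding M'.Qh_def by blast
    obtain P Pi U Ui where "pure_motive_basis ?q ?M' r f Q' u v P Pi U Ui"
      using M'.pure_matrix_basis[OF uv(3,1,2)] by blast
    then obtain n' g' where g': "is_basis ?M' sk_ring_tau n' g'"
      using pure_motive_basis.tau_basis_exists by blast
    have "kills_coker ?\<theta> m ?M'" by (rule M.kills_coker_semilinear_act[OF Q'(1) dual])
    then have abelian: "abelian_T_motive ?q ?\<theta> r n' ?M'"
      unfolding abelian_T_motive_def using M'.skew_module M'.basis g' by blast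
    let ?h = "map_mat to_fract :: 'c poly mat \<Rightarrow> _"
    define R where "R = inverse (to_fract ?\<psi>) \<cdot>\<^sub>m ?h Q'"
    have hnz: "to_fract ?\<psi> \<noteq> 0" using nz to_fract_eq_iff[of ?\<psi> 0] by simp
    have R: "R \<in> carrier_mat r r" using Q'(1) by (simp add: R_def)
    have hQt: "transpose_mat (?h Q) \<in> carrier_mat r r" by simp
    have hone: "?h (?\<psi> \<cdot>\<^sub>m 1\<^sub>m r) = to_fract ?\<psi> \<cdot>\<^sub>m 1\<^sub>m r"
      by (simp only: map_mat_smult fract.hom_mult fract.mat_hom_one)
    have "transpose_mat (?h Q) * R = inverse (to_fract ?\<psi>) \<cdot>\<^sub>m ?h (transpose_mat Q * Q')"
      using Q'(1) Qt unfolding R_def map_mat_transpose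
      by (simp add: mult_smult_distrib[of _ r r _ r] fract.mat_hom_mult[of _ r r _ r])
    also have "\<dots> = 1\<^sub>m r"
      unfolding dual hone smult_smult_mat using hnz by (auto intro!: eq_matI)
    finally have QR: "transpose_mat (?h Q) * R = 1\<^sub>m r" .
    have RQ: "R * transpose_mat (?h Q) = 1\<^sub>m r"
      by (rule mat_mult_left_right_inverse[OF hQt R QR])
    have "?h Q' = to_fract ?\<psi> \<cdot>\<^sub>m R"
      unfolding R_def smult_smult_mat using hnz by (auto intro!: eq_matI)
    then have "is_mu_dual ?q ?\<theta> m M ?M'"
      unfolding is_mu_dual_def using abelian f M.tau_matrix M'.basis M'.tau_matrix R QR RQ
      by (intro conjI exI[of _ r] exI[of _ n'] exI[of _ f] exI[of _ Q] exI[of _ Q'] exI[of _ R])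
        (auto simp: inverts_mat_def)
    moreover have "pure_motive ?q ?M'" by (rule pure'[OF M.motive_basis_axioms basis' dual'])
    ultimately show "\<exists>M' :: 'c poly poly \<Rightarrow> 'm \<Rightarrow> 'm. is_mu_dual ?q ?\<theta> m M M' \<and> pure_motive ?q M'"
      by blast
  next
    fix M' :: "'c poly poly \<Rightarrow> 'n \<Rightarrow> 'n"
    assume "is_mu_dual ?q ?\<theta> m M M'"
    then obtain r0 n0 r' f1 Q f' Q' R where abelian: "abelian_T_motive ?q ?\<theta> r0 n0 M'"
      and *: "is_basis M sk_ring_T r' f1" "tau_matrix M r' f1 Q"
        "is_basis M' sk_ring_T r' f'" "tau_matrix M' r' f' Q'" "R \<in> carrier_mat r' r'"
        "inverts_mat R (transpose_mat (map_mat to_fract Q))"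
        "map_mat to_fract Q' = to_fract ?\<psi> \<cdot>\<^sub>m R"
      unfolding is_mu_dual_def by (elim exE conjE) (rule that)
    interpret M': skew_mod ?q M'
      using abelian by unfold_locales (auto simp: abelian_T_motive_def)
    have b: "motive_basis ?q M r' f1 Q" using * by unfold_locales
    have b': "motive_basis ?q M' r' f' Q'" using * by unfold_locales
    have Q: "Q \<in> carrier_mat r' r'" "Q' \<in> carrier_mat r' r'"
      using * by (auto simp: tau_matrix_def)
    \<comment> \<open>The description of a dual by an inverse over the fraction field is brought
      back to an identity of polynomial matrices, the form in which \<open>pure'\<close> takes
      it.\<close>
    have "map_mat to_fract (Q' * transpose_mat Q) =
        map_mat to_fract Q' * transpose_mat (map_mat to_fract Q)"
      using Q by (simp add: fract.mat_hom_mult[of _ r' r' _ r'] map_mat_transpose)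
    also have "\<dots> = to_fract ?\<psi> \<cdot>\<^sub>m (R * transpose_mat (map_mat to_fract Q))"
      unfolding *(7) using *(5) Q by (intro mult_smult_assoc_mat[of _ r' r' _ r']) auto
    also have "R * transpose_mat (map_mat to_fract Q) = 1\<^sub>m r'"
      using *(5,6) by (simp add: inverts_mat_def)
    also have "to_fract ?\<psi> \<cdot>\<^sub>m 1\<^sub>m r' = map_mat to_fract (?\<psi> \<cdot>\<^sub>m 1\<^sub>m r')"
      by (simp only: map_mat_smult fract.hom_mult fract.mat_hom_one)
    finally have "Q' * transpose_mat Q = ?\<psi> \<cdot>\<^sub>m 1\<^sub>m r'" by (rule map_mat_to_fract_eqD)
    then show "pure_motive ?q M'" by (rule pure'[OF b b'])
  qed
qed

end
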